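(* Let $T\in(0,\infty)$, $S\in(0,T)$ and $K\in(0,\infty)$. The time $0$ price \[ \pi_C(0)=E^Q\left[e^{-\int_0^S r(s)ds}\,(P(S,T)-K)_+\right] \] of the European call option on the zero-coupon bond with maturity $T$, with option maturity $S$ and exercise price $K$, satisfies \[ \pi_C(0)=P(0,T)\Phi(d_+)-KP(0,S)\Phi(d_-), \] where \[ d_+:=\frac{1}{\sqrt{\Sigma^2(S)}}\left\{\log\left(\frac{P(0,T)}{KP(0,S)}\right)+\frac12\Sigma^2(S)\right\},\qquad d_-:=d_+-\sqrt{\Sigma^2(S)}, \] \[ \Sigma^2(S):=\int_0^S v_{S,T}^2(t)\,dt, \] \[ v_{S,T}(t):=\frac{\sigma}{b}\left\{e^{-b(T-t)}-e^{-b(S-t)}+l(t)\left(m(T-t)-m(S-t)\right)\right\}. \]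
   Context: Let $\{W^*(t)\}_{t\ge 0}$ be a one-dimensional standard Brownian motion on a complete probability space $(\Omega,\mathcal{F},Q)$ and let $\{\mathcal{F}_t\}_{t\ge 0}$ be the $Q$-augmentation of the filtration it generates. Let $p,q$ be real numbers with $0<q<\infty$ and $-q<p<\infty$. Define \[ l(\tau)=1-\frac{2qp}{(p+2q)^2e^{2q\tau}-p^2}\quad(\tau\ge 0), \] \[ Z(t)=W^*(t)-\int_0^t\left\{\int_0^s pe^{-(p+q)(s-\tau)}l(\tau)\,dW^*(\tau)\right\}ds\quad(t\ge 0). \] $Z$ is an It\^o process. Let $a,b,\sigma\in(0,\infty)$ and let $\{r(t)\}_{t\ge 0}$ (the short rate) be the unique strong solution of $dr(t)=\{a-br(t)\}dt+\sigma\,dZ(t)$, $t\ge 0$, with deterministic initial value $r(0)\in[0,\infty)$. $E^Q$ denotes expectation under $Q$. For $0\le t\le T$, the time $t$ price of the zero-coupon bond with maturity $T$ is $P(t,T)=E^Q\left[e^{-\int_t^T r(s)ds}\,\middle|\,\mathcal{F}_t\right]$. Further notation: $m(t):=\int_0^t pe^{-(p+q)s}\{1-e^{-b(t-s)}\}ds$ for $t\ge 0$; $(x)_+:=\max(x,0)$; $\Phi(x):=\int_{-\infty}^x\frac{1}{\sqrt{2\pi}}e^{-y^2/2}dy$ is the standard normal distribution function. *)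

theory Defs
  imports "HOL-Probability.Probability"
begin

section \<open>Brownian motion and its augmented filtration\<close>

text \<open>Processes are functions \<open>real \<Rightarrow> 'w \<Rightarrow> real\<close>; only times \<open>t \<ge> 0\<close> are relevant.\<close>

definition natural_filtration :: "'w measure \<Rightarrow> (real \<Rightarrow> 'w \<Rightarrow> real) \<Rightarrow> real \<Rightarrow> 'w measure" where
  "natural_filtration Q X t =
     sigma (space Q) {X s -` A \<inter> space Q | s A. s \<in> {0..t} \<and> A \<in> sets borel}"

definition augmented_filtration :: "'w measure \<Rightarrow> (real \<Rightarrow> 'w \<Rightarrow> real) \<Rightarrow> real \<Rightarrow> 'w measure" where
  "augmented_filtration Q X t =
     sigma (space Q) (sets (natural_filtration Q X t) \<union> null_sets Q)"

definition standard_brownian_motion :: "'w measure \<Rightarrow> (real \<Rightarrow> 'w \<Rightarrow> real) \<Rightarrow> bool" where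
  "standard_brownian_motion Q W \<longleftrightarrow>
     (\<forall>t\<ge>0. W t \<in> borel_measurable Q) \<and>
     (AE \<omega> in Q. W 0 \<omega> = 0) \<and>
     (\<forall>s t. 0 \<le> s \<and> s < t \<longrightarrow>
        distributed Q lborel (\<lambda>\<omega>. W t \<omega> - W s \<omega>) (normal_density 0 (sqrt (t - s))) \<and>
        prob_space.indep_set Q
          (sets (natural_filtration Q W s))
          (sets (vimage_algebra (space Q) (\<lambda>\<omega>. W t \<omega> - W s \<omega>) borel))) \<and>
     (AE \<omega> in Q. continuous_on {0..} (\<lambda>t. W t \<omega>))"

definition adapted_process ::
  "(real \<Rightarrow> 'w measure) \<Rightarrow> (real \<Rightarrow> 'w \<Rightarrow> real) \<Rightarrow> bool" where
  "adapted_process F X \<longleftrightarrow> (\<forall>t\<ge>0. X t \<in> borel_measurable (F t))"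


section \<open>The Ito integral\<close>

text \<open>
  A simple integrand is given by \<open>n\<close>, times \<open>\<tau> 0 \<le> \<dots> \<le> \<tau> n\<close> and bounded weights \<open>\<xi> i\<close>
  that are measurable at time \<open>\<tau> i\<close>.
\<close>

definition simple_integrand ::
  "'w measure \<Rightarrow> (real \<Rightarrow> 'w measure) \<Rightarrow> nat \<Rightarrow> (nat \<Rightarrow> real) \<Rightarrow> (nat \<Rightarrow> 'w \<Rightarrow> real) \<Rightarrow> bool" where
  "simple_integrand Q F n \<tau> \<xi> \<longleftrightarrow>
     0 \<le> \<tau> 0 \<and>
     (\<forall>i<n. \<tau> i \<le> \<tau> (Suc i) \<and> \<xi> i \<in> borel_measurable (F (\<tau> i)) \<and> bounded (\<xi> i ` space Q))"

definition simple_process ::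
  "nat \<Rightarrow> (nat \<Rightarrow> real) \<Rightarrow> (nat \<Rightarrow> 'w \<Rightarrow> real) \<Rightarrow> real \<Rightarrow> 'w \<Rightarrow> real" where
  "simple_process n \<tau> \<xi> s \<omega> = (\<Sum>i<n. \<xi> i \<omega> * indicator {\<tau> i<..\<tau> (Suc i)} s)"

definition simple_integral ::
  "(real \<Rightarrow> 'w \<Rightarrow> real) \<Rightarrow> nat \<Rightarrow> (nat \<Rightarrow> real) \<Rightarrow> (nat \<Rightarrow> 'w \<Rightarrow> real) \<Rightarrow> real \<Rightarrow> 'w \<Rightarrow> real" where
  "simple_integral W n \<tau> \<xi> t \<omega> =
     (\<Sum>i<n. \<xi> i \<omega> * (W (min t (\<tau> (Suc i))) \<omega> - W (min t (\<tau> i)) \<omega>))"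

text \<open>
  \<open>is_ito_integral Q F W f t J\<close>: the random variable \<open>J\<close> is (a version of) the Ito integral
  of the square-integrable integrand \<open>f\<close> against \<open>W\<close> over \<open>[0, t]\<close>, i.e. the limit in
  \<open>L\<^sup>2(Q)\<close> of integrals of simple integrands converging to \<open>f\<close> in \<open>L\<^sup>2([0, t] \<times> Q)\<close>.
\<close>

definition is_ito_integral ::
  "'w measure \<Rightarrow> (real \<Rightarrow> 'w measure) \<Rightarrow> (real \<Rightarrow> 'w \<Rightarrow> real) \<Rightarrow> (real \<Rightarrow> 'w \<Rightarrow> real) \<Rightarrow>
   real \<Rightarrow> ('w \<Rightarrow> real) \<Rightarrow> bool" where
  "is_ito_integral Q F W f t J \<longleftrightarrow>
     (\<lambda>(s, \<omega>). indicator {0..t} s * f s \<omega>) \<in> borel_measurable (lborel \<Otimes>\<^sub>M Q) \<and>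
     (\<forall>s\<in>{0..t}. f s \<in> borel_measurable (F s)) \<and>
     J \<in> borel_measurable Q \<and>
     (\<exists>n \<tau> \<xi>.
        (\<forall>k. simple_integrand Q F (n k) (\<tau> k) (\<xi> k)) \<and>
        (\<lambda>k. \<integral>\<^sup>+\<omega>. (\<integral>\<^sup>+s\<in>{0..t}.
           ennreal ((simple_process (n k) (\<tau> k) (\<xi> k) s \<omega> - f s \<omega>)\<^sup>2) \<partial>lborel) \<partial>Q)
          \<longlonglongrightarrow> 0 \<and>
        (\<lambda>k. \<integral>\<^sup>+\<omega>. ennreal ((simple_integral W (n k) (\<tau> k) (\<xi> k) t \<omega> - J \<omega>)\<^sup>2) \<partial>Q)
          \<longlonglongrightarrow> 0)"


section \<open>The driving noise and the short rate\<close>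

definition l_fun :: "real \<Rightarrow> real \<Rightarrow> real \<Rightarrow> real" where
  "l_fun p q \<tau> = 1 - 2 * q * p / ((p + 2 * q)\<^sup>2 * exp (2 * q * \<tau>) - p\<^sup>2)"

text \<open>
  \<open>Y s\<close> is the inner stochastic integral over \<open>[0, s]\<close>, whose integrand depends on \<open>s\<close>.
  Each \<open>Y s\<close> is determined only up to a null set; the outer integral \<open>ds\<close> is taken along the
  continuous version.
\<close>

definition is_noise_drift ::
  "'w measure \<Rightarrow> (real \<Rightarrow> 'w \<Rightarrow> real) \<Rightarrow> real \<Rightarrow> real \<Rightarrow> (real \<Rightarrow> 'w \<Rightarrow> real) \<Rightarrow> bool" where
  "is_noise_drift Q W p q Y \<longleftrightarrow>
     (\<forall>s\<ge>0. is_ito_integral Q (augmented_filtration Q W) W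
        (\<lambda>\<tau> \<omega>. p * exp (- (p + q) * (s - \<tau>)) * l_fun p q \<tau>) s (Y s)) \<and>
     (AE \<omega> in Q. continuous_on {0..} (\<lambda>s. Y s \<omega>))"

definition noise :: "(real \<Rightarrow> 'w \<Rightarrow> real) \<Rightarrow> (real \<Rightarrow> 'w \<Rightarrow> real) \<Rightarrow> real \<Rightarrow> 'w \<Rightarrow> real" where
  "noise W Y t \<omega> = W t \<omega> - (LBINT s:{0..t}. Y s \<omega>)"

text \<open>
  Strong solutions of \<open>dr(t) = (a - b r(t)) dt + \<sigma> dZ(t)\<close>, \<open>r(0) = r0\<close>. As \<open>\<sigma>\<close> is constant,
  the integral of \<open>\<sigma>\<close> against \<open>Z\<close> over \<open>[0, t]\<close> is \<open>\<sigma> (Z(t) - Z(0))\<close>.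
\<close>

definition strong_solution ::
  "'w measure \<Rightarrow> (real \<Rightarrow> 'w measure) \<Rightarrow> (real \<Rightarrow> 'w \<Rightarrow> real) \<Rightarrow> real \<Rightarrow> real \<Rightarrow> real \<Rightarrow> real \<Rightarrow>
   (real \<Rightarrow> 'w \<Rightarrow> real) \<Rightarrow> bool" where
  "strong_solution Q F Z a b \<sigma> r0 r \<longleftrightarrow>
     adapted_process F r \<and>
     (AE \<omega> in Q. continuous_on {0..} (\<lambda>t. r t \<omega>)) \<and>
     (AE \<omega> in Q. \<forall>t\<ge>0.
        r t \<omega> = r0 + (LBINT s:{0..t}. a - b * r s \<omega>) + \<sigma> * (Z t \<omega> - Z 0 \<omega>))"


section \<open>Prices\<close>

definition bond_price ::
  "'w measure \<Rightarrow> (real \<Rightarrow> 'w measure) \<Rightarrow> (real \<Rightarrow> 'w \<Rightarrow> real) \<Rightarrow> real \<Rightarrow> real \<Rightarrow> 'w \<Rightarrow> real" where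
  "bond_price Q F r t T =
     real_cond_exp Q (F t) (\<lambda>\<omega>. exp (- (LBINT s:{t..T}. r s \<omega>)))"

definition call_price ::
  "'w measure \<Rightarrow> (real \<Rightarrow> 'w measure) \<Rightarrow> (real \<Rightarrow> 'w \<Rightarrow> real) \<Rightarrow> real \<Rightarrow> real \<Rightarrow> real \<Rightarrow> real" where
  "call_price Q F r S T K =
     (\<integral>\<omega>. exp (- (LBINT s:{0..S}. r s \<omega>)) * max (bond_price Q F r S T \<omega> - K) 0 \<partial>Q)"

definition Phi :: "real \<Rightarrow> real" where
  "Phi x = (LBINT y:{..x}. std_normal_density y)"

definition m_fun :: "real \<Rightarrow> real \<Rightarrow> real \<Rightarrow> real \<Rightarrow> real" where
  "m_fun p q b t = (LBINT s:{0..t}. p * exp (- (p + q) * s) * (1 - exp (- b * (t - s))))"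

definition v_fun :: "real \<Rightarrow> real \<Rightarrow> real \<Rightarrow> real \<Rightarrow> real \<Rightarrow> real \<Rightarrow> real \<Rightarrow> real" where
  "v_fun p q b \<sigma> S T t =
     \<sigma> / b * (exp (- b * (T - t)) - exp (- b * (S - t)) +
       l_fun p q t * (m_fun p q b (T - t) - m_fun p q b (S - t)))"

definition Sigma_sq :: "real \<Rightarrow> real \<Rightarrow> real \<Rightarrow> real \<Rightarrow> real \<Rightarrow> real \<Rightarrow> real" where
  "Sigma_sq p q b \<sigma> S T = (LBINT t:{0..S}. (v_fun p q b \<sigma> S T t)\<^sup>2)"

text \<open>In \<open>d_plus\<close> and \<open>d_minus\<close>, \<open>V\<close> is the variance and \<open>PT\<close>, \<open>PS\<close> are the bond prices
  with maturities \<open>T\<close> and \<open>S\<close>.\<close>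

definition d_plus :: "real \<Rightarrow> real \<Rightarrow> real \<Rightarrow> real \<Rightarrow> real" where
  "d_plus V K PT PS = 1 / sqrt V * (ln (PT / (K * PS)) + 1 / 2 * V)"

definition d_minus :: "real \<Rightarrow> real \<Rightarrow> real \<Rightarrow> real \<Rightarrow> real" where
  "d_minus V K PT PS = d_plus V K PT PS - sqrt V"

end

theory Submission
  imports Defs
begin

text \<open>
  The idea is that the integrated short rate is Gaussian with an explicit volatility, so that bond
  prices are lognormal and the option is priced by a change of measure.

  Solving the linear equation for \<open>r\<close> path by path and integrating by parts gives, for every
  \<open>T\<close>, almost surely \<open>\<integral>\<^sub>0\<^sup>T r = D T + \<integral>\<^sub>0\<^sup>T vol T dW\<close> with deterministic \<open>D\<close> and \<open>vol T\<close>
  (\<open>AE_integrated_rate\<close>). All integrands of the model are deterministic and continuously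
  differentiable. For those, integration by parts turns the stochastic integral into an ordinary
  integral along the path of \<open>W\<close>, and it is the pathwise limit of its left-point sums
  (\<open>stieltjes_sum_tendsto\<close>). The inner integral in the noise is given as an
  \<open>L\<^sup>2\<close> limit of integrals of arbitrary simple integrands; the Ito isometry identifies it with
  the pathwise expression (\<open>ito_integral_eq_wiener_integral\<close>).

  The distributional input is one formula: for an event \<open>B\<close> known at time \<open>s\<close> and complex
  \<open>f = g + \<i> h\<close>, the expectation of \<open>1\<^sub>B exp (\<integral>\<^sub>s\<^sup>t f dW)\<close> is \<open>Q B exp (\<integral>\<^sub>s\<^sup>t f\<^sup>2 / 2)\<close>
  (\<open>exp_wiener_integral\<close>). It contains the independence of \<open>\<integral>\<^sub>s\<^sup>t g dW\<close> from the past, its normal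
  law, and the joint exponential moments of two such integrals.

  Splitting \<open>\<integral>\<^sub>0\<^sup>T vol T dW\<close> at time \<open>t\<close>, the conditional expectation in the bond price is
  computed by this formula, and \<open>P(t,T)\<close> is the exponential of a constant plus
  \<open>\<integral>\<^sub>0\<^sup>t (vol t - vol T) dW\<close> (\<open>AE_bond_price\<close>). At \<open>t = S\<close> the integrand
  \<open>vol S - vol T\<close> is the function \<open>v\<^sub>S\<^sub>,\<^sub>T\<close> of the statement. Hence the option payoff is a function
  of \<open>X = \<integral>\<^sub>0\<^sup>S v\<^sub>S\<^sub>,\<^sub>T dW\<close>, to be weighted by the discount factor \<open>exp (- \<integral>\<^sub>0\<^sup>S r)\<close>. Under the
  measure with this weight, which is the \<open>S\<close>-forward measure up to normalisation, the characteristic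
  function of \<open>X\<close> is that of a normal law with variance \<open>\<Sigma>\<^sup>2(S)\<close>, and the price is an elementary
  Gaussian integral (\<open>call_price_eq\<close>). The variance is positive because \<open>v\<^sub>S\<^sub>,\<^sub>T(S) < 0\<close>, so that the
  division by its root in \<open>d\<^sub>+\<close> is meaningful.
\<close>

section \<open>Expectations, Gaussian weights and laws\<close>

lemma has_bochner_integral_cmult:
  fixes f :: "'a \<Rightarrow> real"
  assumes "has_bochner_integral M f x" shows "has_bochner_integral M (\<lambda>\<omega>. c * f \<omega>) (c * x)"
  using assms by (auto intro: has_bochner_integral_mult_right)

lemma LBINT_continuous:
  fixes f :: "real \<Rightarrow> real"
  assumes "continuous_on {s..t} f"
  shows "(LBINT x:{s..t}. f x) = integral {s..t} f"
  by (rule set_borel_integral_eq_integral(2)[OF borel_integrable_atLeastAtMost'[OF assms]])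

lemma (in complete_measure) borel_measurable_AE_eq:
  fixes f g :: "'a \<Rightarrow> real"
  assumes f: "f \<in> borel_measurable M" and eq: "AE x in M. g x = f x"
  shows "g \<in> borel_measurable M"
proof (rule measurableI)
  fix A :: "real set" assume A: "A \<in> sets borel"
  show "g -` A \<inter> space M \<in> sets M"
  proof (rule in_sets_AE)
    show "AE x in M. x \<in> f -` A \<inter> space M \<longleftrightarrow> x \<in> g -` A \<inter> space M" using eq by auto
    show "f -` A \<inter> space M \<in> sets M" using f A by (rule measurable_sets)
  qed auto
qed simp

text \<open>
  A bound in \<open>L\<^sup>2\<close> is a form of uniform integrability. The map \<open>v \<mapsto> v / (1 + e \<bar>v\<bar>)\<close> is bounded,
  so that dominated convergence applies after composing with it, and the composition changes each
  integral by at most \<open>e C\<close>, uniformly in \<open>n\<close>.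
  This is used for exponentials of approximating sums, which have no evident integrable majorant.
\<close>

lemma (in prob_space) integral_tendsto_of_L2_bounded:
  fixes f :: "nat \<Rightarrow> 'a \<Rightarrow> 'b::{banach, second_countable_topology}"
  assumes f[measurable]: "\<And>n. f n \<in> borel_measurable M" and g[measurable]: "g \<in> borel_measurable M"
    and lim: "AE x in M. (\<lambda>n. f n x) \<longlonglongrightarrow> g x"
    and int: "\<And>n. integrable M (\<lambda>x. (norm (f n x))\<^sup>2)"
    and bound: "\<And>n. (\<integral>x. (norm (f n x))\<^sup>2 \<partial>M) \<le> C"
  shows "integrable M g" and "(\<lambda>n. \<integral>x. f n x \<partial>M) \<longlonglongrightarrow> (\<integral>x. g x \<partial>M)"
proof -
  have "(\<integral>\<^sup>+x. ennreal ((norm (g x))\<^sup>2) \<partial>M) \<le> liminf (\<lambda>n. \<integral>\<^sup>+x. ennreal ((norm (f n x))\<^sup>2) \<partial>M)"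
  proof -
    have "(\<integral>\<^sup>+x. ennreal ((norm (g x))\<^sup>2) \<partial>M) = (\<integral>\<^sup>+x. liminf (\<lambda>n. ennreal ((norm (f n x))\<^sup>2)) \<partial>M)"
    proof (rule nn_integral_cong_AE, use lim in eventually_elim)
      fix x assume "(\<lambda>n. f n x) \<longlonglongrightarrow> g x"
      then have "(\<lambda>n. ennreal ((norm (f n x))\<^sup>2)) \<longlonglongrightarrow> ennreal ((norm (g x))\<^sup>2)"
        by (intro tendsto_intros)
      then show "ennreal ((norm (g x))\<^sup>2) = liminf (\<lambda>n. ennreal ((norm (f n x))\<^sup>2))"
        by (rule lim_imp_Liminf[OF trivial_limit_sequentially, symmetric])
    qed
    also have "\<dots> \<le> liminf (\<lambda>n. \<integral>\<^sup>+x. ennreal ((norm (f n x))\<^sup>2) \<partial>M)"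
      by (rule nn_integral_liminf) simp
    finally show ?thesis .
  qed
  also have "\<dots> \<le> ennreal C"
  proof -
    have "(\<integral>\<^sup>+x. ennreal ((norm (f n x))\<^sup>2) \<partial>M) \<le> ennreal C" for n
      using nn_integral_eq_integral[OF int[of n]] bound[of n] by (simp add: ennreal_leI)
    then have "liminf (\<lambda>n. \<integral>\<^sup>+x. ennreal ((norm (f n x))\<^sup>2) \<partial>M) \<le> liminf (\<lambda>n::nat. ennreal C)"
      by (intro Liminf_mono) auto
    then show ?thesis by (simp add: Liminf_const)
  qed
  finally have gb: "(\<integral>\<^sup>+x. ennreal ((norm (g x))\<^sup>2) \<partial>M) \<le> ennreal C" .
  have g2: "integrable M (\<lambda>x. (norm (g x))\<^sup>2)"
    using gb by (intro integrableI_bounded) (auto simp: top_unique less_top[symmetric] intro: le_less_trans)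
  have C: "0 \<le> C"
    by (rule order_trans[OF Bochner_Integration.integral_nonneg bound[of 0]]) simp
  have g3: "(\<integral>x. (norm (g x))\<^sup>2 \<partial>M) \<le> C"
  proof -
    have "ennreal (\<integral>x. (norm (g x))\<^sup>2 \<partial>M) \<le> ennreal C"
      using gb by (subst (asm) nn_integral_eq_integral[OF g2]) simp_all
    then show ?thesis using C by (simp only: ennreal_le_iff)
  qed
  have L1: "integrable M h" if [measurable]: "h \<in> borel_measurable M" and "integrable M (\<lambda>x. (norm (h x))\<^sup>2)" for h :: "'a \<Rightarrow> 'b"
  proof (rule Bochner_Integration.integrable_bound)
    show "integrable M (\<lambda>x. 1 + (norm (h x))\<^sup>2)" using that by simp
    have "n \<le> 1 + n\<^sup>2" if "0 \<le> n" for n :: real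
      using zero_le_power2[of "n - 1"] that unfolding power2_diff by simp
    then show "AE x in M. norm (h x) \<le> norm (1 + (norm (h x))\<^sup>2)" by auto
  qed simp
  show gi: "integrable M g" by (rule L1[OF g g2])
  have fi: "integrable M (f n)" for n by (rule L1[OF f int])
  define c where "c e v = v /\<^sub>R (1 + e * norm v)" for e and v :: 'b
  have c_meas[measurable]: "(\<lambda>x. c e (h x)) \<in> borel_measurable M" if "h \<in> borel_measurable M" for e h
    using that unfolding c_def by measurable
  have c_bound: "norm (c e v) \<le> 1 / e" if "e > 0" for e v
    using that by (simp add: c_def divide_simps add_pos_nonneg)
  have c_err: "norm (v - c e v) \<le> e * (norm v)\<^sup>2" if "e > 0" for e v
  proof -
    have p: "1 + e * norm v > 0" using that by (simp add: add_pos_nonneg)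
    have "v - c e v = (1 - inverse (1 + e * norm v)) *\<^sub>R v" by (simp add: c_def algebra_simps)
    also have "1 - inverse (1 + e * norm v) = e * norm v / (1 + e * norm v)" using p by (simp add: field_simps)
    finally have "norm (v - c e v) = \<bar>e * norm v / (1 + e * norm v)\<bar> * norm v" by simp
    also have "\<bar>e * norm v / (1 + e * norm v)\<bar> = e * norm v / (1 + e * norm v)" using p that by simp
    also have "\<dots> \<le> e * norm v" using p that by (simp add: divide_le_eq mult_le_cancel_left1)
    finally show ?thesis by (simp add: power2_eq_square mult_right_mono)
  qed
  have ci: "integrable M (\<lambda>x. c e (h x))" if [measurable]: "h \<in> borel_measurable M" and "e > 0" for e h
    by (rule integrable_const_bound[of _ "1 / e"]) (use c_bound that in auto)
  have err: "norm ((\<integral>x. h x \<partial>M) - (\<integral>x. c e (h x) \<partial>M)) \<le> e * C"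
    if [measurable]: "h \<in> borel_measurable M" and "integrable M (\<lambda>x. (norm (h x))\<^sup>2)"
      "(\<integral>x. (norm (h x))\<^sup>2 \<partial>M) \<le> C" "e > 0" for e h
  proof -
    have "norm ((\<integral>x. h x \<partial>M) - (\<integral>x. c e (h x) \<partial>M)) = norm (\<integral>x. h x - c e (h x) \<partial>M)"
      using that by (simp add: Bochner_Integration.integral_diff[OF L1 ci])
    also have "\<dots> \<le> (\<integral>x. e * (norm (h x))\<^sup>2 \<partial>M)"
    proof (rule order_trans[OF integral_norm_bound integral_mono])
      show "integrable M (\<lambda>x. norm (h x - c e (h x)))"
        by (rule integrable_norm[OF Bochner_Integration.integrable_diff[OF L1[OF that(1,2)] ci[OF that(1,4)]]])
      show "integrable M (\<lambda>x. e * (norm (h x))\<^sup>2)" by (rule integrable_mult_right[OF that(2)])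
    qed (rule c_err[OF that(4)])
    also have "\<dots> = e * (\<integral>x. (norm (h x))\<^sup>2 \<partial>M)" by (rule integral_mult_right_zero)
    also have "\<dots> \<le> e * C" using that(3,4) by (intro mult_left_mono) auto
    finally show ?thesis .
  qed
  show "(\<lambda>n. \<integral>x. f n x \<partial>M) \<longlonglongrightarrow> (\<integral>x. g x \<partial>M)"
  proof (rule LIMSEQ_I)
    fix r :: real assume r: "r > 0"
    define e where "e = r / (3 * (C + 1))"
    have e: "e > 0" using r C by (simp add: e_def)
    have eC: "e * C < r / 3" using r C by (simp add: e_def field_simps)
    have "(\<lambda>n. \<integral>x. c e (f n x) \<partial>M) \<longlonglongrightarrow> (\<integral>x. c e (g x) \<partial>M)"
    proof (rule integral_dominated_convergence[where w="\<lambda>_. 1 / e"])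
      show "AE x in M. (\<lambda>n. c e (f n x)) \<longlonglongrightarrow> c e (g x)"
        using lim
      proof eventually_elim
        fix x assume "(\<lambda>n. f n x) \<longlonglongrightarrow> g x"
        moreover have "1 + e * norm (g x) > 0" using e by (simp add: add_pos_nonneg)
        ultimately show "(\<lambda>n. c e (f n x)) \<longlonglongrightarrow> c e (g x)"
          unfolding c_def by (intro tendsto_intros) auto
      qed
    qed (use c_bound e in auto)
    then obtain N where N: "\<And>n. n \<ge> N \<Longrightarrow> norm ((\<integral>x. c e (f n x) \<partial>M) - (\<integral>x. c e (g x) \<partial>M)) < r / 3"
      using LIMSEQ_D[of _ _ "r / 3"] r by (metis divide_pos_pos zero_less_numeral)
    have "norm ((\<integral>x. f n x \<partial>M) - (\<integral>x. g x \<partial>M)) < r" if "n \<ge> N" for n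
    proof -
      have 1: "norm ((\<integral>x. f n x \<partial>M) - (\<integral>x. c e (f n x) \<partial>M)) < r / 3"
        using err[OF f int bound e, of n] eC by simp
      have 2: "norm ((\<integral>x. g x \<partial>M) - (\<integral>x. c e (g x) \<partial>M)) < r / 3"
        using err[OF g g2 g3 e] eC by simp
      have "(\<integral>x. f n x \<partial>M) - (\<integral>x. g x \<partial>M) =
          ((\<integral>x. f n x \<partial>M) - (\<integral>x. c e (f n x) \<partial>M)) + ((\<integral>x. c e (f n x) \<partial>M) - (\<integral>x. c e (g x) \<partial>M))
          - ((\<integral>x. g x \<partial>M) - (\<integral>x. c e (g x) \<partial>M))" by simp
      also have "norm \<dots> \<le> norm ((\<integral>x. f n x \<partial>M) - (\<integral>x. c e (f n x) \<partial>M))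
         + norm ((\<integral>x. c e (f n x) \<partial>M) - (\<integral>x. c e (g x) \<partial>M)) + norm ((\<integral>x. g x \<partial>M) - (\<integral>x. c e (g x) \<partial>M))"
        by (meson norm_triangle_ineq norm_triangle_ineq4 order_trans add_right_mono)
      finally show ?thesis using 1 2 N[OF that] by simp
    qed
    then show "\<exists>no. \<forall>n\<ge>no. norm ((\<integral>x. f n x \<partial>M) - (\<integral>x. g x \<partial>M)) < r" by blast
  qed
qed

lemma integral_std_normal_cexp:
  "(\<integral>x. std_normal_density x *\<^sub>R iexp (t * x) \<partial>lborel) = complex_of_real (exp (- t\<^sup>2 / 2))"
proof -
  have "char std_normal_distribution t = (\<integral>x. std_normal_density x *\<^sub>R iexp (t * x) \<partial>lborel)"
    unfolding char_def by (subst integral_density) auto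
  then show ?thesis by (simp add: char_std_normal_distribution)
qed

text \<open>
  Completing the square absorbs the real part of \<open>z\<close> into a shift of the mean, which leaves a value
  of the characteristic function of the normal law.
\<close>

lemma normal_density_exp_moment:
  fixes z :: complex
  assumes s: "0 < s"
  shows "integrable lborel (\<lambda>x. normal_density 0 s x *\<^sub>R exp (z * complex_of_real x))"
    and "(\<integral>x. normal_density 0 s x *\<^sub>R exp (z * complex_of_real x) \<partial>lborel) = exp (z\<^sup>2 * complex_of_real (s\<^sup>2) / 2)"
proof -
  define \<mu> where "\<mu> = Re z * s\<^sup>2"
  have shift: "normal_density 0 s x *\<^sub>R exp (z * complex_of_real x) =
      exp ((Re z)\<^sup>2 * s\<^sup>2 / 2) *\<^sub>R (normal_density \<mu> s x *\<^sub>R iexp (Im z * x))" for x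
  proof -
    have "normal_density 0 s x * exp (Re z * x) = exp ((Re z)\<^sup>2 * s\<^sup>2 / 2) * normal_density \<mu> s x"
    proof -
      have "- x\<^sup>2 / (2 * s\<^sup>2) + Re z * x = (Re z)\<^sup>2 * s\<^sup>2 / 2 - (x - \<mu>)\<^sup>2 / (2 * s\<^sup>2)"
        using s by (simp add: \<mu>_def field_simps power2_eq_square)
      then show ?thesis
        using s by (simp add: normal_density_def exp_add[symmetric] mult.left_commute)
    qed
    moreover have "exp (z * complex_of_real x) = exp (Re z * x) *\<^sub>R iexp (Im z * x)"
      by (subst exp_eq_polar) (simp add: cis_conv_exp scaleR_conv_of_real exp_of_real)
    ultimately show ?thesis
      by (metis scaleR_scaleR)
  qed
  have bas: "integrable lborel (\<lambda>x. normal_density \<mu> s x *\<^sub>R iexp (Im z * x))"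
    by (rule Bochner_Integration.integrable_bound[OF integrable_normal_density[OF s, of \<mu>]])
       (auto simp: normal_density_nonneg)
  then show "integrable lborel (\<lambda>x. normal_density 0 s x *\<^sub>R exp (z * complex_of_real x))"
    unfolding shift by (rule integrable_scaleR_right)
  have "(\<integral>x. normal_density \<mu> s x *\<^sub>R iexp (Im z * x) \<partial>lborel) =
     s *\<^sub>R (\<integral>x. normal_density \<mu> s (\<mu> + s * x) *\<^sub>R iexp (Im z * (\<mu> + s * x)) \<partial>lborel)"
    by (subst lborel_integral_real_affine[of s _ \<mu>]) (use s in auto)
  also have "\<dots> = (\<integral>x. iexp (Im z * \<mu>) * (std_normal_density x *\<^sub>R iexp ((Im z * s) * x)) \<partial>lborel)"
  proof (subst integral_scaleR_right[symmetric], rule Bochner_Integration.integral_cong[OF refl])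
    fix x
    have "s * normal_density \<mu> s (\<mu> + s * x) = std_normal_density x"
      using s by (simp add: normal_density_def real_sqrt_mult power_mult_distrib)
    then show "s *\<^sub>R normal_density \<mu> s (\<mu> + s * x) *\<^sub>R iexp (Im z * (\<mu> + s * x)) =
        iexp (Im z * \<mu>) * (std_normal_density x *\<^sub>R iexp ((Im z * s) * x))"
      by (simp add: scaleR_scaleR algebra_simps exp_add)
  qed
  also have "\<dots> = iexp (Im z * \<mu>) * complex_of_real (exp (- (Im z * s)\<^sup>2 / 2))"
    by (subst integral_mult_right_zero, subst integral_std_normal_cexp) simp
  finally have "(\<integral>x. normal_density 0 s x *\<^sub>R exp (z * complex_of_real x) \<partial>lborel) =
     exp ((Re z)\<^sup>2 * s\<^sup>2 / 2) *\<^sub>R (iexp (Im z * \<mu>) * complex_of_real (exp (- (Im z * s)\<^sup>2 / 2)))"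
    unfolding shift by (simp only: integral_scaleR_right)
  also have "\<dots> = exp (complex_of_real ((Re z)\<^sup>2 * s\<^sup>2 / 2) + \<i> * complex_of_real (Im z * \<mu>) + complex_of_real (- (Im z * s)\<^sup>2 / 2))"
    unfolding scaleR_conv_of_real exp_add exp_of_real[symmetric] by (simp add: mult.assoc)
  also have "complex_of_real ((Re z)\<^sup>2 * s\<^sup>2 / 2) + \<i> * complex_of_real (Im z * \<mu>) + complex_of_real (- (Im z * s)\<^sup>2 / 2)
     = z\<^sup>2 * complex_of_real (s\<^sup>2) / 2"
    by (simp add: complex_eq_iff \<mu>_def power2_eq_square algebra_simps)
  finally show "(\<integral>x. normal_density 0 s x *\<^sub>R exp (z * complex_of_real x) \<partial>lborel) = exp (z\<^sup>2 * complex_of_real (s\<^sup>2) / 2)" .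
qed

text \<open>
  After normalisation \<open>H\<close> is the density of a probability measure, and the assumption says that the
  characteristic function of \<open>X\<close> under that measure is the one of \<open>\<mu> + s N\<close> with \<open>N\<close> standard
  normal; characteristic functions determine laws. Two weights matter below: the indicator of an
  event of the past, which yields independence, and a discount factor, which yields the forward
  measure.
\<close>

lemma (in prob_space) weighted_law_of_char:
  fixes H X :: "'a \<Rightarrow> real" and h :: "real \<Rightarrow> real"
  assumes H[measurable]: "integrable M H" and H0: "\<And>x. x \<in> space M \<Longrightarrow> 0 \<le> H x"
    and X[measurable]: "X \<in> borel_measurable M" and h[measurable]: "h \<in> borel_measurable borel"
    and char: "\<And>u. (\<integral>x. H x *\<^sub>R iexp (u * X x) \<partial>M) =
       (\<integral>x. H x \<partial>M) *\<^sub>R exp (\<i> * complex_of_real (u * \<mu>) - complex_of_real (u\<^sup>2 * s\<^sup>2 / 2))"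
  shows "(\<integral>x. H x * h (X x) \<partial>M) = (\<integral>x. H x \<partial>M) * (\<integral>y. std_normal_density y * h (\<mu> + s * y) \<partial>lborel)" (is ?eq)
    and "integrable lborel (\<lambda>y. std_normal_density y * h (\<mu> + s * y)) \<Longrightarrow> integrable M (\<lambda>x. H x * h (X x))"
      (is "?int \<Longrightarrow> ?int'")
proof -
  have "?eq \<and> (?int \<longrightarrow> ?int')"
  proof (cases "(\<integral>x. H x \<partial>M) = 0")
  case True
  then have "AE x in M. H x = 0"
    using integral_nonneg_eq_0_iff_AE[OF H] H0 by auto
  then have "AE x in M. H x * h (X x) = 0" by auto
  moreover have "(\<lambda>x. H x * h (X x)) \<in> borel_measurable M"
    using borel_measurable_integrable[OF H] by measurable
  ultimately have 0: "(\<integral>x. H x * h (X x) \<partial>M) = 0" "integrable M (\<lambda>x. H x * h (X x))"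
    using integrable_cong_AE[of "\<lambda>x. H x * h (X x)" M "\<lambda>_. 0"] by (auto intro: integral_eq_zero_AE)
  show ?thesis unfolding 0(1) True using 0(2) by simp
next
  case False
  define N where "N = (\<integral>x. H x \<partial>M)"
  have Hm[measurable]: "H \<in> borel_measurable M" using H by simp
  have N: "N > 0" using False Bochner_Integration.integral_nonneg_AE[of H M] H0 by (auto simp: N_def order.strict_iff_order)
  define D where "D = density M (\<lambda>x. ennreal (H x / N))"
  have H0': "AE x in M. 0 \<le> H x / N" using H0 N by auto
  have "emeasure D (space D) = ennreal (\<integral>x. H x / N \<partial>M)"
    using H H0' by (simp add: D_def emeasure_density nn_integral_eq_integral cong: nn_integral_cong)
  also have "\<dots> = 1" using N by (simp add: N_def)
  finally interpret D: prob_space D by (rule prob_spaceI)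
  have XD[measurable]: "X \<in> borel_measurable D" by (simp add: D_def)
  interpret SN: prob_space std_normal_distribution using prob_space_normal_density[of 1 0] by simp
  have "distr D borel X = distr std_normal_distribution borel (\<lambda>y. \<mu> + s * y)"
  proof (rule Levy_uniqueness)
    show "real_distribution (distr D borel X)" by (rule D.real_distribution_distr) simp
    show "real_distribution (distr std_normal_distribution borel (\<lambda>y. \<mu> + s * y))"
      by (rule SN.real_distribution_distr) simp
    show "char (distr D borel X) = char (distr std_normal_distribution borel (\<lambda>y. \<mu> + s * y))"
    proof
      fix u
      have "char (distr D borel X) u = (\<integral>x. iexp (u * X x) \<partial>D)"
        unfolding char_def by (subst integral_distr) auto
      also have "\<dots> = (\<integral>x. H x *\<^sub>R iexp (u * X x) \<partial>M) /\<^sub>R N"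
      proof -
        have "(H x / N) *\<^sub>R iexp (u * X x) = (inverse N) *\<^sub>R (H x *\<^sub>R iexp (u * X x))" for x
          by (simp add: divide_inverse mult.commute)
        then show ?thesis
          unfolding D_def by (subst integral_density[OF _ _ H0'])
            (simp_all only: integral_scaleR_right, measurable)
      qed
      also have "\<dots> = exp (\<i> * complex_of_real (u * \<mu>) - complex_of_real (u\<^sup>2 * s\<^sup>2 / 2))"
        unfolding char using N by (simp add: N_def)
      finally have 1: "char (distr D borel X) u = \<dots>" .
      have "char (distr std_normal_distribution borel (\<lambda>y. \<mu> + s * y)) u
          = (\<integral>y. iexp (u * (\<mu> + s * y)) \<partial>std_normal_distribution)"
        unfolding char_def by (subst integral_distr) auto
      also have "\<dots> = (\<integral>y. iexp (u * \<mu>) * (std_normal_density y *\<^sub>R iexp ((u * s) * y)) \<partial>lborel)"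
        by (subst integral_density) (auto simp: algebra_simps exp_add intro!: Bochner_Integration.integral_cong)
      also have "\<dots> = iexp (u * \<mu>) * complex_of_real (exp (- (u * s)\<^sup>2 / 2))"
        by (subst integral_mult_right_zero, subst integral_std_normal_cexp) simp
      also have "\<dots> = exp (\<i> * complex_of_real (u * \<mu>) - complex_of_real (u\<^sup>2 * s\<^sup>2 / 2))"
        unfolding exp_of_real[symmetric] exp_add[symmetric] by (simp add: power_mult_distrib)
      finally show "char (distr D borel X) u = char (distr std_normal_distribution borel (\<lambda>y. \<mu> + s * y)) u"
        using 1 by simp
    qed
  qed
  note law = this
  from law have "(\<integral>y. h y \<partial>distr D borel X) = (\<integral>y. h y \<partial>distr std_normal_distribution borel (\<lambda>y. \<mu> + s * y))" by simp
  then have "(\<integral>x. h (X x) \<partial>D) = (\<integral>y. h (\<mu> + s * y) \<partial>std_normal_distribution)"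
    by (simp add: integral_distr)
  also have "\<dots> = (\<integral>y. std_normal_density y * h (\<mu> + s * y) \<partial>lborel)"
    by (subst integral_density) auto
  finally have "(\<integral>x. h (X x) \<partial>D) = (\<integral>y. std_normal_density y * h (\<mu> + s * y) \<partial>lborel)" .
  moreover have "(\<integral>x. h (X x) \<partial>D) = (\<integral>x. H x * h (X x) \<partial>M) / N"
    unfolding D_def by (subst integral_density[OF _ _ H0']) auto
  ultimately have ?eq
    using N by (simp add: N_def[symmetric] field_simps)
  moreover have ?int' if ?int
  proof -
    have "integrable std_normal_distribution (\<lambda>y. h (\<mu> + s * y))"
      using that by (subst integrable_density) auto
    then have "integrable (distr std_normal_distribution borel (\<lambda>y. \<mu> + s * y)) h"
      by (subst integrable_distr_eq) auto
    then have "integrable D (\<lambda>x. h (X x))"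
      unfolding law[symmetric] by (subst (asm) integrable_distr_eq) auto
    then have "integrable M (\<lambda>x. (H x / N) *\<^sub>R h (X x))"
      unfolding D_def by (subst (asm) integrable_density[OF _ _ H0']) auto
    then have "integrable M (\<lambda>x. N * ((H x / N) *\<^sub>R h (X x)))" by (rule integrable_mult_right)
    then show ?thesis using N by simp
  qed
  ultimately show ?thesis by blast
  qed
  then show ?eq and "?int \<Longrightarrow> ?int'" by blast+
qed

section \<open>Brownian motion and its augmented filtration\<close>

text \<open>
  Independence of the \<open>\<sigma>\<close>-algebra of \<open>G\<close> and the random variable \<open>D\<close>, written out on events so
  that it can be read off directly from expectations of indicators.
\<close>

definition (in prob_space) independent_of :: "'a measure \<Rightarrow> ('a \<Rightarrow> real) \<Rightarrow> bool" where
  "independent_of G D \<longleftrightarrow> (\<forall>B\<in>sets G. \<forall>A\<in>sets borel.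
     prob (B \<inter> (D -` A \<inter> space M)) = prob B * prob (D -` A \<inter> space M))"

lemma (in prob_space) independent_of_indep_var:
  fixes Z :: "'a \<Rightarrow> 'b::{second_countable_topology,real_normed_vector}"
  assumes ind: "independent_of G D" and G: "subalgebra M G" and D[measurable]: "D \<in> borel_measurable M"
    and Z: "Z \<in> borel_measurable G" and h[measurable]: "h \<in> borel_measurable borel"
  shows "indep_var borel Z borel (\<lambda>x. h (D x) :: 'b)"
proof -
  have sp: "space G = space M" and sub: "sets G \<subseteq> sets M" using G by (auto simp: subalgebra_def)
  have ZM: "Z \<in> borel_measurable M" using measurable_from_subalg[OF G Z] .
  have hD: "(\<lambda>x. h (D x)) \<in> borel_measurable M" by simp
  have 1: "sigma_sets (space M) {Z -` A \<inter> space M | A. A \<in> sets borel} \<subseteq> sets G"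
    unfolding sp[symmetric] by (rule sets.sigma_sets_subset) (use Z in \<open>auto intro: measurable_sets\<close>)
  have 2: "sigma_sets (space M) {(\<lambda>x. h (D x)) -` A \<inter> space M | A. A \<in> sets borel}
      \<subseteq> sets (vimage_algebra (space M) D borel)"
  proof -
    have "sigma_sets (space (vimage_algebra (space M) D borel)) {(\<lambda>x. h (D x)) -` A \<inter> space M | A. A \<in> sets borel}
      \<subseteq> sets (vimage_algebra (space M) D borel)"
    proof (rule sets.sigma_sets_subset, safe)
      fix A :: "'b set" assume A: "A \<in> sets borel"
      have "(\<lambda>x. h (D x)) -` A \<inter> space M = D -` (h -` A \<inter> space borel) \<inter> space M" by auto
      moreover have "h -` A \<inter> space borel \<in> sets borel" using A h by (rule measurable_sets[rotated])
      ultimately show "(\<lambda>x. h (D x)) -` A \<inter> space M \<in> sets (vimage_algebra (space M) D borel)"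
        by (subst sets_vimage_algebra2) auto
    qed
    then show ?thesis by simp
  qed
  have 3: "sets (vimage_algebra (space M) D borel) = {D -` A \<inter> space M | A. A \<in> sets borel}"
    by (rule sets_vimage_algebra2) auto
  have "indep_set (sets G) (sets (vimage_algebra (space M) D borel))"
    unfolding indep_sets2_eq using sub ind D by (auto simp: 3 independent_of_def intro: measurable_sets)
  then have "indep_set (sigma_sets (space M) {Z -` A \<inter> space M | A. A \<in> sets borel})
       (sigma_sets (space M) {(\<lambda>x. h (D x)) -` A \<inter> space M | A. A \<in> sets borel})"
    unfolding indep_sets2_eq using 1 2 by blast
  then show ?thesis unfolding indep_var_eq using ZM hD by simp
qed

lemma (in prob_space) independent_of_integral:
  fixes Z :: "'a \<Rightarrow> 'b::{real_normed_field, banach, second_countable_topology}"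
  assumes "independent_of G D" "subalgebra M G" "D \<in> borel_measurable M"
    and "Z \<in> borel_measurable G" "h \<in> borel_measurable borel"
    and "integrable M Z" "integrable M (\<lambda>x. h (D x))"
  shows "integrable M (\<lambda>x. Z x * h (D x))"
    and "(\<integral>x. Z x * h (D x) \<partial>M) = (\<integral>x. Z x \<partial>M) * (\<integral>x. h (D x) \<partial>M)"
  using indep_var_integrable[OF independent_of_indep_var[OF assms(1-5)] assms(6,7)]
    indep_var_lebesgue_integral[OF independent_of_indep_var[OF assms(1-5)] assms(6,7)] by auto

locale brownian = prob_space Q + complete_measure Q for Q :: "'w measure" +
  fixes W :: "real \<Rightarrow> 'w \<Rightarrow> real"
  assumes bm: "standard_brownian_motion Q W"
begin

abbreviation \<F> :: "real \<Rightarrow> 'w measure" where "\<F> \<equiv> augmented_filtration Q W"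

lemma W_measurable: "0 \<le> t \<Longrightarrow> W t \<in> borel_measurable Q"
  using bm by (simp add: standard_brownian_motion_def)

lemma W_0: "AE \<omega> in Q. W 0 \<omega> = 0"
  using bm by (simp add: standard_brownian_motion_def)

lemma W_continuous: "AE \<omega> in Q. continuous_on {0..} (\<lambda>t. W t \<omega>)"
  using bm by (simp add: standard_brownian_motion_def)

lemma W_increment_distributed:
  "0 \<le> s \<Longrightarrow> s < t \<Longrightarrow> distributed Q lborel (\<lambda>\<omega>. W t \<omega> - W s \<omega>) (normal_density 0 (sqrt (t - s)))"
  using bm by (simp add: standard_brownian_motion_def)

lemma natural_generators: "{W s -` A \<inter> space Q | s A. s \<in> {0..t} \<and> A \<in> sets borel} \<subseteq> sets Q"
  using W_measurable by (auto intro: measurable_sets)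

lemma sets_natural:
  "sets (natural_filtration Q W t) =
     sigma_sets (space Q) {W s -` A \<inter> space Q | s A. s \<in> {0..t} \<and> A \<in> sets borel}"
  unfolding natural_filtration_def by (rule sets_measure_of) auto

lemma space_natural[simp]: "space (natural_filtration Q W t) = space Q"
  unfolding natural_filtration_def by (rule space_measure_of) auto

lemma natural_subset: "sets (natural_filtration Q W t) \<subseteq> sets Q"
  unfolding sets_natural by (rule sets.sigma_sets_subset[OF natural_generators])

lemma sets_\<F>: "sets (\<F> t) = sigma_sets (space Q) (sets (natural_filtration Q W t) \<union> null_sets Q)"
  unfolding augmented_filtration_def
  by (rule sets_measure_of) (use natural_subset[of t] in \<open>auto dest!: null_setsD2 dest: sets.sets_into_space\<close>)

lemma space_\<F>[simp]: "space (\<F> t) = space Q"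
  unfolding augmented_filtration_def
  by (rule space_measure_of) (use natural_subset[of t] in \<open>auto dest!: null_setsD2 dest: sets.sets_into_space\<close>)

lemma \<F>_subalgebra: "subalgebra Q (\<F> t)"
proof -
  have "sets (\<F> t) \<subseteq> sets Q"
    unfolding sets_\<F> by (rule sets.sigma_sets_subset) (use natural_subset in auto)
  then show ?thesis by (simp add: subalgebra_def)
qed

lemma \<F>_measurable_Q: "Z \<in> borel_measurable (\<F> t) \<Longrightarrow> Z \<in> borel_measurable Q"
  by (rule measurable_from_subalg[OF \<F>_subalgebra])

lemma \<F>_mono: assumes "s \<le> t" shows "subalgebra (\<F> t) (\<F> s)"
proof -
  have "sets (natural_filtration Q W s) \<subseteq> sets (natural_filtration Q W t)"
    unfolding sets_natural
  proof (rule sigma_sets_mono', rule subsetI)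
    fix x assume "x \<in> {W u -` A \<inter> space Q | u A. u \<in> {0..s} \<and> A \<in> sets borel}"
    then obtain u A where "x = W u -` A \<inter> space Q" "u \<in> {0..t}" "A \<in> sets borel" using assms by auto
    then show "x \<in> {W u -` A \<inter> space Q | u A. u \<in> {0..t} \<and> A \<in> sets borel}" by blast
  qed
  then show ?thesis
    unfolding subalgebra_def sets_\<F> by (auto intro!: sigma_sets_mono' subsetD[OF sigma_sets_mono'])
qed

lemma \<F>_measurable_mono: "Z \<in> borel_measurable (\<F> s) \<Longrightarrow> s \<le> t \<Longrightarrow> Z \<in> borel_measurable (\<F> t)"
  using measurable_from_subalg[OF \<F>_mono] .

lemma W_adapted: assumes "0 \<le> s" "s \<le> t" shows "W s \<in> borel_measurable (\<F> t)"
proof (rule measurableI)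
  fix A :: "real set" assume "A \<in> sets borel"
  then have "W s -` A \<inter> space Q \<in> sets (natural_filtration Q W t)"
    unfolding sets_natural using assms by (intro sigma_sets.Basic) auto
  then show "W s -` A \<inter> space (\<F> t) \<in> sets (\<F> t)" by (simp add: sets_\<F>)
qed simp

text \<open>
  The sets that agree almost surely with an event of the natural filtration form a \<open>\<sigma>\<close>-algebra
  which contains the null sets. Augmentation therefore does not destroy the independence of the
  increments from the past.
\<close>

lemma \<F>_almost_natural:
  assumes "B \<in> sets (\<F> s)"
  shows "\<exists>C\<in>sets (natural_filtration Q W s). AE \<omega> in Q. \<omega> \<in> B \<longleftrightarrow> \<omega> \<in> C"
  using assms unfolding sets_\<F>
proof (induction rule: sigma_sets.induct)
  case (Basic a)
  then show ?case
  proof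
    assume "a \<in> null_sets Q"
    then have "AE \<omega> in Q. \<omega> \<in> a \<longleftrightarrow> \<omega> \<in> {}" using AE_not_in by auto
    then show ?thesis by (intro bexI[of _ "{}"]) auto
  qed auto
next
  case Empty
  then show ?case by (intro bexI[of _ "{}"]) auto
next
  case (Compl a)
  then obtain C where C: "C \<in> sets (natural_filtration Q W s)" "AE \<omega> in Q. \<omega> \<in> a \<longleftrightarrow> \<omega> \<in> C" by auto
  have "space Q - C \<in> sets (natural_filtration Q W s)"
    using sets.compl_sets[OF C(1)] by simp
  moreover have "AE \<omega> in Q. \<omega> \<in> space Q - a \<longleftrightarrow> \<omega> \<in> space Q - C" using C(2) by auto
  ultimately show ?case by (rule bexI[rotated])
next
  case (Union a)
  then have "\<forall>i. \<exists>C. C \<in> sets (natural_filtration Q W s) \<and> (AE \<omega> in Q. \<omega> \<in> a i \<longleftrightarrow> \<omega> \<in> C)" by blast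
  then obtain C where C: "\<And>i. C i \<in> sets (natural_filtration Q W s)" "\<And>i. AE \<omega> in Q. \<omega> \<in> a i \<longleftrightarrow> \<omega> \<in> C i"
    by metis
  have "AE \<omega> in Q. \<forall>i. \<omega> \<in> a i \<longleftrightarrow> \<omega> \<in> C i" using C(2) by (simp add: AE_all_countable)
  then have "AE \<omega> in Q. \<omega> \<in> (\<Union>i. a i) \<longleftrightarrow> \<omega> \<in> (\<Union>i. C i)" by auto
  then show ?case using C(1) by (intro bexI[of _ "\<Union>i. C i"]) auto
qed

lemma increment_independent:
  assumes "0 \<le> s" "s < t"
  shows "independent_of (\<F> s) (\<lambda>\<omega>. W t \<omega> - W s \<omega>)"
  unfolding independent_of_def
proof safe
  fix B and A :: "real set" assume B: "B \<in> sets (\<F> s)" and A: "A \<in> sets borel"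
  let ?D = "\<lambda>\<omega>. W t \<omega> - W s \<omega>"
  have [measurable]: "?D \<in> borel_measurable Q" using W_measurable assms by simp
  obtain C where C: "C \<in> sets (natural_filtration Q W s)" "AE \<omega> in Q. \<omega> \<in> B \<longleftrightarrow> \<omega> \<in> C"
    using \<F>_almost_natural[OF B] by auto
  have [measurable]: "B \<in> sets Q" "C \<in> sets Q" "?D -` A \<inter> space Q \<in> sets Q"
    using B \<F>_subalgebra[of s] C natural_subset A by (auto simp: subalgebra_def intro: measurable_sets)
  have "?D -` A \<inter> space Q \<in> sets (vimage_algebra (space Q) ?D borel)"
    using A by (subst sets_vimage_algebra2) auto
  then have "prob (C \<inter> (?D -` A \<inter> space Q)) = prob C * prob (?D -` A \<inter> space Q)"
    using bm assms C(1) unfolding standard_brownian_motion_def indep_sets2_eq by auto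
  moreover have "prob (B \<inter> (?D -` A \<inter> space Q)) = prob (C \<inter> (?D -` A \<inter> space Q))"
    by (rule finite_measure_eq_AE) (use C(2) in auto)
  moreover have "prob B = prob C" by (rule finite_measure_eq_AE) (use C(2) in auto)
  ultimately show "prob (B \<inter> (?D -` A \<inter> space Q)) = prob B * prob (?D -` A \<inter> space Q)" by simp
qed

lemma exp_increment:
  fixes Z :: "'w \<Rightarrow> complex"
  assumes st: "0 \<le> s" "s \<le> t" and Z: "Z \<in> borel_measurable (\<F> s)" "integrable Q Z"
  shows "integrable Q (\<lambda>\<omega>. Z \<omega> * exp (z * complex_of_real (W t \<omega> - W s \<omega>)))"
    and "(\<integral>\<omega>. Z \<omega> * exp (z * complex_of_real (W t \<omega> - W s \<omega>)) \<partial>Q) =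
      (\<integral>\<omega>. Z \<omega> \<partial>Q) * exp (z\<^sup>2 * complex_of_real (t - s) / 2)"
proof -
  let ?D = "\<lambda>\<omega>. W t \<omega> - W s \<omega>"
  have "integrable Q (\<lambda>\<omega>. Z \<omega> * exp (z * complex_of_real (?D \<omega>))) \<and>
    (\<integral>\<omega>. Z \<omega> * exp (z * complex_of_real (?D \<omega>)) \<partial>Q) = (\<integral>\<omega>. Z \<omega> \<partial>Q) * exp (z\<^sup>2 * complex_of_real (t - s) / 2)"
  proof (cases "s = t")
    case True then show ?thesis using Z by simp
  next
    case False
    then have st': "s < t" using st by simp
    have D: "?D \<in> borel_measurable Q" using W_measurable st by simp
    have d: "distributed Q lborel ?D (normal_density 0 (sqrt (t - s)))"
      by (rule W_increment_distributed[OF st(1) st'])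
    have p: "0 < sqrt (t - s)" using st' by simp
    have DL: "?D \<in> measurable Q lborel" using D by simp
    have dd: "distr Q lborel ?D = density lborel (normal_density 0 (sqrt (t - s)))"
      using distributed_distr_eq_density[OF d] .
    have "integrable (distr Q lborel ?D) (\<lambda>x. exp (z * complex_of_real x))"
      unfolding dd by (subst integrable_density) (use normal_density_exp_moment(1)[OF p] in auto)
    then have i: "integrable Q (\<lambda>\<omega>. exp (z * complex_of_real (?D \<omega>)))"
      by (subst (asm) integrable_distr_eq[OF DL]) simp_all
    have "(\<integral>\<omega>. exp (z * complex_of_real (?D \<omega>)) \<partial>Q) = (\<integral>x. exp (z * complex_of_real x) \<partial>distr Q lborel ?D)"
      by (subst integral_distr[OF DL]) simp_all
    also have "\<dots> = exp (z\<^sup>2 * complex_of_real (t - s) / 2)"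
      unfolding dd by (subst integral_density) (use normal_density_exp_moment(2)[OF p, of z] st' in auto)
    finally have e: "(\<integral>\<omega>. exp (z * complex_of_real (?D \<omega>)) \<partial>Q) = exp (z\<^sup>2 * complex_of_real (t - s) / 2)" .
    show ?thesis
      using independent_of_integral[OF increment_independent[OF st(1) st'] \<F>_subalgebra D Z(1) _ Z(2) i] e by simp
  qed
  then show "integrable Q (\<lambda>\<omega>. Z \<omega> * exp (z * complex_of_real (?D \<omega>)))"
    "(\<integral>\<omega>. Z \<omega> * exp (z * complex_of_real (?D \<omega>)) \<partial>Q) = (\<integral>\<omega>. Z \<omega> \<partial>Q) * exp (z\<^sup>2 * complex_of_real (t - s) / 2)"
    by auto
qed

text \<open>
  Induction on the number of increments: the last one is independent of all that precedes it. The
  coefficients are complex, so that this single formula covers exponential moments, characteristic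
  functions and mixtures of the two.
\<close>

lemma exp_increments:
  fixes Z :: "'w \<Rightarrow> complex" and z :: "nat \<Rightarrow> complex" and t :: "nat \<Rightarrow> real"
  assumes t0: "0 \<le> t 0" and t: "\<And>j. j < n \<Longrightarrow> t j \<le> t (Suc j)"
    and Z: "Z \<in> borel_measurable (\<F> (t 0))" "integrable Q Z"
  shows "integrable Q (\<lambda>\<omega>. Z \<omega> * exp (\<Sum>j<n. z j * complex_of_real (W (t (Suc j)) \<omega> - W (t j) \<omega>))) \<and>
    (\<integral>\<omega>. Z \<omega> * exp (\<Sum>j<n. z j * complex_of_real (W (t (Suc j)) \<omega> - W (t j) \<omega>)) \<partial>Q) =
      (\<integral>\<omega>. Z \<omega> \<partial>Q) * exp (\<Sum>j<n. (z j)\<^sup>2 * complex_of_real (t (Suc j) - t j) / 2)"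
  using t
proof (induction n)
  case 0
  then show ?case using Z by simp
next
  case (Suc n)
  have mono: "t i \<le> t j" if "i \<le> j" "j \<le> Suc n" for i j
    using that
  proof (induction rule: dec_induct)
    case (step m)
    then show ?case using Suc.prems[of m] by simp
  qed simp
  let ?Y = "\<lambda>\<omega>. Z \<omega> * exp (\<Sum>j<n. z j * complex_of_real (W (t (Suc j)) \<omega> - W (t j) \<omega>))"
  have "W (t j) \<in> borel_measurable (\<F> (t n))" if "j \<le> n" for j
    using mono[of 0 j] mono[of j n] that t0 by (intro W_adapted) auto
  moreover have "Z \<in> borel_measurable (\<F> (t n))"
    using \<F>_measurable_mono[OF Z(1)] mono[of 0 n] by simp
  ultimately have Y: "?Y \<in> borel_measurable (\<F> (t n))"
    by (intro borel_measurable_times borel_measurable_exp borel_measurable_sum borel_measurable_const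
        borel_measurable_diff measurable_compose[OF _ borel_measurable_of_real] measurable_compose[OF _ borel_measurable_exp]) auto
  have IH: "integrable Q ?Y" "(\<integral>\<omega>. ?Y \<omega> \<partial>Q) =
      (\<integral>\<omega>. Z \<omega> \<partial>Q) * exp (\<Sum>j<n. (z j)\<^sup>2 * complex_of_real (t (Suc j) - t j) / 2)"
    using Suc by auto
  have tn: "0 \<le> t n" "t n \<le> t (Suc n)" using t0 mono[of 0 n] Suc.prems[of n] by auto
  have eq: "Z \<omega> * exp (\<Sum>j<Suc n. z j * complex_of_real (W (t (Suc j)) \<omega> - W (t j) \<omega>)) =
     ?Y \<omega> * exp (z n * complex_of_real (W (t (Suc n)) \<omega> - W (t n) \<omega>))" for \<omega>
    by (simp only: sum.lessThan_Suc exp_add mult.assoc)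
  show ?case
    unfolding eq using exp_increment[OF tn Y IH(1), of "z n"] IH(2)
    by (simp only: sum.lessThan_Suc exp_add mult.assoc)
qed

end

section \<open>Wiener integrals of continuously differentiable functions\<close>

text \<open>
  Derivatives are taken within the set, hence one-sided at the ends of an interval: the functions of
  interest contain an integral over \<open>{s..T}\<close> as a function of \<open>s\<close>, which is not differentiable from
  the right at \<open>s = T\<close>.
\<close>

definition C1_deriv_on :: "real set \<Rightarrow> (real \<Rightarrow> real) \<Rightarrow> (real \<Rightarrow> real) \<Rightarrow> bool" where
  "C1_deriv_on A g g' \<longleftrightarrow> continuous_on A g' \<and> (\<forall>x\<in>A. (g has_real_derivative g' x) (at x within A))"

lemma C1_deriv_on_continuous: "C1_deriv_on A g g' \<Longrightarrow> continuous_on A g"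
  unfolding C1_deriv_on_def by (meson DERIV_continuous continuous_on_eq_continuous_within)

lemma C1_deriv_on_subset: "C1_deriv_on A g g' \<Longrightarrow> B \<subseteq> A \<Longrightarrow> C1_deriv_on B g g'"
  unfolding C1_deriv_on_def by (meson DERIV_subset continuous_on_subset subsetD)

lemma C1_deriv_on_const: "C1_deriv_on A (\<lambda>_. c) (\<lambda>_. 0)"
  by (simp add: C1_deriv_on_def)

lemma C1_deriv_on_ident: "C1_deriv_on A (\<lambda>x. x) (\<lambda>_. 1)"
  by (simp add: C1_deriv_on_def)

lemma C1_deriv_on_add:
  "C1_deriv_on A f f' \<Longrightarrow> C1_deriv_on A g g' \<Longrightarrow> C1_deriv_on A (\<lambda>x. f x + g x) (\<lambda>x. f' x + g' x)"
  by (auto simp: C1_deriv_on_def intro!: continuous_intros derivative_eq_intros)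

lemma C1_deriv_on_diff:
  "C1_deriv_on A f f' \<Longrightarrow> C1_deriv_on A g g' \<Longrightarrow> C1_deriv_on A (\<lambda>x. f x - g x) (\<lambda>x. f' x - g' x)"
  by (auto simp: C1_deriv_on_def intro!: continuous_intros derivative_eq_intros)

lemma C1_deriv_on_cmult:
  "C1_deriv_on A f f' \<Longrightarrow> C1_deriv_on A (\<lambda>x. c * f x) (\<lambda>x. c * f' x)"
  by (auto simp: C1_deriv_on_def intro!: continuous_intros derivative_eq_intros)

lemma C1_deriv_on_mult:
  assumes "C1_deriv_on A f f'" "C1_deriv_on A g g'"
  shows "C1_deriv_on A (\<lambda>x. f x * g x) (\<lambda>x. f' x * g x + f x * g' x)"
  using assms C1_deriv_on_continuous[OF assms(1)] C1_deriv_on_continuous[OF assms(2)]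
  by (auto simp: C1_deriv_on_def mult.commute intro!: continuous_intros derivative_eq_intros)

lemma C1_deriv_on_integral:
  assumes "s \<le> t" "C1_deriv_on {s..t} g g'"
  shows "integral {s..t} g' = g t - g s"
  using assms fundamental_theorem_of_calculus[of s t g g']
  by (auto simp: C1_deriv_on_def has_real_derivative_iff_has_vector_derivative intro!: integral_unique)

text \<open>
  The equidistant partition of \<open>{s..t}\<close> has \<open>Suc n\<close> cells, which avoids a division by zero at
  \<open>n = 0\<close>.
\<close>

definition grid :: "real \<Rightarrow> real \<Rightarrow> nat \<Rightarrow> nat \<Rightarrow> real" where
  "grid s t n j = s + (t - s) * real j / real (Suc n)"

lemma grid_0[simp]: "grid s t n 0 = s" by (simp add: grid_def)

lemma grid_Suc_n[simp]: "grid s t n (Suc n) = t" by (simp add: grid_def del: of_nat_Suc)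

lemma grid_step: "grid s t n (Suc j) - grid s t n j = (t - s) / real (Suc n)"
  by (simp add: grid_def diff_divide_distrib[symmetric] algebra_simps del: of_nat_Suc) (simp add: algebra_simps)

lemma grid_mono: "s \<le> t \<Longrightarrow> i \<le> j \<Longrightarrow> grid s t n i \<le> grid s t n j"
  by (simp add: grid_def divide_right_mono mult_left_mono del: of_nat_Suc)

lemma grid_bounds: assumes "s \<le> t" "j \<le> Suc n" shows "s \<le> grid s t n j" "grid s t n j \<le> t"
  using grid_mono[OF assms(1), of 0 j n] grid_mono[OF assms(1,2), of n] by auto

text \<open>
  Let \<open>P\<close> be the claimed limit as a function of its upper end. Over one cell \<open>{x..y}\<close> the summand
  differs from the increment of \<open>P\<close> by \<open>\<integral>\<^sub>x\<^sup>y g' (w - w(y))\<close>, and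
  \<open>w - w(y)\<close> is uniformly small on fine partitions because \<open>w\<close> is continuous.
\<close>

lemma stieltjes_sum_tendsto:
  fixes w :: "real \<Rightarrow> real"
  assumes st: "s \<le> t" and g: "C1_deriv_on {s..t} g g'" and w: "continuous_on {s..t} w"
  shows "(\<lambda>n. \<Sum>j<Suc n. g (grid s t n j) * (w (grid s t n (Suc j)) - w (grid s t n j))) \<longlonglongrightarrow>
     g t * w t - g s * w s - integral {s..t} (\<lambda>u. g' u * w u)"
proof -
  have g': "continuous_on {s..t} g'" using g by (simp add: C1_deriv_on_def)
  have int: "(\<lambda>u. g' u * w u) integrable_on {a..b}" if "s \<le> a" "b \<le> t" for a b
    by (rule integrable_continuous_real) (use that in \<open>auto intro!: continuous_intros continuous_on_subset[OF g'] continuous_on_subset[OF w]\<close>)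
  have int': "g' integrable_on {a..b}" if "s \<le> a" "b \<le> t" for a b
    by (rule integrable_continuous_real) (use that in \<open>auto intro!: continuous_on_subset[OF g']\<close>)
  define P where "P u = g u * w u - integral {s..u} (\<lambda>u. g' u * w u)" for u
  have "bounded (g' ` {s..t})" using compact_continuous_image[OF g'] compact_imp_bounded by blast
  then obtain M where M: "0 < M" "\<And>u. u \<in> {s..t} \<Longrightarrow> \<bar>g' u\<bar> \<le> M"
    unfolding bounded_pos by auto
  show ?thesis
  proof (rule LIMSEQ_I)
    fix r :: real assume r: "r > 0"
    define e where "e = r / (M * (t - s + 1))"
    have e: "e > 0" using r M st by (simp add: e_def)
    have "uniformly_continuous_on {s..t} w" using w compact_uniformly_continuous by blast
    then obtain d where d: "d > 0" "\<And>x y. x \<in> {s..t} \<Longrightarrow> y \<in> {s..t} \<Longrightarrow> \<bar>x - y\<bar> < d \<Longrightarrow> \<bar>w x - w y\<bar> < e"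
      using e unfolding uniformly_continuous_on_def dist_real_def by metis
    obtain N where N: "real N > (t - s) / d" using reals_Archimedean2 by blast
    have "norm ((\<Sum>j<Suc n. g (grid s t n j) * (w (grid s t n (Suc j)) - w (grid s t n j))) - (P t - P s)) < r"
      if "n \<ge> N" for n
    proof -
      let ?D = "(t - s) / real (Suc n)"
      have "t - s < d * real N" using N d by (simp add: divide_less_eq mult.commute)
      also have "\<dots> \<le> d * real (Suc n)" using that d by (simp del: of_nat_Suc)
      finally have D: "?D < d" by (simp add: divide_less_eq)
      have step: "\<bar>g a * (w b - w a) - (P b - P a)\<bar> \<le> M * e * ?D"
        if ab: "s \<le> a" "a \<le> b" "b \<le> t" "b - a = ?D" for a b
      proof -
        have 1: "integral {s..b} (\<lambda>u. g' u * w u) = integral {s..a} (\<lambda>u. g' u * w u) + integral {a..b} (\<lambda>u. g' u * w u)"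
          by (rule Henstock_Kurzweil_Integration.integral_combine[symmetric]) (use ab int in auto)
        have 2: "integral {a..b} g' = g b - g a"
          by (rule C1_deriv_on_integral[OF ab(2) C1_deriv_on_subset[OF g]]) (use ab in auto)
        have "integral {a..b} (\<lambda>u. g' u * (w u - w b)) = integral {a..b} (\<lambda>u. g' u * w u) - integral {a..b} (\<lambda>u. g' u * w b)"
          by (simp only: right_diff_distrib, rule Henstock_Kurzweil_Integration.integral_diff)
            (use ab int int' in \<open>auto intro: integrable_on_mult_left\<close>)
        also have "integral {a..b} (\<lambda>u. g' u * w b) = (g b - g a) * w b" by (simp add: 2)
        finally have "g a * (w b - w a) - (P b - P a) = integral {a..b} (\<lambda>u. g' u * (w u - w b))"
          by (simp add: P_def 1 algebra_simps)
        also have "\<bar>\<dots>\<bar> \<le> M * e * (b - a)"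
        proof (rule integral_bound[where 'a=real, simplified real_norm_def])
          show "continuous_on {a..b} (\<lambda>u. g' u * (w u - w b))"
            using ab by (auto intro!: continuous_intros continuous_on_subset[OF g'] continuous_on_subset[OF w])
          fix u assume u: "u \<in> {a..b}"
          then have "\<bar>w u - w b\<bar> \<le> e" using d(2)[of u b] ab D by force
          then show "\<bar>g' u * (w u - w b)\<bar> \<le> M * e"
            using M(2)[of u] u ab M(1) by (auto simp: abs_mult intro!: mult_mono)
        qed (use ab in auto)
        finally show ?thesis using ab by simp
      qed
      have tel: "P t - P s = (\<Sum>j<Suc n. P (grid s t n (Suc j)) - P (grid s t n j))"
        by (subst sum_lessThan_telescope) simp
      have "norm ((\<Sum>j<Suc n. g (grid s t n j) * (w (grid s t n (Suc j)) - w (grid s t n j))) - (P t - P s))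
         = \<bar>\<Sum>j<Suc n. g (grid s t n j) * (w (grid s t n (Suc j)) - w (grid s t n j)) - (P (grid s t n (Suc j)) - P (grid s t n j))\<bar>"
        unfolding tel by (simp only: sum_subtractf real_norm_def)
      also have "\<dots> \<le> (\<Sum>j<Suc n. M * e * ?D)"
        by (rule order_trans[OF sum_abs], rule sum_mono, rule step)
           (use grid_bounds[OF st] grid_mono[OF st] grid_step in \<open>auto simp del: of_nat_Suc grid_Suc_n\<close>)
      also have "\<dots> = M * e * (t - s)" by (simp del: of_nat_Suc)
      also have "\<dots> = r * ((t - s) / (t - s + 1))" using M by (simp add: e_def)
      also have "\<dots> < r * 1" using st r by (intro mult_strict_left_mono) (auto simp: divide_less_eq)
      also have "\<dots> = r" by simp
      finally show ?thesis .
    qed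
    moreover have "P t - P s = g t * w t - g s * w s - integral {s..t} (\<lambda>u. g' u * w u)"
      by (simp add: P_def)
    ultimately show "\<exists>no. \<forall>n\<ge>no. norm ((\<Sum>j<Suc n. g (grid s t n j) * (w (grid s t n (Suc j)) - w (grid s t n j)))
       - (g t * w t - g s * w s - integral {s..t} (\<lambda>u. g' u * w u))) < r" by metis
  qed
qed

text \<open>
  The preceding lemma for the path \<open>w u = u\<close>, followed by a partial integration back.
\<close>

lemma grid_sum_tendsto_integral:
  assumes st: "s \<le> t" and g: "C1_deriv_on {s..t} g g'"
  shows "(\<lambda>n. \<Sum>j<Suc n. g (grid s t n j) * (grid s t n (Suc j) - grid s t n j)) \<longlonglongrightarrow> integral {s..t} g"
proof -
  have "integral {s..t} (\<lambda>u. g' u * u + g u * 1) = g t * t - g s * s"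
    by (rule C1_deriv_on_integral[OF st C1_deriv_on_mult[OF g C1_deriv_on_ident]])
  moreover have "integral {s..t} (\<lambda>u. g' u * u + g u * 1) = integral {s..t} (\<lambda>u. g' u * u) + integral {s..t} g"
    using g C1_deriv_on_continuous[OF g]
    by (subst Henstock_Kurzweil_Integration.integral_add)
       (auto simp: C1_deriv_on_def intro!: integrable_continuous_real continuous_intros)
  ultimately have "integral {s..t} g = g t * t - g s * s - integral {s..t} (\<lambda>u. g' u * u)" by linarith
  then show ?thesis
    using stieltjes_sum_tendsto[OF st g, of "\<lambda>x. x"] by simp
qed

definition wiener_sum :: "(real \<Rightarrow> 'w \<Rightarrow> real) \<Rightarrow> (real \<Rightarrow> real) \<Rightarrow> real \<Rightarrow> real \<Rightarrow> nat \<Rightarrow> 'w \<Rightarrow> real" where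
  "wiener_sum W g s t n \<omega> = (\<Sum>j<Suc n. g (grid s t n j) * (W (grid s t n (Suc j)) \<omega> - W (grid s t n j) \<omega>))"

text \<open>
  Taking the limit of the left-point sums as the definition, rather than the formula obtained by
  partial integration, makes the integral measurable with respect to the filtration without any
  exceptional set of paths.
\<close>

definition wiener_integral :: "(real \<Rightarrow> 'w \<Rightarrow> real) \<Rightarrow> (real \<Rightarrow> real) \<Rightarrow> real \<Rightarrow> real \<Rightarrow> 'w \<Rightarrow> real" where
  "wiener_integral W g s t \<omega> = lim (\<lambda>n. wiener_sum W g s t n \<omega>)"

lemma wiener_integral_pathwise:
  assumes "0 \<le> s" "s \<le> t" "C1_deriv_on {s..t} g g'" "continuous_on {0..} (\<lambda>u. W u \<omega>)"
  shows "(\<lambda>n. wiener_sum W g s t n \<omega>) \<longlonglongrightarrow> wiener_integral W g s t \<omega>"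
    and "wiener_integral W g s t \<omega> = g t * W t \<omega> - g s * W s \<omega> - integral {s..t} (\<lambda>u. g' u * W u \<omega>)"
proof -
  have "continuous_on {s..t} (\<lambda>u. W u \<omega>)" by (rule continuous_on_subset[OF assms(4)]) (use assms in auto)
  from stieltjes_sum_tendsto[OF assms(2,3) this]
  have *: "(\<lambda>n. wiener_sum W g s t n \<omega>) \<longlonglongrightarrow> g t * W t \<omega> - g s * W s \<omega> - integral {s..t} (\<lambda>u. g' u * W u \<omega>)"
    by (simp add: wiener_sum_def del: sum.lessThan_Suc)
  then show "wiener_integral W g s t \<omega> = g t * W t \<omega> - g s * W s \<omega> - integral {s..t} (\<lambda>u. g' u * W u \<omega>)"
    unfolding wiener_integral_def by (rule limI)
  with * show "(\<lambda>n. wiener_sum W g s t n \<omega>) \<longlonglongrightarrow> wiener_integral W g s t \<omega>" by simp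
qed

lemma wiener_integral_same[simp]: "wiener_integral W g s s \<omega> = 0"
  by (simp add: wiener_integral_def wiener_sum_def grid_def)

context brownian
begin

abbreviation I :: "(real \<Rightarrow> real) \<Rightarrow> real \<Rightarrow> real \<Rightarrow> 'w \<Rightarrow> real" where "I \<equiv> wiener_integral W"

lemma wiener_sum_measurable:
  assumes "0 \<le> s" "s \<le> t" shows "wiener_sum W g s t n \<in> borel_measurable (\<F> t)"
proof -
  have "W (grid s t n j) \<in> borel_measurable (\<F> t)" if "j \<le> Suc n" for j
    using grid_bounds[OF assms(2) that] assms by (intro W_adapted) auto
  then show ?thesis
    unfolding wiener_sum_def
    by (intro borel_measurable_sum borel_measurable_times borel_measurable_diff borel_measurable_const) auto
qed

lemma wiener_integral_measurable:
  assumes "0 \<le> s" "s \<le> t" shows "I g s t \<in> borel_measurable (\<F> t)"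
  unfolding wiener_integral_def by (intro borel_measurable_lim_metric wiener_sum_measurable assms)

lemma wiener_integral_measurable_Q:
  assumes "0 \<le> s" "s \<le> t" shows "I g s t \<in> borel_measurable Q"
  by (rule \<F>_measurable_Q[OF wiener_integral_measurable[OF assms]])

lemma AE_wiener_integral:
  assumes "0 \<le> s" "s \<le> t" "C1_deriv_on {s..t} g g'"
  shows "AE \<omega> in Q. I g s t \<omega> = g t * W t \<omega> - g s * W s \<omega> - integral {s..t} (\<lambda>u. g' u * W u \<omega>)"
  using W_continuous by eventually_elim (rule wiener_integral_pathwise[OF assms])

text \<open>
  Limit of \<open>exp_increments\<close> along the left-point sums. Their exponentials are bounded in \<open>L\<^sup>2\<close>,
  since \<open>\<bar>exp z\<bar>\<^sup>2 = exp (2 Re z)\<close> is again covered by that lemma and its expectation converges.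
\<close>

lemma exp_wiener_integral:
  assumes st: "0 \<le> s" "s \<le> t" and g: "C1_deriv_on {s..t} g g'" and h: "C1_deriv_on {s..t} h h'"
    and B: "B \<in> sets (\<F> s)"
  shows "integrable Q (\<lambda>\<omega>. indicator B \<omega> *\<^sub>R exp (Complex (I g s t \<omega>) (I h s t \<omega>)))"
    and "(\<integral>\<omega>. indicator B \<omega> *\<^sub>R exp (Complex (I g s t \<omega>) (I h s t \<omega>)) \<partial>Q) =
      prob B *\<^sub>R exp (Complex ((integral {s..t} (\<lambda>u. g u * g u) - integral {s..t} (\<lambda>u. h u * h u)) / 2)
         (integral {s..t} (\<lambda>u. g u * h u)))"
proof -
  define f where "f n \<omega> = indicator B \<omega> *\<^sub>R exp (Complex (wiener_sum W g s t n \<omega>) (wiener_sum W h s t n \<omega>))" for n \<omega>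
  let ?S = "\<lambda>k n. \<Sum>j<Suc n. k (grid s t n j) * (grid s t n (Suc j) - grid s t n j)"
  have BQ[measurable]: "B \<in> sets Q" using B \<F>_subalgebra[of s] by (auto simp: subalgebra_def)
  have [measurable]: "wiener_sum W k s t n \<in> borel_measurable Q" for k n
    by (rule \<F>_measurable_Q[OF wiener_sum_measurable[OF st]])
  have [measurable]: "I k s t \<in> borel_measurable Q" for k
    by (rule wiener_integral_measurable_Q[OF st])
  have Complex_eq': "Complex a b = complex_of_real a + \<i> * complex_of_real b" for a b
    by (simp add: complex_eq_iff)
  have fm: "f n \<in> borel_measurable Q" for n
    unfolding f_def Complex_eq' by measurable
  have Fm: "(\<lambda>\<omega>. indicator B \<omega> *\<^sub>R exp (Complex (I g s t \<omega>) (I h s t \<omega>))) \<in> borel_measurable Q"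
    unfolding Complex_eq' by measurable
  have lim: "AE \<omega> in Q. (\<lambda>n. f n \<omega>) \<longlonglongrightarrow> indicator B \<omega> *\<^sub>R exp (Complex (I g s t \<omega>) (I h s t \<omega>))"
    using W_continuous unfolding f_def
    by eventually_elim (intro tendsto_intros wiener_integral_pathwise(1)[OF st g] wiener_integral_pathwise(1)[OF st h])
  have moment: "integrable Q (\<lambda>\<omega>. indicator A \<omega> *\<^sub>R exp (\<Sum>j<Suc n. z j * complex_of_real (W (grid s t n (Suc j)) \<omega> - W (grid s t n j) \<omega>)))
     \<and> (\<integral>\<omega>. indicator A \<omega> *\<^sub>R exp (\<Sum>j<Suc n. z j * complex_of_real (W (grid s t n (Suc j)) \<omega> - W (grid s t n j) \<omega>)) \<partial>Q)
      = prob A *\<^sub>R exp (\<Sum>j<Suc n. (z j)\<^sup>2 * complex_of_real (grid s t n (Suc j) - grid s t n j) / 2)"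
    if A: "A \<in> sets (\<F> s)" for A z n
  proof -
    have [measurable]: "A \<in> sets Q" using A \<F>_subalgebra[of s] by (auto simp: subalgebra_def)
    have 1: "(\<lambda>\<omega>. complex_of_real (indicator A \<omega>)) \<in> borel_measurable (\<F> (grid s t n 0))"
      using A by simp
    have 2: "integrable Q (\<lambda>\<omega>. complex_of_real (indicator A \<omega>))"
      by (simp add: complex_of_real_integrable_eq integrable_real_indicator emeasure_eq_measure)
    have 3: "(\<integral>\<omega>. complex_of_real (indicator A \<omega>) \<partial>Q) = complex_of_real (prob A)"
      by (simp add: integral_complex_of_real)
    show ?thesis
      using exp_increments[of "grid s t n" "Suc n" "\<lambda>\<omega>. complex_of_real (indicator A \<omega>)" z, OF _ _ 1 2] st
      unfolding 3 scaleR_conv_of_real by (simp add: grid_mono del: sum.lessThan_Suc)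
  qed
  have sum_eq: "Complex (wiener_sum W g s t n \<omega>) (wiener_sum W h s t n \<omega>) =
      (\<Sum>j<Suc n. Complex (g (grid s t n j)) (h (grid s t n j)) * complex_of_real (W (grid s t n (Suc j)) \<omega> - W (grid s t n j) \<omega>))" for n \<omega>
    unfolding wiener_sum_def complex_eq_iff Re_sum Im_sum by (auto intro!: sum.cong)
  have norm_f: "(norm (f n \<omega>))\<^sup>2 = indicator B \<omega> * exp (2 * wiener_sum W g s t n \<omega>)" for n \<omega>
    by (auto simp: f_def indicator_def exp_double)
  have sum_eq2: "complex_of_real (exp (2 * wiener_sum W g s t n \<omega>)) =
      exp (\<Sum>j<Suc n. complex_of_real (2 * g (grid s t n j)) * complex_of_real (W (grid s t n (Suc j)) \<omega> - W (grid s t n j) \<omega>))" for n \<omega>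
    unfolding exp_of_real[symmetric] wiener_sum_def by (simp add: sum_distrib_left mult.assoc del: sum.lessThan_Suc)
  have sq: "integrable Q (\<lambda>\<omega>. (norm (f n \<omega>))\<^sup>2) \<and> (\<integral>\<omega>. (norm (f n \<omega>))\<^sup>2 \<partial>Q) = prob B * exp (2 * ?S (\<lambda>u. g u * g u) n)" for n
  proof -
    note m = moment[of B "\<lambda>j. complex_of_real (2 * g (grid s t n j))" n, OF B, folded sum_eq2]
    have a: "indicator B \<omega> *\<^sub>R complex_of_real (exp (2 * wiener_sum W g s t n \<omega>)) = complex_of_real ((norm (f n \<omega>))\<^sup>2)" for \<omega>
      unfolding norm_f by (simp add: scaleR_conv_of_real)
    have b: "prob B *\<^sub>R exp (\<Sum>j<Suc n. (complex_of_real (2 * g (grid s t n j)))\<^sup>2 * complex_of_real (grid s t n (Suc j) - grid s t n j) / 2)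
       = complex_of_real (prob B * exp (2 * ?S (\<lambda>u. g u * g u) n))"
    proof -
      have "(\<Sum>j<Suc n. (complex_of_real (2 * g (grid s t n j)))\<^sup>2 * complex_of_real (grid s t n (Suc j) - grid s t n j) / 2)
         = complex_of_real (2 * ?S (\<lambda>u. g u * g u) n)"
        unfolding sum_distrib_left of_real_sum by (rule sum.cong) (auto simp: power2_eq_square)
      then show ?thesis unfolding exp_of_real scaleR_conv_of_real by (simp only: exp_of_real of_real_mult[of "prob B"])
    qed
    show ?thesis using m unfolding a b by (simp only: complex_of_real_integrable_eq integral_complex_of_real of_real_eq_iff)
  qed
  have "convergent (?S (\<lambda>u. g u * g u))"
    using grid_sum_tendsto_integral[OF st(2) C1_deriv_on_mult[OF g g]] convergentI by blast
  then have "Bseq (?S (\<lambda>u. g u * g u))" by (rule convergent_imp_Bseq)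
  then obtain K where K': "\<forall>n. norm (?S (\<lambda>u. g u * g u) n) \<le> K" by (rule BseqE)
  have K: "?S (\<lambda>u. g u * g u) n \<le> K" for n
    using K'[rule_format, of n] unfolding real_norm_def by (rule order_trans[OF abs_ge_self])
  have bound: "(\<integral>\<omega>. (norm (f n \<omega>))\<^sup>2 \<partial>Q) \<le> exp (2 * K)" for n
  proof -
    have "prob B * exp (2 * ?S (\<lambda>u. g u * g u) n) \<le> 1 * exp (2 * K)"
      using K[of n] by (intro mult_mono) auto
    then show ?thesis using sq[of n] by (simp del: sum.lessThan_Suc)
  qed
  note conv = integral_tendsto_of_L2_bounded[OF fm Fm lim conjunct1[OF sq] bound]
  show "integrable Q (\<lambda>\<omega>. indicator B \<omega> *\<^sub>R exp (Complex (I g s t \<omega>) (I h s t \<omega>)))" by (rule conv(1))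
  have "(\<integral>\<omega>. f n \<omega> \<partial>Q) = prob B *\<^sub>R exp (Complex ((?S (\<lambda>u. g u * g u) n - ?S (\<lambda>u. h u * h u) n) / 2) (?S (\<lambda>u. g u * h u) n))" for n
  proof -
    have "(\<Sum>j<Suc n. (Complex (g (grid s t n j)) (h (grid s t n j)))\<^sup>2 * complex_of_real (grid s t n (Suc j) - grid s t n j) / 2)
       = Complex ((?S (\<lambda>u. g u * g u) n - ?S (\<lambda>u. h u * h u) n) / 2) (?S (\<lambda>u. g u * h u) n)"
      unfolding complex_eq_iff Re_sum Im_sum complex.sel diff_divide_distrib sum_divide_distrib sum_subtractf[symmetric]
      by (auto intro!: sum.cong simp: power2_eq_square field_simps)
    then show ?thesis using moment[of B "\<lambda>j. Complex (g (grid s t n j)) (h (grid s t n j))" n, OF B]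
      unfolding f_def sum_eq by simp
  qed
  then have "(\<lambda>n. \<integral>\<omega>. f n \<omega> \<partial>Q) \<longlonglongrightarrow> prob B *\<^sub>R exp (Complex ((integral {s..t} (\<lambda>u. g u * g u) - integral {s..t} (\<lambda>u. h u * h u)) / 2)
         (integral {s..t} (\<lambda>u. g u * h u)))"
    by (simp only:) (intro tendsto_intros grid_sum_tendsto_integral[OF st(2) C1_deriv_on_mult[OF g g]]
       grid_sum_tendsto_integral[OF st(2) C1_deriv_on_mult[OF h h]] grid_sum_tendsto_integral[OF st(2) C1_deriv_on_mult[OF g h]], simp)
  from LIMSEQ_unique[OF conv(2) this]
  show "(\<integral>\<omega>. indicator B \<omega> *\<^sub>R exp (Complex (I g s t \<omega>) (I h s t \<omega>)) \<partial>Q) =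
      prob B *\<^sub>R exp (Complex ((integral {s..t} (\<lambda>u. g u * g u) - integral {s..t} (\<lambda>u. h u * h u)) / 2)
         (integral {s..t} (\<lambda>u. g u * h u)))" .
qed

lemma AE_wiener_integral_linear:
  assumes "0 \<le> s" "s \<le> t" "C1_deriv_on {s..t} f f'" "C1_deriv_on {s..t} g g'"
  shows "AE \<omega> in Q. I (\<lambda>u. \<alpha> * f u + \<beta> * g u) s t \<omega> = \<alpha> * I f s t \<omega> + \<beta> * I g s t \<omega>"
  using W_continuous
proof eventually_elim
  fix \<omega> assume c: "continuous_on {0..} (\<lambda>u. W u \<omega>)"
  have "wiener_sum W (\<lambda>u. \<alpha> * f u + \<beta> * g u) s t n \<omega> = \<alpha> * wiener_sum W f s t n \<omega> + \<beta> * wiener_sum W g s t n \<omega>" for n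
    unfolding wiener_sum_def sum_distrib_left sum.distrib[symmetric] by (rule sum.cong) (auto simp: algebra_simps)
  then have "(\<lambda>n. wiener_sum W (\<lambda>u. \<alpha> * f u + \<beta> * g u) s t n \<omega>) \<longlonglongrightarrow> \<alpha> * I f s t \<omega> + \<beta> * I g s t \<omega>"
    by (simp only:) (intro tendsto_intros wiener_integral_pathwise(1)[where W=W and \<omega>=\<omega>, OF assms(1-3) c]
      wiener_integral_pathwise(1)[where W=W and \<omega>=\<omega>, OF assms(1,2,4) c])
  then show "I (\<lambda>u. \<alpha> * f u + \<beta> * g u) s t \<omega> = \<alpha> * I f s t \<omega> + \<beta> * I g s t \<omega>"
    unfolding wiener_integral_def by (rule limI)
qed

lemma AE_wiener_integral_cmult:
  assumes "0 \<le> s" "s \<le> t" "C1_deriv_on {s..t} f f'"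
  shows "AE \<omega> in Q. I (\<lambda>u. c * f u) s t \<omega> = c * I f s t \<omega>"
  using AE_wiener_integral_linear[OF assms assms(3), of c 0] by simp

lemma AE_wiener_integral_diff:
  assumes "0 \<le> s" "s \<le> t" "C1_deriv_on {s..t} f f'" "C1_deriv_on {s..t} g g'"
  shows "AE \<omega> in Q. I (\<lambda>u. f u - g u) s t \<omega> = I f s t \<omega> - I g s t \<omega>"
  using AE_wiener_integral_linear[OF assms, of 1 "-1"] by simp

lemma wiener_integral_zero[simp]: "I (\<lambda>_. 0) s t \<omega> = 0"
  by (simp add: wiener_integral_def wiener_sum_def)

lemma AE_wiener_integral_combine:
  assumes "0 \<le> s" "s \<le> u" "u \<le> t" "C1_deriv_on {s..t} g g'"
  shows "AE \<omega> in Q. I g s t \<omega> = I g s u \<omega> + I g u t \<omega>"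
  using W_continuous
proof eventually_elim
  fix \<omega> assume c: "continuous_on {0..} (\<lambda>u. W u \<omega>)"
  have g: "C1_deriv_on {s..u} g g'" "C1_deriv_on {u..t} g g'"
    using assms by (auto intro: C1_deriv_on_subset)
  have "(\<lambda>v. g' v * W v \<omega>) integrable_on {s..t}"
    using assms by (auto simp: C1_deriv_on_def intro!: integrable_continuous_real continuous_intros continuous_on_subset[OF c])
  then have "integral {s..t} (\<lambda>v. g' v * W v \<omega>) = integral {s..u} (\<lambda>v. g' v * W v \<omega>) + integral {u..t} (\<lambda>v. g' v * W v \<omega>)"
    using assms by (intro Henstock_Kurzweil_Integration.integral_combine[symmetric]) auto
  then show "I g s t \<omega> = I g s u \<omega> + I g u t \<omega>"
    using wiener_integral_pathwise(2)[where W=W and \<omega>=\<omega>, OF _ _ assms(4) c] wiener_integral_pathwise(2)[where W=W and \<omega>=\<omega>, OF _ _ g(1) c]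
      wiener_integral_pathwise(2)[where W=W and \<omega>=\<omega>, OF _ _ g(2) c] assms by simp
qed

lemma exp_wiener_integral_real:
  assumes st: "0 \<le> s" "s \<le> t" and g: "C1_deriv_on {s..t} g g'" and B: "B \<in> sets (\<F> s)"
  shows "integrable Q (\<lambda>\<omega>. indicator B \<omega> * exp (I g s t \<omega>))"
    and "(\<integral>\<omega>. indicator B \<omega> * exp (I g s t \<omega>) \<partial>Q) = prob B * exp (integral {s..t} (\<lambda>u. g u * g u) / 2)"
proof -
  have eq: "indicator B \<omega> *\<^sub>R exp (Complex (I g s t \<omega>) (I (\<lambda>_. 0) s t \<omega>)) = complex_of_real (indicator B \<omega> * exp (I g s t \<omega>))" for \<omega>
    by (simp add: complex_of_real_def[symmetric] scaleR_conv_of_real exp_of_real)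
  have eq2: "prob B *\<^sub>R exp (Complex ((integral {s..t} (\<lambda>u. g u * g u) - integral {s..t} (\<lambda>u. 0 * 0)) / 2)
         (integral {s..t} (\<lambda>u. g u * 0))) = complex_of_real (prob B * exp (integral {s..t} (\<lambda>u. g u * g u) / 2))"
    by (simp add: complex_of_real_def[symmetric] scaleR_conv_of_real exp_of_real del: of_real_divide)
  note e = exp_wiener_integral[OF st g C1_deriv_on_const[of _ 0] B, unfolded eq eq2]
  show "integrable Q (\<lambda>\<omega>. indicator B \<omega> * exp (I g s t \<omega>))"
    using e(1) by (simp only: complex_of_real_integrable_eq)
  show "(\<integral>\<omega>. indicator B \<omega> * exp (I g s t \<omega>) \<partial>Q) = prob B * exp (integral {s..t} (\<lambda>u. g u * g u) / 2)"
    using e(2) by (simp only: integral_complex_of_real of_real_eq_iff)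
qed

text \<open>
  With the indicator of \<open>B\<close> as a weight, the characteristic function of the integral is that of
  the centred normal law with variance \<open>v\<close>, whatever the event \<open>B\<close> of the past. The case \<open>v = 0\<close> is
  included because the law appears as that of \<open>sqrt v\<close> times a standard normal variable.
\<close>

lemma wiener_integral_law:
  assumes st: "0 \<le> s" "s \<le> t" and g: "C1_deriv_on {s..t} g g'" and B: "B \<in> sets (\<F> s)"
    and h: "h \<in> borel_measurable borel"
  defines "v \<equiv> integral {s..t} (\<lambda>u. g u * g u)"
  shows "(\<integral>\<omega>. indicator B \<omega> * h (I g s t \<omega>) \<partial>Q) = prob B * (\<integral>y. std_normal_density y * h (sqrt v * y) \<partial>lborel)"
    and "integrable lborel (\<lambda>y. std_normal_density y * h (sqrt v * y)) \<Longrightarrow> integrable Q (\<lambda>\<omega>. indicator B \<omega> * h (I g s t \<omega>))"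
proof -
  have v: "0 \<le> v"
    unfolding v_def by (rule Henstock_Kurzweil_Integration.integral_nonneg)
      (use C1_deriv_on_continuous[OF g] in \<open>auto intro!: integrable_continuous_real continuous_intros\<close>)
  have BQ[measurable]: "B \<in> sets Q" using B \<F>_subalgebra[of s] by (auto simp: subalgebra_def)
  have Im[measurable]: "I k s t \<in> borel_measurable Q" for k
    by (rule wiener_integral_measurable_Q[OF st])
  have char: "(\<integral>\<omega>. indicator B \<omega> *\<^sub>R iexp (u * I g s t \<omega>) \<partial>Q) =
     (\<integral>\<omega>. indicator B \<omega> \<partial>Q) *\<^sub>R exp (\<i> * complex_of_real (u * 0) - complex_of_real (u\<^sup>2 * (sqrt v)\<^sup>2 / 2))" for u
  proof -
    have c: "Complex 0 (u * x) = \<i> * complex_of_real (u * x)" for x by (simp add: complex_eq_iff)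
    have "(\<integral>\<omega>. indicator B \<omega> *\<^sub>R iexp (u * I g s t \<omega>) \<partial>Q) =
      (\<integral>\<omega>. indicator B \<omega> *\<^sub>R exp (Complex (I (\<lambda>_. 0) s t \<omega>) (I (\<lambda>x. u * g x) s t \<omega>)) \<partial>Q)"
    proof (rule integral_cong_AE)
      have *: "Complex 0 x = \<i> * complex_of_real x" for x by (simp add: complex_eq_iff)
      show "(\<lambda>\<omega>. indicator B \<omega> *\<^sub>R exp (Complex (I (\<lambda>_. 0) s t \<omega>) (I (\<lambda>x. u * g x) s t \<omega>))) \<in> borel_measurable Q"
        unfolding wiener_integral_zero * by measurable
      show "AE \<omega> in Q. indicator B \<omega> *\<^sub>R iexp (u * I g s t \<omega>) =
         indicator B \<omega> *\<^sub>R exp (Complex (I (\<lambda>_. 0) s t \<omega>) (I (\<lambda>x. u * g x) s t \<omega>))"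
        using AE_wiener_integral_linear[OF st g g, of u 0] by eventually_elim (simp add: c)
    qed simp
    also have "\<dots> = prob B *\<^sub>R exp (Complex ((integral {s..t} (\<lambda>x. 0 * 0) - integral {s..t} (\<lambda>x. (u * g x) * (u * g x))) / 2)
         (integral {s..t} (\<lambda>x. 0 * (u * g x))))"
      by (rule exp_wiener_integral(2)[OF st C1_deriv_on_const C1_deriv_on_cmult[OF g] B])
    also have "integral {s..t} (\<lambda>x. (u * g x) * (u * g x)) = u\<^sup>2 * v"
      unfolding v_def by (subst integral_mult_right[symmetric]) (simp add: power2_eq_square mult.assoc mult.left_commute)
    also have "Complex ((integral {s..t} (\<lambda>x. 0 * 0) - u\<^sup>2 * v) / 2) (integral {s..t} (\<lambda>x. 0 * (u * g x)))
       = \<i> * complex_of_real (u * 0) - complex_of_real (u\<^sup>2 * (sqrt v)\<^sup>2 / 2)"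
      using v by (simp add: complex_eq_iff)
    finally show ?thesis by simp
  qed
  have "integrable Q (indicator B :: _ \<Rightarrow> real)" by (simp add: integrable_real_indicator emeasure_eq_measure)
  note law = weighted_law_of_char[OF this _ Im h char]
  show "(\<integral>\<omega>. indicator B \<omega> * h (I g s t \<omega>) \<partial>Q) = prob B * (\<integral>y. std_normal_density y * h (sqrt v * y) \<partial>lborel)"
    using law(1) by simp
  show "integrable lborel (\<lambda>y. std_normal_density y * h (sqrt v * y)) \<Longrightarrow> integrable Q (\<lambda>\<omega>. indicator B \<omega> * h (I g s t \<omega>))"
    using law(2) by simp
qed

lemma space_in_\<F>: "space Q \<in> sets (\<F> t)"
  using sets.top[of "\<F> t"] by simp

lemma wiener_integral_independent:
  assumes st: "0 \<le> s" "s \<le> t" and g: "C1_deriv_on {s..t} g g'"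
  shows "independent_of (\<F> s) (I g s t)"
  unfolding independent_of_def
proof safe
  fix B and A :: "real set" assume B: "B \<in> sets (\<F> s)" and A: "A \<in> sets borel"
  have BQ[measurable]: "B \<in> sets Q" using B \<F>_subalgebra[of s] by (auto simp: subalgebra_def)
  have h: "(indicator A :: real \<Rightarrow> real) \<in> borel_measurable borel" using A by simp
  have *: "(\<integral>\<omega>. indicator C \<omega> * indicator A (I g s t \<omega>) \<partial>Q) = prob (C \<inter> (I g s t -` A \<inter> space Q))" if "C \<in> sets Q" for C
  proof -
    have "I g s t -` A \<inter> space Q \<in> sets Q" using A wiener_integral_measurable_Q[OF st] by (rule measurable_sets[rotated])
    then have "C \<inter> (I g s t -` A \<inter> space Q) \<in> sets Q" using that by auto
    then have "prob (C \<inter> (I g s t -` A \<inter> space Q)) = (\<integral>\<omega>. indicator (C \<inter> (I g s t -` A \<inter> space Q)) \<omega> \<partial>Q)" by simp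
    also have "\<dots> = (\<integral>\<omega>. indicator C \<omega> * indicator A (I g s t \<omega>) \<partial>Q)"
      by (rule Bochner_Integration.integral_cong) (auto simp: indicator_def)
    finally show ?thesis by simp
  qed
  have "prob (space Q \<inter> (I g s t -` A \<inter> space Q)) = prob (space Q) * (\<integral>y. std_normal_density y * indicator A (sqrt (integral {s..t} (\<lambda>u. g u * g u)) * y) \<partial>lborel)"
    using wiener_integral_law(1)[OF st g space_in_\<F> h] * by simp
  moreover have "prob (B \<inter> (I g s t -` A \<inter> space Q)) = prob B * (\<integral>y. std_normal_density y * indicator A (sqrt (integral {s..t} (\<lambda>u. g u * g u)) * y) \<partial>lborel)"
    using wiener_integral_law(1)[OF st g B h] *[OF BQ] by simp
  ultimately show "prob (B \<inter> (I g s t -` A \<inter> space Q)) = prob B * prob (I g s t -` A \<inter> space Q)"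
    by (simp add: prob_space Int_absorb1)
qed

lemma wiener_integral_mean:
  fixes Z :: "'w \<Rightarrow> real"
  assumes st: "0 \<le> s" "s \<le> t" and g: "C1_deriv_on {s..t} g g'" and Z: "Z \<in> borel_measurable (\<F> s)" "integrable Q Z"
  shows "has_bochner_integral Q (\<lambda>\<omega>. Z \<omega> * I g s t \<omega>) 0"
proof -
  have id: "(\<lambda>x. x) \<in> borel_measurable (borel :: real measure)" by simp
  let ?v = "integral {s..t} (\<lambda>u. g u * g u)"
  have eq: "(\<lambda>y. std_normal_density y * (sqrt ?v * y)) = (\<lambda>y. sqrt ?v * (std_normal_density y * y ^ (2 * 0 + 1)))"
    by (auto simp: algebra_simps)
  have "has_bochner_integral lborel (\<lambda>y. std_normal_density y * (sqrt ?v * y)) (sqrt ?v * 0)"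
    unfolding eq by (rule has_bochner_integral_mult_right) (use std_normal_moment_odd[of 0] in auto)
  then have n: "integrable lborel (\<lambda>y. std_normal_density y * (sqrt ?v * y))" "(\<integral>y. std_normal_density y * (sqrt ?v * y) \<partial>lborel) = 0"
    by (simp_all add: has_bochner_integral_iff)
  have 1: "(\<integral>\<omega>. indicator (space Q) \<omega> * I g s t \<omega> \<partial>Q) = (\<integral>\<omega>. I g s t \<omega> \<partial>Q)"
    by (rule Bochner_Integration.integral_cong) auto
  have 2: "integrable Q (\<lambda>\<omega>. indicator (space Q) \<omega> * I g s t \<omega>) \<longleftrightarrow> integrable Q (I g s t)"
    by (rule Bochner_Integration.integrable_cong) auto
  have i: "integrable Q (I g s t)" and m: "(\<integral>\<omega>. I g s t \<omega> \<partial>Q) = 0"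
    using wiener_integral_law[OF st g space_in_\<F> id] n 1 2 by auto
  show ?thesis
    using independent_of_integral[OF wiener_integral_independent[OF st g] \<F>_subalgebra wiener_integral_measurable_Q[OF st] Z(1) id Z(2) i] m
    by (simp add: has_bochner_integral_iff)
qed

lemma wiener_integral_square:
  fixes Z :: "'w \<Rightarrow> real"
  assumes st: "0 \<le> s" "s \<le> t" and g: "C1_deriv_on {s..t} g g'" and Z: "Z \<in> borel_measurable (\<F> s)" "integrable Q Z"
  shows "has_bochner_integral Q (\<lambda>\<omega>. Z \<omega> * (I g s t \<omega>)\<^sup>2) ((\<integral>\<omega>. Z \<omega> \<partial>Q) * integral {s..t} (\<lambda>u. g u * g u))"
proof -
  have sq: "(\<lambda>x. x\<^sup>2) \<in> borel_measurable (borel :: real measure)" by simp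
  let ?v = "integral {s..t} (\<lambda>u. g u * g u)"
  have v: "0 \<le> ?v"
    by (rule Henstock_Kurzweil_Integration.integral_nonneg)
      (use C1_deriv_on_continuous[OF g] in \<open>auto intro!: integrable_continuous_real continuous_intros\<close>)
  have eq: "(\<lambda>y. std_normal_density y * (sqrt ?v * y)\<^sup>2) = (\<lambda>y. ?v * (std_normal_density y * y ^ (2 * 1)))"
    using v by (auto simp: power_mult_distrib)
  have "has_bochner_integral lborel (\<lambda>y. std_normal_density y * (sqrt ?v * y)\<^sup>2) (?v * 1)"
    unfolding eq by (rule has_bochner_integral_mult_right) (use std_normal_moment_even[of 1] in auto)
  then have n: "integrable lborel (\<lambda>y. std_normal_density y * (sqrt ?v * y)\<^sup>2)" "(\<integral>y. std_normal_density y * (sqrt ?v * y)\<^sup>2 \<partial>lborel) = ?v"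
    by (simp_all add: has_bochner_integral_iff)
  have 1: "(\<integral>\<omega>. indicator (space Q) \<omega> * (I g s t \<omega>)\<^sup>2 \<partial>Q) = (\<integral>\<omega>. (I g s t \<omega>)\<^sup>2 \<partial>Q)"
    by (rule Bochner_Integration.integral_cong) auto
  have 2: "integrable Q (\<lambda>\<omega>. indicator (space Q) \<omega> * (I g s t \<omega>)\<^sup>2) \<longleftrightarrow> integrable Q (\<lambda>\<omega>. (I g s t \<omega>)\<^sup>2)"
    by (rule Bochner_Integration.integrable_cong) auto
  have i: "integrable Q (\<lambda>\<omega>. (I g s t \<omega>)\<^sup>2)" and m: "(\<integral>\<omega>. (I g s t \<omega>)\<^sup>2 \<partial>Q) = ?v"
    using wiener_integral_law[OF st g space_in_\<F> sq] n 1 2 by (auto simp: prob_space)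
  show ?thesis
    using independent_of_integral[OF wiener_integral_independent[OF st g] \<F>_subalgebra wiener_integral_measurable_Q[OF st] Z(1) sq Z(2) i] m
    by (simp add: has_bochner_integral_iff)
qed

text \<open>
  On this interval the simple integrand has the constant value \<open>\<xi>\<close>, and \<open>D\<close> stands for what has
  accumulated before. In the expanded square the mixed terms with \<open>D\<close> have mean zero. The product of
  \<open>W t - W s\<close> and the integral of \<open>f\<close> is expressed by polarisation through the squares of the
  integrals of \<open>1 + f\<close> and \<open>1 - f\<close>, which are independent of \<open>\<xi>\<close>.
\<close>

lemma ito_isometry_step:
  fixes D \<xi> :: "'w \<Rightarrow> real"
  assumes st: "0 \<le> s" "s \<le> t" and f: "C1_deriv_on {s..t} f f'"
    and D: "D \<in> borel_measurable (\<F> s)" "integrable Q (\<lambda>\<omega>. (D \<omega>)\<^sup>2)"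
    and \<xi>: "\<xi> \<in> borel_measurable (\<F> s)" "bounded (\<xi> ` space Q)"
  shows "has_bochner_integral Q (\<lambda>\<omega>. (D \<omega> + \<xi> \<omega> * (W t \<omega> - W s \<omega>) - I f s t \<omega>)\<^sup>2)
    ((\<integral>\<omega>. (D \<omega>)\<^sup>2 \<partial>Q) + (\<integral>\<omega>. integral {s..t} (\<lambda>u. (\<xi> \<omega> - f u)\<^sup>2) \<partial>Q))"
    and "integrable Q (\<lambda>\<omega>. integral {s..t} (\<lambda>u. (\<xi> \<omega> - f u)\<^sup>2))"
proof -
  obtain K where K: "\<And>\<omega>. \<omega> \<in> space Q \<Longrightarrow> \<bar>\<xi> \<omega>\<bar> \<le> K" using \<xi>(2) unfolding bounded_iff by auto
  have DQ[measurable]: "D \<in> borel_measurable Q" "\<xi> \<in> borel_measurable Q"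
    using \<F>_measurable_Q D \<xi> by auto
  have iD: "integrable Q D" using square_integrable_imp_integrable[OF DQ(1) D(2)] .
  have i\<xi>: "integrable Q \<xi>" by (rule integrable_const_bound[of _ K]) (use K in auto)
  have i\<xi>2: "integrable Q (\<lambda>\<omega>. (\<xi> \<omega>)\<^sup>2)"
  proof (rule integrable_const_bound[of _ "K\<^sup>2"])
    show "AE \<omega> in Q. norm ((\<xi> \<omega>)\<^sup>2) \<le> K\<^sup>2"
      using power_mono[OF K abs_ge_zero, of _ 2] by (intro AE_I2) simp
  qed simp
  have iD\<xi>: "integrable Q (\<lambda>\<omega>. D \<omega> * \<xi> \<omega>)"
  proof (rule Bochner_Integration.integrable_bound[of Q "\<lambda>\<omega>. K * D \<omega>"])
    show "AE \<omega> in Q. norm (D \<omega> * \<xi> \<omega>) \<le> norm (K * D \<omega>)"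
    proof (rule AE_I2)
      fix \<omega> assume "\<omega> \<in> space Q"
      then have "\<bar>D \<omega>\<bar> * \<bar>\<xi> \<omega>\<bar> \<le> \<bar>D \<omega>\<bar> * \<bar>K\<bar>"
        using K[of \<omega>] by (intro mult_left_mono) auto
      then show "norm (D \<omega> * \<xi> \<omega>) \<le> norm (K * D \<omega>)" by (simp add: abs_mult mult.commute)
    qed
  qed (use iD in auto)
  have one: "C1_deriv_on {s..t} (\<lambda>_. 1) (\<lambda>_. 0)" by (rule C1_deriv_on_const)
  have fc: "continuous_on {s..t} f" by (rule C1_deriv_on_continuous[OF f])
  have int: "f integrable_on {s..t}" "(\<lambda>u. f u * f u) integrable_on {s..t}" "(\<lambda>u. c) integrable_on {s..t}" for c :: real
    using fc by (auto intro!: integrable_continuous_real continuous_intros)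
  \<comment> \<open>The trivial factors match the form in which linearity of the integral is stated.\<close>
  let ?p = "\<lambda>u. 1 * 1 + 1 * f u" and ?m = "\<lambda>u. 1 * 1 + (-1) * f u"
  have pm: "C1_deriv_on {s..t} ?p (\<lambda>u. 1 * 0 + 1 * f' u)" "C1_deriv_on {s..t} ?m (\<lambda>u. 1 * 0 + (-1) * f' u)"
    by (intro C1_deriv_on_add C1_deriv_on_cmult one f)+
  have h1: "has_bochner_integral Q (\<lambda>\<omega>. (D \<omega>)\<^sup>2) (\<integral>\<omega>. (D \<omega>)\<^sup>2 \<partial>Q)" using D(2) by (simp add: has_bochner_integral_iff)
  have h2: "has_bochner_integral Q (\<lambda>\<omega>. (D \<omega> * \<xi> \<omega>) * I (\<lambda>_. 1) s t \<omega>) 0"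
    by (rule wiener_integral_mean[OF st one _ iD\<xi>]) (use D(1) \<xi>(1) in simp)
  have h3: "has_bochner_integral Q (\<lambda>\<omega>. D \<omega> * I f s t \<omega>) 0"
    by (rule wiener_integral_mean[OF st f D(1) iD])
  have h4: "has_bochner_integral Q (\<lambda>\<omega>. (\<xi> \<omega>)\<^sup>2 * (I (\<lambda>_. 1) s t \<omega>)\<^sup>2) ((\<integral>\<omega>. (\<xi> \<omega>)\<^sup>2 \<partial>Q) * (t - s))"
    using wiener_integral_square[OF st one _ i\<xi>2] \<xi>(1) st by simp
  have h5: "has_bochner_integral Q (\<lambda>\<omega>. \<xi> \<omega> * (I ?p s t \<omega>)\<^sup>2) ((\<integral>\<omega>. \<xi> \<omega> \<partial>Q) * integral {s..t} (\<lambda>u. ?p u * ?p u))"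
    by (rule wiener_integral_square[OF st pm(1) \<xi>(1) i\<xi>])
  have h6: "has_bochner_integral Q (\<lambda>\<omega>. \<xi> \<omega> * (I ?m s t \<omega>)\<^sup>2) ((\<integral>\<omega>. \<xi> \<omega> \<partial>Q) * integral {s..t} (\<lambda>u. ?m u * ?m u))"
    by (rule wiener_integral_square[OF st pm(2) \<xi>(1) i\<xi>])
  have h7: "has_bochner_integral Q (\<lambda>\<omega>. 1 * (I f s t \<omega>)\<^sup>2) ((\<integral>\<omega>. 1 \<partial>Q) * integral {s..t} (\<lambda>u. f u * f u))"
    by (rule wiener_integral_square[OF st f]) auto
  note H = has_bochner_integral_add[OF has_bochner_integral_diff[OF
      has_bochner_integral_add[OF has_bochner_integral_diff[OF has_bochner_integral_add[OF h1 has_bochner_integral_cmult[OF h2, of 2]]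
        has_bochner_integral_cmult[OF h3, of 2]] h4]
      has_bochner_integral_cmult[OF has_bochner_integral_diff[OF h5 h6], of "1/2"]] h7]
  have sq: "integral {s..t} (\<lambda>u. (c - f u)\<^sup>2) = c\<^sup>2 * (t - s) - 2 * c * integral {s..t} f + integral {s..t} (\<lambda>u. f u * f u)" for c
  proof -
    have "((\<lambda>u. c\<^sup>2 - (2 * c) * f u + f u * f u) has_integral (t - s) * c\<^sup>2 - (2 * c) * integral {s..t} f + integral {s..t} (\<lambda>u. f u * f u)) {s..t}"
      using st(2) int by (intro has_integral_add has_integral_diff has_integral_mult_right integrable_integral)
        (use has_integral_const_real[of "c\<^sup>2" s t] in auto)
    then show ?thesis by (simp add: power2_diff power2_eq_square algebra_simps integral_unique)
  qed
  have pp: "integral {s..t} (\<lambda>u. ?p u * ?p u) - integral {s..t} (\<lambda>u. ?m u * ?m u) = 4 * integral {s..t} f"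
  proof -
    have "integral {s..t} (\<lambda>u. ?p u * ?p u) = integral {s..t} (\<lambda>u. (-1 - f u)\<^sup>2)"
      by (rule Henstock_Kurzweil_Integration.integral_cong) (simp add: power2_eq_square algebra_simps)
    moreover have "integral {s..t} (\<lambda>u. ?m u * ?m u) = integral {s..t} (\<lambda>u. (1 - f u)\<^sup>2)"
      by (rule Henstock_Kurzweil_Integration.integral_cong) (simp add: power2_eq_square algebra_simps)
    ultimately show ?thesis by (simp add: sq)
  qed
  show i: "integrable Q (\<lambda>\<omega>. integral {s..t} (\<lambda>u. (\<xi> \<omega> - f u)\<^sup>2))"
    unfolding sq using i\<xi> i\<xi>2 by auto
  have val: "(\<integral>\<omega>. integral {s..t} (\<lambda>u. (\<xi> \<omega> - f u)\<^sup>2) \<partial>Q) =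
     (\<integral>\<omega>. (\<xi> \<omega>)\<^sup>2 \<partial>Q) * (t - s) - 2 * (\<integral>\<omega>. \<xi> \<omega> \<partial>Q) * integral {s..t} f + integral {s..t} (\<lambda>u. f u * f u)"
    unfolding sq using i\<xi> i\<xi>2 by (simp add: prob_space)
  have [measurable]: "I k s t \<in> borel_measurable Q" for k by (rule wiener_integral_measurable_Q[OF st])
  have [measurable]: "W s \<in> borel_measurable Q" "W t \<in> borel_measurable Q" using W_measurable st by auto
  have "AE \<omega> in Q. (D \<omega>)\<^sup>2 + 2 * ((D \<omega> * \<xi> \<omega>) * I (\<lambda>_. 1) s t \<omega>) - 2 * (D \<omega> * I f s t \<omega>) + (\<xi> \<omega>)\<^sup>2 * (I (\<lambda>_. 1) s t \<omega>)\<^sup>2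
     - 1 / 2 * (\<xi> \<omega> * (I ?p s t \<omega>)\<^sup>2 - \<xi> \<omega> * (I ?m s t \<omega>)\<^sup>2) + 1 * (I f s t \<omega>)\<^sup>2
     = (D \<omega> + \<xi> \<omega> * (W t \<omega> - W s \<omega>) - I f s t \<omega>)\<^sup>2"
    using AE_wiener_integral[OF st one] AE_wiener_integral_linear[OF st one f, of 1 1] AE_wiener_integral_linear[OF st one f, of 1 "-1"]
  proof eventually_elim
    case (elim \<omega>)
    have "I (\<lambda>_. 1) s t \<omega> = W t \<omega> - W s \<omega>" using elim(1) by simp
    then show ?case
      unfolding elim(2,3) by (simp only:) (simp add: power2_eq_square algebra_simps)
  qed
  then have "has_bochner_integral Q (\<lambda>\<omega>. (D \<omega> + \<xi> \<omega> * (W t \<omega> - W s \<omega>) - I f s t \<omega>)\<^sup>2)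
     ((\<integral>\<omega>. (D \<omega>)\<^sup>2 \<partial>Q) + 2 * 0 - 2 * 0 + (\<integral>\<omega>. (\<xi> \<omega>)\<^sup>2 \<partial>Q) * (t - s)
     - 1 / 2 * ((\<integral>\<omega>. \<xi> \<omega> \<partial>Q) * integral {s..t} (\<lambda>u. ?p u * ?p u) - (\<integral>\<omega>. \<xi> \<omega> \<partial>Q) * integral {s..t} (\<lambda>u. ?m u * ?m u))
     + (\<integral>\<omega>. 1 \<partial>Q) * integral {s..t} (\<lambda>u. f u * f u))"
    using H by (subst (asm) has_bochner_integral_cong_AE) simp_all
  also have "((\<integral>\<omega>. (D \<omega>)\<^sup>2 \<partial>Q) + 2 * 0 - 2 * 0 + (\<integral>\<omega>. (\<xi> \<omega>)\<^sup>2 \<partial>Q) * (t - s)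
     - 1 / 2 * ((\<integral>\<omega>. \<xi> \<omega> \<partial>Q) * integral {s..t} (\<lambda>u. ?p u * ?p u) - (\<integral>\<omega>. \<xi> \<omega> \<partial>Q) * integral {s..t} (\<lambda>u. ?m u * ?m u))
     + (\<integral>\<omega>. 1 \<partial>Q) * integral {s..t} (\<lambda>u. f u * f u)) = (\<integral>\<omega>. (D \<omega>)\<^sup>2 \<partial>Q) + (\<integral>\<omega>. integral {s..t} (\<lambda>u. (\<xi> \<omega> - f u)\<^sup>2) \<partial>Q)"
    unfolding val right_diff_distrib[symmetric] pp by (simp add: prob_space)
  finally show "has_bochner_integral Q (\<lambda>\<omega>. (D \<omega> + \<xi> \<omega> * (W t \<omega> - W s \<omega>) - I f s t \<omega>)\<^sup>2)
    ((\<integral>\<omega>. (D \<omega>)\<^sup>2 \<partial>Q) + (\<integral>\<omega>. integral {s..t} (\<lambda>u. (\<xi> \<omega> - f u)\<^sup>2) \<partial>Q))" .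
qed

end

section \<open>Ito integrals of deterministic functions\<close>

lemma nn_integral_interval_square:
  fixes f :: "real \<Rightarrow> real"
  assumes ab: "a \<le> b" and f: "continuous_on {a..b} f"
  shows "(\<integral>\<^sup>+s. ennreal ((c - f s)\<^sup>2) * indicator {a<..b} s \<partial>lborel) = ennreal (integral {a..b} (\<lambda>s. (c - f s)\<^sup>2))"
proof -
  have "set_integrable lborel {a..b} (\<lambda>s. (c - f s)\<^sup>2)"
    by (rule borel_integrable_atLeastAtMost') (intro continuous_intros f)
  then have i: "integrable lborel (\<lambda>s. indicator {a..b} s *\<^sub>R (c - f s)\<^sup>2)"
    and v: "(\<integral>s. indicator {a..b} s *\<^sub>R (c - f s)\<^sup>2 \<partial>lborel) = integral {a..b} (\<lambda>s. (c - f s)\<^sup>2)"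
    using set_borel_integral_eq_integral[of "{a..b}" "\<lambda>s. (c - f s)\<^sup>2"]
    by (simp_all add: set_integrable_def set_lebesgue_integral_def)
  have "(\<integral>\<^sup>+s. ennreal ((c - f s)\<^sup>2) * indicator {a<..b} s \<partial>lborel) = (\<integral>\<^sup>+s. ennreal (indicator {a..b} s *\<^sub>R (c - f s)\<^sup>2) \<partial>lborel)"
  proof (rule nn_integral_cong_AE, use AE_lborel_singleton[of a] in eventually_elim)
    fix s assume "s \<noteq> a"
    then show "ennreal ((c - f s)\<^sup>2) * indicator {a<..b} s = ennreal (indicator {a..b} s *\<^sub>R (c - f s)\<^sup>2)"
      by (auto simp: indicator_def)
  qed
  also have "\<dots> = ennreal (integral {a..b} (\<lambda>s. (c - f s)\<^sup>2))"
    unfolding v[symmetric] by (rule nn_integral_eq_integral[OF i]) simp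
  finally show ?thesis .
qed

lemma simple_process_on_step:
  assumes \<tau>: "\<And>i. i < n \<Longrightarrow> \<tau> i \<le> \<tau> (Suc i)" and m: "m < n" and s: "\<tau> m < s" "s \<le> \<tau> (Suc m)"
  shows "simple_process n \<tau> \<xi> s \<omega> = \<xi> m \<omega>"
proof -
  have mono: "\<tau> i \<le> \<tau> j" if "i \<le> j" "j \<le> n" for i j
    using that
  proof (induction rule: dec_induct)
    case (step k)
    then show ?case using \<tau>[of k] by simp
  qed simp
  have "\<xi> i \<omega> * indicator {\<tau> i<..\<tau> (Suc i)} s = (if i = m then \<xi> m \<omega> else 0)" if "i < n" for i
  proof (cases i m rule: linorder_cases)
    case less
    then have "\<tau> (Suc i) \<le> \<tau> m" using mono[of "Suc i" m] m by simp
    then show ?thesis using less s by simp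
  next
    case equal
    then show ?thesis using s by simp
  next
    case greater
    then have "\<tau> (Suc m) \<le> \<tau> i" using mono[of "Suc m" i] that by simp
    then show ?thesis using greater s by simp
  qed
  then have "simple_process n \<tau> \<xi> s \<omega> = (\<Sum>i<n. if i = m then \<xi> m \<omega> else 0)"
    unfolding simple_process_def by (intro sum.cong) auto
  then show ?thesis using m by simp
qed

lemma simple_process_outside:
  assumes \<tau>: "\<And>i. i < n \<Longrightarrow> \<tau> i \<le> \<tau> (Suc i)" and s: "s \<le> \<tau> 0 \<or> \<tau> n < s"
  shows "simple_process n \<tau> \<xi> s \<omega> = 0"
proof -
  have mono: "\<tau> i \<le> \<tau> j" if "i \<le> j" "j \<le> n" for i j
    using that
  proof (induction rule: dec_induct)
    case (step k)
    then show ?case using \<tau>[of k] by simp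
  qed simp
  have "indicator {\<tau> i<..\<tau> (Suc i)} s = (0::real)" if "i < n" for i
    using mono[of 0 i] mono[of "Suc i" n] that s by (auto simp: indicator_def)
  then show ?thesis unfolding simple_process_def by simp
qed

context brownian
begin

definition L2_distance :: "(real \<Rightarrow> 'w \<Rightarrow> real) \<Rightarrow> (real \<Rightarrow> real) \<Rightarrow> real \<Rightarrow> ennreal" where
  "L2_distance H f c = (\<integral>\<^sup>+\<omega>. (\<integral>\<^sup>+s\<in>{0..c}. ennreal ((H s \<omega> - f s)\<^sup>2) \<partial>lborel) \<partial>Q)"

text \<open>
  The induction step over the partition of a simple integrand. Both sides of the isometry add up:
  the squared norms by \<open>ito_isometry_step\<close>, since the new term is orthogonal to the past, and the
  distances because the time interval is split into disjoint parts.
\<close>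

lemma ito_isometry_extend:
  assumes ab: "0 \<le> a" "a \<le> b" and f: "C1_deriv_on {a..b} f f'" and fm[measurable]: "f \<in> borel_measurable borel"
    and H[measurable]: "(\<lambda>(\<omega>, s). H s \<omega>) \<in> borel_measurable (Q \<Otimes>\<^sub>M lborel)"
    and \<xi>: "\<xi> \<in> borel_measurable (\<F> a)" "bounded (\<xi> ` space Q)"
    and step: "\<And>s \<omega>. a < s \<Longrightarrow> s \<le> b \<Longrightarrow> H s \<omega> = \<xi> \<omega>"
    and X: "X \<in> borel_measurable (\<F> a)" "integrable Q (\<lambda>\<omega>. (X \<omega>)\<^sup>2)"
      "ennreal (\<integral>\<omega>. (X \<omega>)\<^sup>2 \<partial>Q) = L2_distance H f a"
  defines "X' \<equiv> \<lambda>\<omega>. X \<omega> + \<xi> \<omega> * (W b \<omega> - W a \<omega>) - I f a b \<omega>"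
  shows "X' \<in> borel_measurable (\<F> b)" "integrable Q (\<lambda>\<omega>. (X' \<omega>)\<^sup>2)"
    "ennreal (\<integral>\<omega>. (X' \<omega>)\<^sup>2 \<partial>Q) = L2_distance H f b"
proof -
  have [measurable]: "X \<in> borel_measurable (\<F> b)" "\<xi> \<in> borel_measurable (\<F> b)"
    using \<F>_measurable_mono X(1) \<xi>(1) ab by auto
  have [measurable]: "W a \<in> borel_measurable (\<F> b)" "W b \<in> borel_measurable (\<F> b)" "I f a b \<in> borel_measurable (\<F> b)"
    using W_adapted wiener_integral_measurable ab by auto
  show "X' \<in> borel_measurable (\<F> b)" unfolding X'_def by measurable
  note s = ito_isometry_step[OF ab f X(1,2) \<xi>]
  show "integrable Q (\<lambda>\<omega>. (X' \<omega>)\<^sup>2)" using s(1) unfolding X'_def by (simp add: has_bochner_integral_iff)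
  have nonneg: "0 \<le> integral {a..b} (\<lambda>u. (\<xi> \<omega> - f u)\<^sup>2)" for \<omega>
    by (rule Henstock_Kurzweil_Integration.integral_nonneg)
      (use C1_deriv_on_continuous[OF f] in \<open>auto intro!: integrable_continuous_real continuous_intros\<close>)
  have "L2_distance H f b = (\<integral>\<^sup>+\<omega>. (\<integral>\<^sup>+s. ennreal ((H s \<omega> - f s)\<^sup>2) * indicator {0..a} s + ennreal ((H s \<omega> - f s)\<^sup>2) * indicator {a<..b} s \<partial>lborel) \<partial>Q)"
    unfolding L2_distance_def using ab by (intro nn_integral_cong) (auto simp: indicator_def)
  also have "\<dots> = (\<integral>\<^sup>+\<omega>. (\<integral>\<^sup>+s. ennreal ((H s \<omega> - f s)\<^sup>2) * indicator {0..a} s \<partial>lborel)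
       + (\<integral>\<^sup>+s. ennreal ((H s \<omega> - f s)\<^sup>2) * indicator {a<..b} s \<partial>lborel) \<partial>Q)"
  proof (rule nn_integral_cong)
    fix \<omega> assume "\<omega> \<in> space Q"
    then have [measurable]: "(\<lambda>s. H s \<omega>) \<in> borel_measurable lborel"
      using measurable_compose[OF measurable_Pair1' H, of \<omega>] by simp
    show "(\<integral>\<^sup>+s. ennreal ((H s \<omega> - f s)\<^sup>2) * indicator {0..a} s + ennreal ((H s \<omega> - f s)\<^sup>2) * indicator {a<..b} s \<partial>lborel)
       = (\<integral>\<^sup>+s. ennreal ((H s \<omega> - f s)\<^sup>2) * indicator {0..a} s \<partial>lborel)
       + (\<integral>\<^sup>+s. ennreal ((H s \<omega> - f s)\<^sup>2) * indicator {a<..b} s \<partial>lborel)"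
      by (rule nn_integral_add) measurable
  qed
  also have "\<dots> = L2_distance H f a + (\<integral>\<^sup>+\<omega>. (\<integral>\<^sup>+s. ennreal ((H s \<omega> - f s)\<^sup>2) * indicator {a<..b} s \<partial>lborel) \<partial>Q)"
    unfolding L2_distance_def by (rule nn_integral_add) measurable
  also have "(\<integral>\<^sup>+\<omega>. (\<integral>\<^sup>+s. ennreal ((H s \<omega> - f s)\<^sup>2) * indicator {a<..b} s \<partial>lborel) \<partial>Q)
      = (\<integral>\<^sup>+\<omega>. ennreal (integral {a..b} (\<lambda>u. (\<xi> \<omega> - f u)\<^sup>2)) \<partial>Q)"
  proof (rule nn_integral_cong)
    fix \<omega>
    have "(\<integral>\<^sup>+s. ennreal ((H s \<omega> - f s)\<^sup>2) * indicator {a<..b} s \<partial>lborel) = (\<integral>\<^sup>+s. ennreal ((\<xi> \<omega> - f s)\<^sup>2) * indicator {a<..b} s \<partial>lborel)"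
      by (rule nn_integral_cong) (auto simp: indicator_def step)
    also have "\<dots> = ennreal (integral {a..b} (\<lambda>u. (\<xi> \<omega> - f u)\<^sup>2))"
      by (rule nn_integral_interval_square[OF ab(2) C1_deriv_on_continuous[OF f]])
    finally show "(\<integral>\<^sup>+s. ennreal ((H s \<omega> - f s)\<^sup>2) * indicator {a<..b} s \<partial>lborel) = ennreal (integral {a..b} (\<lambda>u. (\<xi> \<omega> - f u)\<^sup>2))" .
  qed
  also have "\<dots> = ennreal (\<integral>\<omega>. integral {a..b} (\<lambda>u. (\<xi> \<omega> - f u)\<^sup>2) \<partial>Q)"
    by (rule nn_integral_eq_integral[OF s(2)]) (use nonneg in simp)
  also have "L2_distance H f a = ennreal (\<integral>\<omega>. (X \<omega>)\<^sup>2 \<partial>Q)" using X(3) by simp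
  also have "ennreal (\<integral>\<omega>. (X \<omega>)\<^sup>2 \<partial>Q) + ennreal (\<integral>\<omega>. integral {a..b} (\<lambda>u. (\<xi> \<omega> - f u)\<^sup>2) \<partial>Q)
     = ennreal ((\<integral>\<omega>. (X \<omega>)\<^sup>2 \<partial>Q) + (\<integral>\<omega>. integral {a..b} (\<lambda>u. (\<xi> \<omega> - f u)\<^sup>2) \<partial>Q))"
    by (rule ennreal_plus[symmetric]) (auto intro!: Bochner_Integration.integral_nonneg nonneg)
  also have "\<dots> = ennreal (\<integral>\<omega>. (X' \<omega>)\<^sup>2 \<partial>Q)"
    using s(1) unfolding X'_def by (simp add: has_bochner_integral_iff)
  finally show "ennreal (\<integral>\<omega>. (X' \<omega>)\<^sup>2 \<partial>Q) = L2_distance H f b" by simp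
qed

text \<open>
  The partition points are cut off at \<open>t\<close>. Before the first and after the last of them the simple
  process is \<open>0\<close>, so that the steps over \<open>[0, \<tau> 0]\<close> and \<open>[\<tau> n, t]\<close> have the same form as the others.
\<close>

lemma ito_isometry_simple:
  assumes si: "simple_integrand Q \<F> n \<tau> \<xi>" and t: "0 \<le> t"
    and f: "C1_deriv_on {0..t} f f'" and fm: "f \<in> borel_measurable borel"
  shows "(\<integral>\<^sup>+\<omega>. ennreal ((simple_integral W n \<tau> \<xi> t \<omega> - I f 0 t \<omega>)\<^sup>2) \<partial>Q)
    = L2_distance (simple_process n \<tau> \<xi>) f t"
proof -
  let ?H = "simple_process n \<tau> \<xi>"
  define c where "c m = min t (\<tau> m)" for m
  have \<tau>: "\<tau> i \<le> \<tau> (Suc i)" if "i < n" for i using si that by (simp add: simple_integrand_def)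
  have \<tau>0: "0 \<le> \<tau> i" if "i \<le> n" for i
    using that by (induction i) (use si \<tau> in \<open>auto simp: simple_integrand_def intro: order_trans\<close>)
  have c: "0 \<le> c i" "c i \<le> t" if "i \<le> n" for i using \<tau>0[OF that] t by (auto simp: c_def)
  have cm: "c i \<le> c (Suc i)" if "i < n" for i using \<tau>[OF that] by (auto simp: c_def)
  have \<xi>m: "\<xi> i \<in> borel_measurable (\<F> (\<tau> i))" "bounded (\<xi> i ` space Q)" if "i < n" for i
    using si that by (auto simp: simple_integrand_def)
  have \<xi>Q: "\<xi> i \<in> borel_measurable Q" if "i < n" for i using \<F>_measurable_Q \<xi>m(1)[OF that] .
  have Hm: "(\<lambda>(\<omega>, s). ?H s \<omega>) \<in> borel_measurable (Q \<Otimes>\<^sub>M lborel)"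
    unfolding simple_process_def case_prod_beta
  proof (intro borel_measurable_sum borel_measurable_times)
    fix i assume "i \<in> {..<n}"
    then show "(\<lambda>x. \<xi> i (fst x)) \<in> borel_measurable (Q \<Otimes>\<^sub>M lborel)"
      by (intro measurable_compose[OF measurable_fst \<xi>Q]) simp
  qed measurable
  define X where "X m \<omega> = (\<Sum>i<m. \<xi> i \<omega> * (W (c (Suc i)) \<omega> - W (c i) \<omega>) - I f (c i) (c (Suc i)) \<omega>) - I f 0 (c 0) \<omega>" for m \<omega>
  have zero: "(\<lambda>_. 0 :: real) \<in> borel_measurable (\<F> u)" "bounded ((\<lambda>_. 0 :: real) ` space Q)" for u by (auto simp: bounded_iff)
  have N0: "L2_distance ?H f 0 = 0"
  proof -
    have "(\<integral>\<^sup>+s\<in>{0..0}. ennreal ((?H s \<omega> - f s)\<^sup>2) \<partial>lborel) = 0" for \<omega>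
    proof -
      have "(\<integral>\<^sup>+s\<in>{0..0}. ennreal ((?H s \<omega> - f s)\<^sup>2) \<partial>lborel) = (\<integral>\<^sup>+(s::real). 0 \<partial>lborel)"
      proof (rule nn_integral_cong_AE)
        show "AE s in lborel. ennreal ((?H s \<omega> - f s)\<^sup>2) * indicator {0..0} s = 0"
          using AE_lborel_singleton[of "0::real"] by eventually_elim (auto simp: indicator_def)
      qed
      then show ?thesis by simp
    qed
    then show ?thesis by (simp add: L2_distance_def)
  qed
  have main: "X m \<in> borel_measurable (\<F> (c m)) \<and> integrable Q (\<lambda>\<omega>. (X m \<omega>)\<^sup>2) \<and>
      ennreal (\<integral>\<omega>. (X m \<omega>)\<^sup>2 \<partial>Q) = L2_distance ?H f (c m)" if "m \<le> n" for m
    using that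
  proof (induction m)
    case 0
    have c0: "0 \<le> c 0" "c 0 \<le> t" using c[of 0] by auto
    have H0: "?H s \<omega> = 0" if "s \<le> c 0" for s \<omega>
      using simple_process_outside[of n \<tau> s \<xi> \<omega>] \<tau> that by (auto simp: c_def)
    have X0: "X 0 = (\<lambda>\<omega>. 0 + 0 * (W (c 0) \<omega> - W 0 \<omega>) - I f 0 (c 0) \<omega>)" by (simp add: X_def fun_eq_iff)
    have f0: "C1_deriv_on {0..c 0} f f'" by (rule C1_deriv_on_subset[OF f]) (use c0 in auto)
    show ?case
      unfolding X0
      using ito_isometry_extend[OF order_refl c0(1) f0 fm Hm zero(1,2) _ zero(1)] H0 N0 by simp
  next
    case (Suc m)
    then have m: "m < n" and IH: "X m \<in> borel_measurable (\<F> (c m))" "integrable Q (\<lambda>\<omega>. (X m \<omega>)\<^sup>2)"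
      "ennreal (\<integral>\<omega>. (X m \<omega>)\<^sup>2 \<partial>Q) = L2_distance ?H f (c m)" by auto
    have cs: "0 \<le> c m" "c m \<le> c (Suc m)" "c (Suc m) \<le> t" using c[of m] c[of "Suc m"] cm[of m] m by auto
    have fs: "C1_deriv_on {c m..c (Suc m)} f f'" by (rule C1_deriv_on_subset[OF f]) (use cs in auto)
    \<comment> \<open>If \<open>\<tau> m \<ge> t\<close>, then \<open>\<xi> m\<close> need not be known at time \<open>t\<close>, but its increment is cut off to zero.\<close>
    show ?case
    proof (cases "\<tau> m < t")
      case True
      then have \<xi>c: "\<xi> m \<in> borel_measurable (\<F> (c m))" using \<xi>m(1)[OF m] by (simp add: c_def min_absorb2)
      have Hs: "?H s \<omega> = \<xi> m \<omega>" if "c m < s" "s \<le> c (Suc m)" for s \<omega>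
        by (rule simple_process_on_step[where n = n and \<tau> = \<tau>, OF \<tau> m]) (use that True in \<open>auto simp: c_def\<close>)
      have XS: "X (Suc m) = (\<lambda>\<omega>. X m \<omega> + \<xi> m \<omega> * (W (c (Suc m)) \<omega> - W (c m) \<omega>) - I f (c m) (c (Suc m)) \<omega>)"
        by (simp add: X_def fun_eq_iff)
      show ?thesis
        unfolding XS using ito_isometry_extend[OF cs(1,2) fs fm Hm \<xi>c \<xi>m(2)[OF m] Hs IH] by blast
    next
      case False
      then have eq: "c m = t" "c (Suc m) = t" using \<tau>[OF m] by (auto simp: c_def)
      have "X (Suc m) = X m" by (simp add: X_def fun_eq_iff eq)
      then show ?thesis using IH by (simp add: eq)
    qed
  qed
  have cn: "0 \<le> c n" "c n \<le> t" using c by auto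
  have fn: "C1_deriv_on {c n..t} f f'" by (rule C1_deriv_on_subset[OF f]) (use cn in auto)
  have Hn: "?H s \<omega> = 0" if "c n < s" "s \<le> t" for s \<omega>
    by (rule simple_process_outside[where n = n and \<tau> = \<tau>, OF \<tau>]) (use that in \<open>auto simp: c_def\<close>)
  let ?Y = "\<lambda>\<omega>. X n \<omega> + 0 * (W t \<omega> - W (c n) \<omega>) - I f (c n) t \<omega>"
  have Y: "integrable Q (\<lambda>\<omega>. (?Y \<omega>)\<^sup>2)" "ennreal (\<integral>\<omega>. (?Y \<omega>)\<^sup>2 \<partial>Q) = L2_distance ?H f t"
    using ito_isometry_extend[OF cn fn fm Hm zero(1,2) Hn, of "X n"] main[of n] by auto
  have comb: "AE \<omega> in Q. I f 0 (c m) \<omega> = I f 0 (c 0) \<omega> + (\<Sum>i<m. I f (c i) (c (Suc i)) \<omega>)" if "m \<le> n" for m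
    using that
  proof (induction m)
    case (Suc m)
    have "AE \<omega> in Q. I f 0 (c (Suc m)) \<omega> = I f 0 (c m) \<omega> + I f (c m) (c (Suc m)) \<omega>"
      by (rule AE_wiener_integral_combine[OF order_refl c(1) cm C1_deriv_on_subset[OF f]]) (use c[of "Suc m"] Suc.prems in auto)
    moreover have "AE \<omega> in Q. I f 0 (c m) \<omega> = I f 0 (c 0) \<omega> + (\<Sum>i<m. I f (c i) (c (Suc i)) \<omega>)"
      using Suc by simp
    ultimately show ?case by eventually_elim simp
  qed simp
  have "AE \<omega> in Q. simple_integral W n \<tau> \<xi> t \<omega> - I f 0 t \<omega> = ?Y \<omega>"
    using comb[OF order_refl] AE_wiener_integral_combine[OF order_refl cn f]
    by eventually_elim (simp add: X_def simple_integral_def c_def sum_subtractf)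
  then have "(\<integral>\<^sup>+\<omega>. ennreal ((simple_integral W n \<tau> \<xi> t \<omega> - I f 0 t \<omega>)\<^sup>2) \<partial>Q) = (\<integral>\<^sup>+\<omega>. ennreal ((?Y \<omega>)\<^sup>2) \<partial>Q)"
    by (intro nn_integral_cong_AE) auto
  also have "\<dots> = ennreal (\<integral>\<omega>. (?Y \<omega>)\<^sup>2 \<partial>Q)"
    by (rule nn_integral_eq_integral[OF Y(1)]) simp
  finally show ?thesis using Y(2) by simp
qed

text \<open>
  By the isometry both \<open>J\<close> and the pathwise integral are \<open>L\<^sup>2\<close> limits of the same sequence of
  simple integrals.
\<close>

lemma ito_integral_eq_wiener_integral:
  assumes J: "is_ito_integral Q \<F> W (\<lambda>s \<omega>. f s) t J" and t: "0 \<le> t"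
    and f: "C1_deriv_on {0..t} f f'" and fm: "f \<in> borel_measurable borel"
  shows "AE \<omega> in Q. J \<omega> = I f 0 t \<omega>"
proof -
  obtain n \<tau> \<xi> where si: "\<And>k. simple_integrand Q \<F> (n k) (\<tau> k) (\<xi> k)"
    and lim1: "(\<lambda>k. L2_distance (simple_process (n k) (\<tau> k) (\<xi> k)) f t) \<longlonglongrightarrow> 0"
    and lim2: "(\<lambda>k. \<integral>\<^sup>+\<omega>. ennreal ((simple_integral W (n k) (\<tau> k) (\<xi> k) t \<omega> - J \<omega>)\<^sup>2) \<partial>Q) \<longlonglongrightarrow> 0"
    and Jm[measurable]: "J \<in> borel_measurable Q"
    using J unfolding is_ito_integral_def L2_distance_def by blast
  let ?S = "\<lambda>k. simple_integral W (n k) (\<tau> k) (\<xi> k) t"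
  have [measurable]: "I f 0 t \<in> borel_measurable Q" by (rule wiener_integral_measurable_Q[OF order_refl t])
  have Sm[measurable]: "?S k \<in> borel_measurable Q" for k
  proof -
    have \<tau>: "\<tau> k i \<le> \<tau> k (Suc i)" "\<xi> k i \<in> borel_measurable Q" if "i < n k" for i
      using si[of k] that \<F>_measurable_Q by (auto simp: simple_integrand_def)
    have "0 \<le> \<tau> k i" if "i \<le> n k" for i
      using that by (induction i) (use si[of k] \<tau> in \<open>auto simp: simple_integrand_def intro: order_trans\<close>)
    then have "W (min t (\<tau> k i)) \<in> borel_measurable Q" if "i \<le> n k" for i
      using W_measurable t that by simp
    then show ?thesis unfolding simple_integral_def using \<tau>(2)
      by (intro borel_measurable_sum borel_measurable_times borel_measurable_diff) auto
  qed
  have bound: "(\<integral>\<^sup>+\<omega>. ennreal ((J \<omega> - I f 0 t \<omega>)\<^sup>2) \<partial>Q) \<le>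
     2 * (\<integral>\<^sup>+\<omega>. ennreal ((?S k \<omega> - J \<omega>)\<^sup>2) \<partial>Q) + 2 * L2_distance (simple_process (n k) (\<tau> k) (\<xi> k)) f t" for k
  proof -
    have "(\<integral>\<^sup>+\<omega>. ennreal ((J \<omega> - I f 0 t \<omega>)\<^sup>2) \<partial>Q) \<le>
      (\<integral>\<^sup>+\<omega>. 2 * ennreal ((?S k \<omega> - J \<omega>)\<^sup>2) + 2 * ennreal ((?S k \<omega> - I f 0 t \<omega>)\<^sup>2) \<partial>Q)"
    proof (rule nn_integral_mono)
      fix \<omega>
      have "(J \<omega> - I f 0 t \<omega>)\<^sup>2 \<le> 2 * (?S k \<omega> - J \<omega>)\<^sup>2 + 2 * (?S k \<omega> - I f 0 t \<omega>)\<^sup>2"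
        using zero_le_power2[of "(?S k \<omega> - J \<omega>) + (?S k \<omega> - I f 0 t \<omega>)"]
        by (simp add: power2_eq_square algebra_simps)
      then have "ennreal ((J \<omega> - I f 0 t \<omega>)\<^sup>2) \<le> ennreal (2 * (?S k \<omega> - J \<omega>)\<^sup>2 + 2 * (?S k \<omega> - I f 0 t \<omega>)\<^sup>2)"
        by (rule ennreal_leI)
      also have "\<dots> = 2 * ennreal ((?S k \<omega> - J \<omega>)\<^sup>2) + 2 * ennreal ((?S k \<omega> - I f 0 t \<omega>)\<^sup>2)"
        by (simp add: ennreal_mult)
      finally show "ennreal ((J \<omega> - I f 0 t \<omega>)\<^sup>2) \<le> 2 * ennreal ((?S k \<omega> - J \<omega>)\<^sup>2) + 2 * ennreal ((?S k \<omega> - I f 0 t \<omega>)\<^sup>2)" .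
    qed
    also have "\<dots> = 2 * (\<integral>\<^sup>+\<omega>. ennreal ((?S k \<omega> - J \<omega>)\<^sup>2) \<partial>Q) + 2 * (\<integral>\<^sup>+\<omega>. ennreal ((?S k \<omega> - I f 0 t \<omega>)\<^sup>2) \<partial>Q)"
      by (simp add: nn_integral_add nn_integral_cmult)
    finally show ?thesis unfolding ito_isometry_simple[OF si t f fm] .
  qed
  have "(\<lambda>k. 2 * (\<integral>\<^sup>+\<omega>. ennreal ((?S k \<omega> - J \<omega>)\<^sup>2) \<partial>Q) + 2 * L2_distance (simple_process (n k) (\<tau> k) (\<xi> k)) f t)
      \<longlonglongrightarrow> 2 * 0 + 2 * 0"
    by (intro tendsto_add ennreal_tendsto_cmult lim1 lim2) auto
  then have "(\<integral>\<^sup>+\<omega>. ennreal ((J \<omega> - I f 0 t \<omega>)\<^sup>2) \<partial>Q) \<le> 2 * 0 + 2 * 0"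
    by (rule LIMSEQ_le_const) (use bound in auto)
  then have "(\<integral>\<^sup>+\<omega>. ennreal ((J \<omega> - I f 0 t \<omega>)\<^sup>2) \<partial>Q) = 0" by simp
  then have "AE \<omega> in Q. ennreal ((J \<omega> - I f 0 t \<omega>)\<^sup>2) = 0"
    by (subst (asm) nn_integral_0_iff_AE) auto
  then show ?thesis by (rule AE_mp) (auto simp: ennreal_eq_0_iff intro!: AE_I2)
qed

end

section \<open>The volatility of the integrated short rate\<close>

locale short_rate_parameters =
  fixes p q b \<sigma> a r0 :: real
  assumes q: "0 < q" and p: "- q < p" and b: "0 < b"
begin

definition l_deriv :: "real \<Rightarrow> real" where
  "l_deriv \<tau> = 4 * q\<^sup>2 * p * (p + 2 * q)\<^sup>2 * exp (2 * q * \<tau>) / ((p + 2 * q)\<^sup>2 * exp (2 * q * \<tau>) - p\<^sup>2)\<^sup>2"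

lemma l_denominator: assumes "0 \<le> \<tau>" shows "4 * q * (p + q) \<le> (p + 2 * q)\<^sup>2 * exp (2 * q * \<tau>) - p\<^sup>2"
proof -
  have "(p + 2 * q)\<^sup>2 * 1 \<le> (p + 2 * q)\<^sup>2 * exp (2 * q * \<tau>)"
    using assms q by (intro mult_left_mono) auto
  then show ?thesis by (simp add: power2_eq_square algebra_simps)
qed

lemma l_denominator_pos: "0 \<le> \<tau> \<Longrightarrow> 0 < (p + 2 * q)\<^sup>2 * exp (2 * q * \<tau>) - p\<^sup>2"
  using l_denominator[of \<tau>] mult_pos_pos[of q "p + q"] q p by linarith

lemma l_C1: "C1_deriv_on {0..t} (l_fun p q) l_deriv"
  unfolding C1_deriv_on_def
proof (intro conjI ballI)
  have nz: "(p + 2 * q)\<^sup>2 * exp (2 * q * \<tau>) - p\<^sup>2 \<noteq> 0" if "\<tau> \<in> {0..t}" for \<tau>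
    using l_denominator_pos[of \<tau>] that by simp
  show "continuous_on {0..t} l_deriv"
    unfolding l_deriv_def using nz by (intro continuous_intros) auto
  fix x assume x: "x \<in> {0..t}"
  have "((\<lambda>\<tau>. 1 - 2 * q * p / ((p + 2 * q)\<^sup>2 * exp (2 * q * \<tau>) - p\<^sup>2)) has_real_derivative
      0 - (0 * ((p + 2 * q)\<^sup>2 * exp (2 * q * x) - p\<^sup>2) - 2 * q * p * ((p + 2 * q)\<^sup>2 * (exp (2 * q * x) * (2 * q)))) /
       (((p + 2 * q)\<^sup>2 * exp (2 * q * x) - p\<^sup>2) * ((p + 2 * q)\<^sup>2 * exp (2 * q * x) - p\<^sup>2))) (at x within {0..t})"
    using nz[OF x] by (auto intro!: derivative_eq_intros)
  moreover have "0 - (0 * d - 2 * q * p * (P * (e * (2 * q)))) / (d * d) = 4 * q\<^sup>2 * p * P * e / d\<^sup>2" for d P e :: real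
    by (simp add: power2_eq_square)
  ultimately show "(l_fun p q has_real_derivative l_deriv x) (at x within {0..t})"
    unfolding l_deriv_def l_fun_def[abs_def] by simp
qed

lemma l_measurable: "l_fun p q \<in> borel_measurable borel"
  unfolding l_fun_def[abs_def] by measurable

text \<open>
  Up to the factor \<open>p exp (- (p + q) s)\<close>, this is the integrand of the inner integral in the noise;
  that factor carries its whole dependence on the upper limit \<open>s\<close>.
\<close>

definition \<Lambda> :: "real \<Rightarrow> real" where "\<Lambda> s = exp ((p + q) * s) * l_fun p q s"
definition \<Lambda>' :: "real \<Rightarrow> real" where "\<Lambda>' s = (p + q) * exp ((p + q) * s) * l_fun p q s + exp ((p + q) * s) * l_deriv s"

lemma \<Lambda>_C1: "C1_deriv_on {0..t} \<Lambda> \<Lambda>'"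
proof -
  have "C1_deriv_on {0..t} (\<lambda>s. exp ((p + q) * s)) (\<lambda>s. (p + q) * exp ((p + q) * s))"
    unfolding C1_deriv_on_def by (auto intro!: continuous_intros derivative_eq_intros)
  from C1_deriv_on_mult[OF this l_C1] show ?thesis unfolding \<Lambda>_def[abs_def] \<Lambda>'_def[abs_def] .
qed

text \<open>
  \<open>\<phi> T s\<close> is the integral of the kernel \<open>exp (- b (T - x))\<close> over \<open>x\<close> in \<open>{s..T}\<close>: the effect on
  the integrated rate over \<open>[0, T]\<close> of a unit shock at time \<open>s\<close>. Likewise \<open>\<psi> T s\<close> collects the effect
  of the memory that such a shock leaves in the drift of the noise.
\<close>

definition \<phi> :: "real \<Rightarrow> real \<Rightarrow> real" where "\<phi> T s = (1 - exp (- b * (T - s))) / b"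
definition \<psi> :: "real \<Rightarrow> real \<Rightarrow> real" where
  "\<psi> T s = integral {s..T} (\<lambda>x. \<phi> T x * (p * exp (- (p + q) * x)))"
text \<open>
  The diffusion coefficient at time \<open>s\<close> of the rate integrated up to \<open>T\<close>.
\<close>

definition vol :: "real \<Rightarrow> real \<Rightarrow> real" where "vol T s = \<sigma> * (\<phi> T s - \<Lambda> s * \<psi> T s)"
definition vol' :: "real \<Rightarrow> real \<Rightarrow> real" where
  "vol' T s = \<sigma> * (- exp (- b * (T - s)) - (\<Lambda>' s * \<psi> T s + \<Lambda> s * (- (\<phi> T s * (p * exp (- (p + q) * s))))))"

lemma \<phi>_C1: "C1_deriv_on A (\<phi> T) (\<lambda>s. - exp (- b * (T - s)))"
  unfolding C1_deriv_on_def \<phi>_def[abs_def] using b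
  by (auto intro!: continuous_intros derivative_eq_intros)

lemma \<phi>_continuous: "continuous_on A (\<phi> T)" by (rule C1_deriv_on_continuous[OF \<phi>_C1])

lemma \<psi>_C1: "C1_deriv_on {0..T} (\<psi> T) (\<lambda>s. - (\<phi> T s * (p * exp (- (p + q) * s))))"
proof -
  have c: "continuous_on {0..T} (\<lambda>x. \<phi> T x * (p * exp (- (p + q) * x)))"
    by (intro continuous_intros \<phi>_continuous)
  then show ?thesis
    unfolding C1_deriv_on_def \<psi>_def[abs_def]
    using integral_has_real_derivative'[OF c] by (auto intro: continuous_on_minus)
qed

lemma vol_C1: "C1_deriv_on {0..T} (vol T) (vol' T)"
  unfolding vol_def[abs_def] vol'_def[abs_def]
  by (intro C1_deriv_on_cmult C1_deriv_on_diff C1_deriv_on_mult \<phi>_C1 \<Lambda>_C1 \<psi>_C1)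

lemma vol_T: "vol T T = 0" by (simp add: vol_def \<phi>_def \<psi>_def)

text \<open>
  Shift of the integration variable by \<open>s\<close>. It explains the function \<open>m\<close>: it is the memory term
  \<open>\<psi>\<close> up to scaling.
\<close>

lemma m_fun_eq:
  assumes "s \<le> T"
  shows "m_fun p q b (T - s) = b * exp ((p + q) * s) * \<psi> T s"
proof -
  let ?f = "\<lambda>x. \<phi> T x * (p * exp (- (p + q) * x))"
  have "m_fun p q b (T - s) = integral {0..T - s} (\<lambda>x. p * exp (- (p + q) * x) * (1 - exp (- b * (T - s - x))))"
    unfolding m_fun_def by (rule LBINT_continuous) (intro continuous_intros)
  also have "\<dots> = integral {0..T - s} (\<lambda>x. b * exp ((p + q) * s) * (?f \<circ> (\<lambda>x. x + s)) x)"
  proof (rule Henstock_Kurzweil_Integration.integral_cong)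
    fix x
    have "exp (- (p + q) * x) = exp ((p + q) * s) * exp (- (p + q) * (x + s))"
      by (simp add: exp_add[symmetric] algebra_simps)
    then show "p * exp (- (p + q) * x) * (1 - exp (- b * (T - s - x))) = b * exp ((p + q) * s) * (?f \<circ> (\<lambda>x. x + s)) x"
      using b by (simp add: \<phi>_def diff_diff_eq add.commute)
  qed
  also have "\<dots> = b * exp ((p + q) * s) * integral {0..T - s} (?f \<circ> (\<lambda>x. x + s))"
    by (rule Henstock_Kurzweil_Integration.integral_mult_right)
  also have "integral {0..T - s} (?f \<circ> (\<lambda>x. x + s)) = integral {0 + s..T - s + s} ?f"
    by (rule integral_shift) (intro continuous_intros \<phi>_continuous)
  finally show ?thesis by (simp add: \<psi>_def)
qed

lemma v_fun_eq_vol_diff: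
  assumes "t \<le> S" "S \<le> T"
  shows "v_fun p q b \<sigma> S T t = vol S t - vol T t"
  using assms b unfolding v_fun_def vol_def \<Lambda>_def
  by (simp add: m_fun_eq \<phi>_def field_simps)

definition drift_integral :: "real \<Rightarrow> real" where
  "drift_integral T = integral {0..T} (\<lambda>s. exp (- b * (T - s)) * (r0 + a * s))"

text \<open>
  Variation of constants: the function \<open>R t = \<integral>\<^sub>0\<^sup>t r\<close> satisfies \<open>R' = r0 + a t - b R + \<sigma> z\<close>.
\<close>

lemma integrated_rate:
  fixes r z :: "real \<Rightarrow> real"
  assumes T: "0 \<le> T" and r: "continuous_on {0..T} r" and z: "continuous_on {0..T} z"
    and eq: "\<And>t. t \<in> {0..T} \<Longrightarrow> r t = r0 + integral {0..t} (\<lambda>s. a - b * r s) + \<sigma> * z t"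
  shows "integral {0..T} r = drift_integral T + integral {0..T} (\<lambda>s. \<sigma> * (exp (- b * (T - s)) * z s))"
proof -
  define R where "R t = integral {0..t} r" for t
  have R: "C1_deriv_on {0..T} R r"
    unfolding C1_deriv_on_def R_def[abs_def] using r integral_has_real_derivative[OF r] by auto
  have e: "C1_deriv_on {0..T} (\<lambda>s. exp (- b * (T - s))) (\<lambda>s. b * exp (- b * (T - s)))"
    unfolding C1_deriv_on_def by (auto intro!: continuous_intros derivative_eq_intros)
  have r_eq: "r t = r0 + a * t - b * R t + \<sigma> * z t" if t: "t \<in> {0..T}" for t
  proof -
    have "r integrable_on {0..t}" using r t by (auto intro!: integrable_continuous_real continuous_on_subset[OF r])
    then have "(\<lambda>s. b * r s) integrable_on {0..t}" by (rule integrable_on_mult_right)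
    then have "integral {0..t} (\<lambda>s. a - b * r s) = a * t - b * R t"
      using t unfolding R_def by (subst Henstock_Kurzweil_Integration.integral_diff) auto
    then show ?thesis using eq[OF t] by simp
  qed
  have "integral {0..T} (\<lambda>s. b * exp (- b * (T - s)) * R s + exp (- b * (T - s)) * r s) = exp (- b * (T - T)) * R T - exp (- b * (T - 0)) * R 0"
    by (rule C1_deriv_on_integral[OF T C1_deriv_on_mult[OF e R]])
  then have "R T = integral {0..T} (\<lambda>s. b * exp (- b * (T - s)) * R s + exp (- b * (T - s)) * r s)"
    by (simp add: R_def)
  also have "\<dots> = integral {0..T} (\<lambda>s. exp (- b * (T - s)) * (r0 + a * s) + \<sigma> * (exp (- b * (T - s)) * z s))"
    by (rule Henstock_Kurzweil_Integration.integral_cong) (simp add: r_eq algebra_simps)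
  also have "\<dots> = drift_integral T + integral {0..T} (\<lambda>s. \<sigma> * (exp (- b * (T - s)) * z s))"
    unfolding drift_integral_def
    by (intro Henstock_Kurzweil_Integration.integral_add integrable_continuous_real continuous_intros z)
  finally show ?thesis by (simp add: R_def)
qed

text \<open>
  The noise is \<open>w - V\<close> with \<open>V s = \<integral>\<^sub>0\<^sup>s y\<close>, and \<open>y\<close> contains \<open>L s = \<integral>\<^sub>0\<^sup>s \<Lambda>' w\<close>.
  Integrating by parts, against \<open>\<phi> T\<close> for \<open>V\<close> and against \<open>\<psi> T\<close> for \<open>L\<close>, removes both inner
  integrals, and \<open>vol' T\<close> is what multiplies \<open>w\<close> in the end, up to sign.
\<close>

lemma integrated_noise:
  fixes w y :: "real \<Rightarrow> real"
  assumes T: "0 \<le> T" and w: "continuous_on {0..T} w"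
    and y: "\<And>s. s \<in> {0..T} \<Longrightarrow> y s = p * l_fun p q s * w s - p * exp (- (p + q) * s) * integral {0..s} (\<lambda>\<tau>. \<Lambda>' \<tau> * w \<tau>)"
  shows "integral {0..T} (\<lambda>s. \<sigma> * (exp (- b * (T - s)) * (w s - integral {0..s} y))) = - integral {0..T} (\<lambda>s. vol' T s * w s)"
proof -
  have \<Lambda>': "continuous_on {0..T} \<Lambda>'" using \<Lambda>_C1 by (simp add: C1_deriv_on_def)
  have vol'c: "continuous_on {0..T} (vol' T)" using vol_C1 by (simp add: C1_deriv_on_def)
  define L where "L s = integral {0..s} (\<lambda>\<tau>. \<Lambda>' \<tau> * w \<tau>)" for s
  have c: "continuous_on {0..T} (\<lambda>\<tau>. \<Lambda>' \<tau> * w \<tau>)" by (intro continuous_intros \<Lambda>' w)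
  have L: "C1_deriv_on {0..T} L (\<lambda>\<tau>. \<Lambda>' \<tau> * w \<tau>)"
    unfolding C1_deriv_on_def L_def[abs_def] using c integral_has_real_derivative[OF c] by auto
  have "continuous_on {0..T} (\<lambda>s. p * l_fun p q s * w s - p * exp (- (p + q) * s) * L s)"
    by (intro continuous_intros w C1_deriv_on_continuous[OF L] C1_deriv_on_continuous[OF l_C1])
  then have yc: "continuous_on {0..T} y"
    by (rule continuous_on_eq) (simp add: y L_def)
  define V where "V s = integral {0..s} y" for s
  have V: "C1_deriv_on {0..T} V y"
    unfolding C1_deriv_on_def V_def[abs_def] using yc integral_has_real_derivative[OF yc] by auto
  have Vc: "continuous_on {0..T} V" by (rule C1_deriv_on_continuous[OF V])
  have i1: "(\<lambda>s. \<sigma> * (exp (- b * (T - s)) * (w s - V s))) integrable_on {0..T}"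
    by (intro integrable_continuous_real continuous_intros w Vc)
  have i2: "(\<lambda>s. vol' T s * w s) integrable_on {0..T}"
    by (intro integrable_continuous_real continuous_intros w vol'c)
  \<comment> \<open>The sum of the two integrands is the derivative of \<open>\<sigma> (\<phi> V - \<psi> L)\<close>, which vanishes at both ends.\<close>
  note F = C1_deriv_on_cmult[OF C1_deriv_on_diff[OF C1_deriv_on_mult[OF \<phi>_C1 V] C1_deriv_on_mult[OF \<psi>_C1 L]], of \<sigma>]
  have "integral {0..T} (\<lambda>s. \<sigma> * (exp (- b * (T - s)) * (w s - V s))) + integral {0..T} (\<lambda>s. vol' T s * w s)
     = integral {0..T} (\<lambda>s. \<sigma> * (exp (- b * (T - s)) * (w s - V s)) + vol' T s * w s)"
    by (rule Henstock_Kurzweil_Integration.integral_add[symmetric, OF i1 i2])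
  also have "\<dots> = integral {0..T} (\<lambda>s. \<sigma> * (- exp (- b * (T - s)) * V s + \<phi> T s * y s
       - (- (\<phi> T s * (p * exp (- (p + q) * s))) * L s + \<psi> T s * (\<Lambda>' s * w s))))"
  proof (rule Henstock_Kurzweil_Integration.integral_cong)
    fix s assume s: "s \<in> {0..T}"
    have e: "\<Lambda> s * (p * exp (- (p + q) * s)) = p * l_fun p q s"
    proof -
      have "exp ((p + q) * s) * exp (- (p + q) * s) = 1" by (simp add: exp_add[symmetric] algebra_simps)
      then show ?thesis unfolding \<Lambda>_def by (metis mult.assoc mult.commute mult.left_commute mult_1)
    qed
    have v: "vol' T s = \<sigma> * (- exp (- b * (T - s)) - \<Lambda>' s * \<psi> T s + (\<Lambda> s * (p * exp (- (p + q) * s))) * \<phi> T s)"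
      unfolding vol'_def by (simp only: minus_add_distrib minus_mult_right minus_minus diff_conv_add_uminus add.assoc mult.assoc mult.commute mult.left_commute)
    show "\<sigma> * (exp (- b * (T - s)) * (w s - V s)) + vol' T s * w s =
        \<sigma> * (- exp (- b * (T - s)) * V s + \<phi> T s * y s
       - (- (\<phi> T s * (p * exp (- (p + q) * s))) * L s + \<psi> T s * (\<Lambda>' s * w s)))"
    proof -
      obtain E F where EF: "exp (- b * (T - s)) = E" "exp (- (p + q) * s) = F" by blast
      show ?thesis unfolding y[OF s] L_def[symmetric] v unfolding e unfolding EF by (simp add: algebra_simps)
    qed
  qed
  also have "\<dots> = \<sigma> * (\<phi> T T * V T - \<psi> T T * L T) - \<sigma> * (\<phi> T 0 * V 0 - \<psi> T 0 * L 0)"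
    by (rule C1_deriv_on_integral[OF T F])
  also have "\<dots> = 0" by (simp add: \<phi>_def \<psi>_def V_def L_def)
  finally show ?thesis by (simp add: V_def)
qed

lemma l_fun_pos: assumes "0 \<le> \<tau>" shows "0 < l_fun p q \<tau>"
proof -
  let ?d = "(p + 2 * q)\<^sup>2 * exp (2 * q * \<tau>) - p\<^sup>2"
  have "2 * q * p < 4 * q * (p + q)" using q p by (simp add: mult.assoc) 
  then have "2 * q * p < ?d" using l_denominator[OF assms] by (rule less_le_trans)
  then show ?thesis using l_denominator_pos[OF assms] by (simp add: l_fun_def)
qed

lemma l_fun_le_1: assumes "0 \<le> \<tau>" "0 \<le> p" shows "l_fun p q \<tau> \<le> 1"
  using l_denominator_pos[OF assms(1)] assms q by (simp add: l_fun_def)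

lemma m_fun_eq_HK: "m_fun p q b u = integral {0..u} (\<lambda>s. p * exp (- (p + q) * s) * (1 - exp (- b * (u - s))))"
  unfolding m_fun_def by (rule LBINT_continuous) (intro continuous_intros)

text \<open>
  For \<open>p < 0\<close> the left-hand side is not positive. For \<open>p \<ge> 0\<close> one has \<open>0 < l \<le> 1\<close>, and
  \<open>m u\<close> is at most \<open>1 - exp (- b u)\<close> times the total mass \<open>p / (p + q) < 1\<close> of its kernel.
  With \<open>u = T - S\<close> this makes \<open>v\<^sub>S\<^sub>,\<^sub>T(S)\<close> negative.
\<close>

lemma l_m_less:
  assumes "0 < u" "0 \<le> \<tau>"
  shows "l_fun p q \<tau> * m_fun p q b u < 1 - exp (- b * u)"
proof (cases "0 \<le> p")
  case False
  have "m_fun p q b u \<le> integral {0..u} (\<lambda>s. 0)"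
    unfolding m_fun_eq_HK
    using False b by (intro Henstock_Kurzweil_Integration.integral_le integrable_continuous_real continuous_intros)
       (auto intro!: mult_nonpos_nonneg)
  then have "l_fun p q \<tau> * m_fun p q b u \<le> 0" using l_fun_pos[OF assms(2)] by (simp add: mult_nonneg_nonpos)
  also have "0 < 1 - exp (- b * u)" using b assms by simp
  finally show ?thesis .
next
  case True
  have pq: "0 < p + q" using p by simp
  have "m_fun p q b u \<le> integral {0..u} (\<lambda>s. (1 - exp (- b * u)) * (p * exp (- (p + q) * s)))"
    unfolding m_fun_eq_HK
  proof (intro Henstock_Kurzweil_Integration.integral_le integrable_continuous_real continuous_intros)
    fix s assume "s \<in> {0..u}"
    then have "1 - exp (- b * (u - s)) \<le> 1 - exp (- b * u)" using b by simp
    then show "p * exp (- (p + q) * s) * (1 - exp (- b * (u - s))) \<le> (1 - exp (- b * u)) * (p * exp (- (p + q) * s))"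
      using True by (subst mult.commute) (intro mult_right_mono, auto)
  qed
  also have "\<dots> = (1 - exp (- b * u)) * integral {0..u} (\<lambda>s. p * exp (- (p + q) * s))"
    by (rule Henstock_Kurzweil_Integration.integral_mult_right)
  also have "integral {0..u} (\<lambda>s. p * exp (- (p + q) * s)) = - p / (p + q) * exp (- (p + q) * u) - - p / (p + q) * exp (- (p + q) * 0)"
  proof (rule C1_deriv_on_integral)
    have cancel: "- p / d * (e * (- d)) = p * e" if "d \<noteq> 0" for d e :: real
      using that by simp
    have "((\<lambda>s. - p / (p + q) * exp (- (p + q) * s)) has_real_derivative - p / (p + q) * (exp (- (p + q) * x) * (- (p + q)))) (at x within {0..u})" for x
      using pq by (auto intro!: derivative_eq_intros)
    moreover have "- p / (p + q) * (e * (- (p + q))) = p * e" for e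
      by (rule cancel) (use pq in simp)
    ultimately show "C1_deriv_on {0..u} (\<lambda>s. - p / (p + q) * exp (- (p + q) * s)) (\<lambda>s. p * exp (- (p + q) * s))"
      unfolding C1_deriv_on_def by (auto intro!: continuous_intros)
  qed (use assms in simp)
  also have "\<dots> = p / (p + q) * (1 - exp (- (p + q) * u))" by (simp add: algebra_simps)
  finally have m: "m_fun p q b u \<le> (1 - exp (- b * u)) * (p / (p + q) * (1 - exp (- (p + q) * u)))" .
  have k: "p / (p + q) * (1 - exp (- (p + q) * u)) < 1"
  proof -
    have "p / (p + q) * (1 - exp (- (p + q) * u)) \<le> p / (p + q) * 1"
      using True pq by (intro mult_left_mono) auto
    also have "\<dots> < 1" using q pq by simp
    finally show ?thesis .
  qed
  have k0: "0 \<le> p / (p + q) * (1 - exp (- (p + q) * u))"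
  proof (intro mult_nonneg_nonneg divide_nonneg_pos)
    have "(p + q) * u \<ge> 0" using pq assms by simp
    then show "0 \<le> 1 - exp (- (p + q) * u)"
      unfolding mult_minus_left by simp
  qed (use True pq in auto)
  have e: "0 < 1 - exp (- b * u)" using b assms by simp
  have "l_fun p q \<tau> * m_fun p q b u \<le> l_fun p q \<tau> * ((1 - exp (- b * u)) * (p / (p + q) * (1 - exp (- (p + q) * u))))"
    using l_fun_pos[OF assms(2)] m by (intro mult_left_mono) auto
  also have "\<dots> \<le> 1 * ((1 - exp (- b * u)) * (p / (p + q) * (1 - exp (- (p + q) * u))))"
    by (rule mult_right_mono[OF l_fun_le_1[OF assms(2) True] mult_nonneg_nonneg[OF less_imp_le[OF e] k0]])
  also have "\<dots> < 1 * ((1 - exp (- b * u)) * 1)"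
    unfolding mult_1_left by (rule mult_strict_left_mono[OF k e])
  finally show ?thesis by simp
qed

lemma v_fun_at_S: assumes "0 < \<sigma>" "0 \<le> S" "S < T" shows "v_fun p q b \<sigma> S T S < 0"
proof -
  have "m_fun p q b 0 = 0" by (simp add: m_fun_eq_HK)
  then have "v_fun p q b \<sigma> S T S = \<sigma> / b * (exp (- b * (T - S)) - 1 + l_fun p q S * m_fun p q b (T - S))"
    by (simp add: v_fun_def)
  also have "\<dots> < 0" using l_m_less[of "T - S" S] assms b by (intro mult_pos_neg) auto
  finally show ?thesis .
qed

end

section \<open>Expected call payoff of a lognormal variable\<close>

text \<open>
  Substitution \<open>y = m - x\<close> and symmetry of the density.
\<close>

lemma integral_std_normal_half_line:
  "integrable lborel (\<lambda>y. indicator {-d..} y * std_normal_density (y - m))"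
  "(\<integral>y. indicator {-d..} y * std_normal_density (y - m) \<partial>lborel) = Phi (d + m)"
proof -
  have "integrable lborel (\<lambda>y. std_normal_density (y - m))"
    using lborel_integrable_real_affine[of std_normal_density 1 "- m"] by simp
  then show "integrable lborel (\<lambda>y. indicator {-d..} y * std_normal_density (y - m))"
    using integrable_mult_indicator[of "{-d..}" lborel "\<lambda>y. std_normal_density (y - m)"] by simp
  have "(\<integral>y. indicator {-d..} y * std_normal_density (y - m) \<partial>lborel) =
     (\<integral>x. indicator {-d..} (m - x) * std_normal_density (m - x - m) \<partial>lborel)"
    by (subst lborel_integral_real_affine[of "- 1" _ m]) simp_all
  also have "\<dots> = (\<integral>x. indicator {..d + m} x *\<^sub>R std_normal_density x \<partial>lborel)"
    by (rule Bochner_Integration.integral_cong) (auto simp: indicator_def std_normal_density_def)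
  finally show "(\<integral>y. indicator {-d..} y * std_normal_density (y - m) \<partial>lborel) = Phi (d + m)"
    by (simp add: Phi_def set_lebesgue_integral_def)
qed

text \<open>
  The option is exercised for \<open>y \<ge> - (k - ln K) / s\<close>, and completing the square turns \<open>exp (s y)\<close>
  times the normal density into \<open>exp (s\<^sup>2 / 2)\<close> times a normal density with mean \<open>s\<close>.
\<close>

lemma lognormal_call_expectation:
  assumes s: "0 < s" and K: "0 < K"
  shows "(\<integral>y. std_normal_density y * max (exp (k + s * y) - K) 0 \<partial>lborel) =
     exp (k + s\<^sup>2 / 2) * Phi ((k - ln K + s\<^sup>2) / s) - K * Phi ((k - ln K) / s)"
proof -
  define d where "d = (k - ln K) / s"
  have "std_normal_density y * max (exp (k + s * y) - K) 0 =
     exp (k + s\<^sup>2 / 2) * (indicator {-d..} y * std_normal_density (y - s)) - K * (indicator {-d..} y * std_normal_density (y - 0))" for y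
  proof -
    have "K \<le> exp (k + s * y) \<longleftrightarrow> ln K \<le> k + s * y" using K by (metis exp_ge_zero exp_ln exp_le_cancel_iff)
    also have "\<dots> \<longleftrightarrow> - d \<le> y" using s by (simp add: d_def field_simps)
    finally have iff: "K \<le> exp (k + s * y) \<longleftrightarrow> - d \<le> y" .
    have "std_normal_density y * exp (k + s * y) = exp (k + s\<^sup>2 / 2) * std_normal_density (y - s)"
    proof -
      have "- y\<^sup>2 / 2 + (k + s * y) = (k + s\<^sup>2 / 2) + - (y - s)\<^sup>2 / 2"
        by (simp add: power2_eq_square field_simps)
      then have "exp (- y\<^sup>2 / 2) * exp (k + s * y) = exp (k + s\<^sup>2 / 2) * exp (- (y - s)\<^sup>2 / 2)"
        unfolding exp_add[symmetric] by simp
      then show ?thesis unfolding std_normal_density_def by simp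
    qed
    then show ?thesis using iff by (auto simp: indicator_def max_def algebra_simps)
  qed
  then have "(\<integral>y. std_normal_density y * max (exp (k + s * y) - K) 0 \<partial>lborel) =
     exp (k + s\<^sup>2 / 2) * Phi (d + s) - K * Phi (d + 0)"
    using integral_std_normal_half_line[of d s] integral_std_normal_half_line[of d 0]
    by (simp only:) (subst Bochner_Integration.integral_diff, simp_all)
  also have "d + s = (k - ln K + s\<^sup>2) / s" using s by (simp add: d_def field_simps power2_eq_square)
  finally show ?thesis by (simp add: d_def)
qed

section \<open>Bond prices and the option price\<close>

locale short_rate_model = brownian Q W + short_rate_parameters p q b \<sigma> a r0
  for Q :: "'w measure" and W :: "real \<Rightarrow> 'w \<Rightarrow> real" and p q b \<sigma> a r0 :: real +
  fixes Y r :: "real \<Rightarrow> 'w \<Rightarrow> real"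
  assumes drift: "is_noise_drift Q W p q Y"
    and solution: "strong_solution Q \<F> (noise W Y) a b \<sigma> r0 r"
begin

text \<open>
  At each fixed time the formula holds almost surely by partial integration. Nonnegative rational
  times are countably many and both sides are continuous, so that one null set serves all times.
\<close>

lemma AE_drift_formula:
  "AE \<omega> in Q. \<forall>s\<ge>0. Y s \<omega> = p * l_fun p q s * W s \<omega> - p * exp (- (p + q) * s) * integral {0..s} (\<lambda>\<tau>. \<Lambda>' \<tau> * W \<tau> \<omega>)"
proof -
  define R where "R s \<omega> = p * l_fun p q s * W s \<omega> - p * exp (- (p + q) * s) * integral {0..s} (\<lambda>\<tau>. \<Lambda>' \<tau> * W \<tau> \<omega>)" for s \<omega>
  have pt: "AE \<omega> in Q. Y s \<omega> = R s \<omega>" if s: "0 \<le> s" for s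
  proof -
    let ?c = "p * exp (- (p + q) * s)"
    have eq: "(\<lambda>\<tau>. p * exp (- (p + q) * (s - \<tau>)) * l_fun p q \<tau>) = (\<lambda>\<tau>. ?c * \<Lambda> \<tau>)"
    proof
      fix \<tau>
      have "exp (- (p + q) * (s - \<tau>)) = exp (- (p + q) * s) * exp ((p + q) * \<tau>)"
        unfolding exp_add[symmetric] by (simp add: algebra_simps)
      then show "p * exp (- (p + q) * (s - \<tau>)) * l_fun p q \<tau> = ?c * \<Lambda> \<tau>" by (simp add: \<Lambda>_def)
    qed
    have c1: "C1_deriv_on {0..s} (\<lambda>\<tau>. p * exp (- (p + q) * (s - \<tau>)) * l_fun p q \<tau>) (\<lambda>\<tau>. ?c * \<Lambda>' \<tau>)"
      unfolding eq by (rule C1_deriv_on_cmult[OF \<Lambda>_C1])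
    have "(\<lambda>\<tau>. p * exp (- (p + q) * (s - \<tau>)) * l_fun p q \<tau>) \<in> borel_measurable borel"
      using l_measurable by measurable
    moreover have "is_ito_integral Q \<F> W (\<lambda>\<tau> \<omega>. p * exp (- (p + q) * (s - \<tau>)) * l_fun p q \<tau>) s (Y s)"
      using drift s by (simp add: is_noise_drift_def)
    ultimately have "AE \<omega> in Q. Y s \<omega> = I (\<lambda>\<tau>. p * exp (- (p + q) * (s - \<tau>)) * l_fun p q \<tau>) 0 s \<omega>"
      using ito_integral_eq_wiener_integral[OF _ s c1] by blast
    then show ?thesis
      using AE_wiener_integral[OF order_refl s c1] W_0
    proof eventually_elim
      case (elim \<omega>)
      have "integral {0..s} (\<lambda>u. ?c * \<Lambda>' u * W u \<omega>) = ?c * integral {0..s} (\<lambda>\<tau>. \<Lambda>' \<tau> * W \<tau> \<omega>)"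
        unfolding mult.assoc[of ?c] by (rule Henstock_Kurzweil_Integration.integral_mult_right)
      then show ?case using elim by (simp add: R_def)
    qed
  qed
  have "AE \<omega> in Q. \<forall>i n :: nat. Y (real i / real (Suc n)) \<omega> = R (real i / real (Suc n)) \<omega>"
    unfolding AE_all_countable using pt by simp
  moreover have "AE \<omega> in Q. continuous_on {0..} (\<lambda>s. Y s \<omega>)" using drift by (simp add: is_noise_drift_def)
  ultimately show ?thesis
    using W_continuous unfolding R_def[symmetric]
  proof eventually_elim
    case (elim \<omega>)
    show ?case
    proof (intro allI impI)
      fix s :: real assume s: "0 \<le> s"
      \<comment> \<open>Rational approximations of \<open>s\<close> from above, which keeps them nonnegative.\<close>
      define x where "x n = real (nat \<lceil>s * real (Suc n)\<rceil>) / real (Suc n)" for n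
      have x: "s \<le> x n" "x n \<le> s + 1 / real (Suc n)" for n
      proof -
        have "s * real (Suc n) \<le> real (nat \<lceil>s * real (Suc n)\<rceil>)" by (rule real_nat_ceiling_ge)
        then show "s \<le> x n" by (simp add: x_def le_divide_eq del: of_nat_Suc)
        have "real (nat \<lceil>s * real (Suc n)\<rceil>) \<le> s * real (Suc n) + 1"
          using of_int_ceiling_le_add_one[of "s * real (Suc n)"] s by simp
        then show "x n \<le> s + 1 / real (Suc n)" by (simp add: x_def divide_le_eq distrib_right del: of_nat_Suc)
      qed
      have xl: "x \<longlonglongrightarrow> s"
      proof (rule tendsto_sandwich[where f = "\<lambda>_. s" and h = "\<lambda>n. s + 1 / real (Suc n)"])
        show "(\<lambda>n. s + 1 / real (Suc n)) \<longlonglongrightarrow> s"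
          using tendsto_add[OF tendsto_const[of s] LIMSEQ_Suc[OF lim_1_over_n]] by simp
      qed (use x in \<open>auto simp del: of_nat_Suc\<close>)
      have x1: "x n \<in> {0..s + 1}" for n
      proof -
        have "1 / real (Suc n) \<le> 1" by simp
        then show ?thesis using x[of n] s unfolding atLeastAtMost_iff by linarith
      qed
      have W1: "continuous_on {0..s + 1} (\<lambda>u. W u \<omega>)" by (rule continuous_on_subset[OF elim(3)]) auto
      have \<Lambda>': "continuous_on {0..s + 1} \<Lambda>'" using \<Lambda>_C1 by (simp add: C1_deriv_on_def)
      have L: "continuous_on {0..s + 1} (\<lambda>s. integral {0..s} (\<lambda>\<tau>. \<Lambda>' \<tau> * W \<tau> \<omega>))"
        by (rule indefinite_integral_continuous_1) (intro integrable_continuous_real continuous_intros \<Lambda>' W1)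
      have R: "continuous_on {0..s + 1} (\<lambda>s. R s \<omega>)"
        unfolding R_def by (intro continuous_intros W1 L C1_deriv_on_continuous[OF l_C1])
      have "(\<lambda>n. R (x n) \<omega>) \<longlonglongrightarrow> R s \<omega>"
        by (rule continuous_on_tendsto_compose[OF R xl]) (use x1 s in auto)
      moreover have "(\<lambda>n. Y (x n) \<omega>) \<longlonglongrightarrow> Y s \<omega>"
        by (rule continuous_on_tendsto_compose[OF elim(2) xl]) (use x1 s in auto)
      moreover have "(\<lambda>n. Y (x n) \<omega>) = (\<lambda>n. R (x n) \<omega>)" using elim(1) by (simp add: x_def)
      ultimately show "Y s \<omega> = R s \<omega>" using LIMSEQ_unique by metis
    qed
  qed
qed

text \<open>
  The deterministic computations are applied to almost every path; the result is recognised as a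
  Wiener integral because \<open>vol T T = 0\<close> and \<open>W 0 = 0\<close>, so that partial integration has no boundary
  terms.
\<close>

lemma AE_integrated_rate:
  assumes t: "0 \<le> t" "t \<le> T"
  shows "AE \<omega> in Q. (LBINT s:{t..T}. r s \<omega>) = drift_integral T - drift_integral t + I (vol T) 0 T \<omega> - I (vol t) 0 t \<omega>"
proof -
  have rc: "AE \<omega> in Q. continuous_on {0..} (\<lambda>t. r t \<omega>)"
    and re: "AE \<omega> in Q. \<forall>t\<ge>0. r t \<omega> = r0 + (LBINT s:{0..t}. a - b * r s \<omega>) + \<sigma> * (noise W Y t \<omega> - noise W Y 0 \<omega>)"
    using solution by (auto simp: strong_solution_def)
  have Yc: "AE \<omega> in Q. continuous_on {0..} (\<lambda>s. Y s \<omega>)" using drift by (simp add: is_noise_drift_def)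
  show ?thesis
    using rc re Yc AE_drift_formula W_continuous W_0
  proof eventually_elim
    case (elim \<omega>)
    have sub: "continuous_on {0..u} (\<lambda>s. r s \<omega>)" "continuous_on {0..u} (\<lambda>s. Y s \<omega>)" "continuous_on {0..u} (\<lambda>s. W s \<omega>)" for u
      using elim(1,3,5) by (auto intro: continuous_on_subset)
    have R: "integral {0..u} (\<lambda>s. r s \<omega>) = drift_integral u + I (vol u) 0 u \<omega>" if u: "0 \<le> u" for u
    proof -
      have z0: "noise W Y 0 \<omega> = 0"
        using elim(6) LBINT_continuous[of 0 0 "\<lambda>s. Y s \<omega>"] by (simp add: noise_def)
      have z: "noise W Y s \<omega> = W s \<omega> - integral {0..s} (\<lambda>s. Y s \<omega>)" for s
        unfolding noise_def by (simp add: LBINT_continuous sub)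
      have zc: "continuous_on {0..u} (\<lambda>s. W s \<omega> - integral {0..s} (\<lambda>s. Y s \<omega>))"
        by (intro continuous_intros sub indefinite_integral_continuous_1 integrable_continuous_real)
      have "integral {0..u} (\<lambda>s. r s \<omega>) = drift_integral u
          + integral {0..u} (\<lambda>s. \<sigma> * (exp (- b * (u - s)) * (W s \<omega> - integral {0..s} (\<lambda>s. Y s \<omega>))))"
      proof (rule integrated_rate[OF u sub(1) zc])
        fix t assume t: "t \<in> {0..u}"
        have "(LBINT s:{0..t}. a - b * r s \<omega>) = integral {0..t} (\<lambda>s. a - b * r s \<omega>)"
          by (rule LBINT_continuous) (intro continuous_intros sub)
        then show "r t \<omega> = r0 + integral {0..t} (\<lambda>s. a - b * r s \<omega>) + \<sigma> * (W t \<omega> - integral {0..t} (\<lambda>s. Y s \<omega>))"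
          using elim(2) t z0 z[of t] by simp
      qed
      also have "integral {0..u} (\<lambda>s. \<sigma> * (exp (- b * (u - s)) * (W s \<omega> - integral {0..s} (\<lambda>s. Y s \<omega>))))
          = - integral {0..u} (\<lambda>s. vol' u s * W s \<omega>)"
        by (rule integrated_noise[OF u sub(3)]) (use elim(4) in auto)
      also have "\<dots> = I (vol u) 0 u \<omega>"
        using wiener_integral_pathwise(2)[where W = W and \<omega> = \<omega>, OF order_refl u vol_C1 elim(5)] elim(6)
        by (simp add: vol_T)
      finally show ?thesis .
    qed
    have "(LBINT s:{t..T}. r s \<omega>) = integral {t..T} (\<lambda>s. r s \<omega>)"
      by (rule LBINT_continuous) (use t in \<open>auto intro: continuous_on_subset[OF elim(1)]\<close>)
    moreover have "integral {0..T} (\<lambda>s. r s \<omega>) = integral {0..t} (\<lambda>s. r s \<omega>) + integral {t..T} (\<lambda>s. r s \<omega>)"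
      by (rule Henstock_Kurzweil_Integration.integral_combine[symmetric])
        (use t sub in \<open>auto intro: integrable_continuous_real\<close>)
    ultimately show ?case using R[of t] R[of T] t by simp
  qed
qed

lemma vol_C1_subset: "0 \<le> s \<Longrightarrow> t \<le> T \<Longrightarrow> C1_deriv_on {s..t} (vol T) (vol' T)"
  by (rule C1_deriv_on_subset[OF vol_C1]) auto

lemma vol_continuous: "0 \<le> s \<Longrightarrow> t \<le> T \<Longrightarrow> continuous_on {s..t} (vol T)"
  by (rule C1_deriv_on_continuous[OF vol_C1_subset])

definition log_bond :: "real \<Rightarrow> real \<Rightarrow> real" where
  "log_bond t T = - (drift_integral T - drift_integral t) + integral {t..T} (\<lambda>u. vol T u * vol T u) / 2"

text \<open>
  The part of the stochastic integral before \<open>t\<close> is known at time \<open>t\<close> and leaves the conditional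
  expectation; the part after \<open>t\<close> is independent of it, and its exponential has conditional
  expectation \<open>exp (\<integral> (vol T)\<^sup>2 / 2)\<close>.
\<close>

lemma AE_bond_price:
  assumes t: "0 \<le> t" "t \<le> T"
  shows "AE \<omega> in Q. bond_price Q \<F> r t T \<omega> = exp (log_bond t T + I (\<lambda>u. vol t u - vol T u) 0 t \<omega>)"
proof -
  interpret sub: finite_measure_subalgebra Q "\<F> t" by unfold_locales (rule \<F>_subalgebra)
  define D where "D = drift_integral T - drift_integral t"
  define X where "X = I (\<lambda>u. vol t u - vol T u) 0 t"
  define X2 where "X2 = I (\<lambda>u. (-1) * vol T u) t T"
  define v where "v = integral {t..T} (\<lambda>u. vol T u * vol T u)"
  have c1: "C1_deriv_on {0..t} (\<lambda>u. vol t u - vol T u) (\<lambda>u. vol' t u - vol' T u)"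
    by (rule C1_deriv_on_diff) (use t in \<open>auto intro: vol_C1_subset\<close>)
  have c2: "C1_deriv_on {t..T} (\<lambda>u. (-1) * vol T u) (\<lambda>u. (-1) * vol' T u)"
    by (rule C1_deriv_on_cmult) (use t in \<open>auto intro: vol_C1_subset\<close>)
  have Xm[measurable]: "X \<in> borel_measurable (\<F> t)" "X \<in> borel_measurable Q"
    unfolding X_def using wiener_integral_measurable wiener_integral_measurable_Q t by auto
  have X2m[measurable]: "X2 \<in> borel_measurable Q"
    unfolding X2_def using wiener_integral_measurable_Q t by auto
  have eq: "AE \<omega> in Q. exp (- (LBINT s:{t..T}. r s \<omega>)) = exp (X \<omega> - D) * exp (X2 \<omega>)"
    using AE_integrated_rate[OF t] AE_wiener_integral_combine[OF order_refl t vol_C1]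
      AE_wiener_integral_diff[OF order_refl t(1) vol_C1_subset[OF order_refl order_refl] vol_C1_subset[OF order_refl t(2)]]
      AE_wiener_integral_cmult[OF t vol_C1_subset[OF t(1) order_refl], of "-1"]
    by eventually_elim (simp add: X_def X2_def D_def exp_add[symmetric])
  have em: "(\<lambda>\<omega>. exp (- (LBINT s:{t..T}. r s \<omega>))) \<in> borel_measurable Q"
    by (rule borel_measurable_AE_eq[OF _ eq]) measurable
  have ind1: "indicator (space Q) \<omega> * exp z = exp z" if "\<omega> \<in> space Q" for \<omega> and z :: real using that by simp
  have iX: "integrable Q (\<lambda>\<omega>. exp (X \<omega>))"
    using exp_wiener_integral_real(1)[OF order_refl t(1) c1 space_in_\<F>]
    unfolding X_def by (subst (asm) Bochner_Integration.integrable_cong[OF refl ind1]) auto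
  have iX2: "integrable Q (\<lambda>\<omega>. exp (X2 \<omega>))"
    using exp_wiener_integral_real(1)[OF t c2 space_in_\<F>]
    unfolding X2_def by (subst (asm) Bochner_Integration.integrable_cong[OF refl ind1]) auto
  have iXD: "integrable Q (\<lambda>\<omega>. exp (X \<omega> - D))"
    using integrable_mult_left[OF iX, of "exp (- D)"] by (simp add: exp_diff exp_minus divide_inverse)
  have ind: "independent_of (\<F> t) X2" unfolding X2_def by (rule wiener_integral_independent[OF t c2])
  have iprod: "integrable Q (\<lambda>\<omega>. exp (X \<omega> - D) * exp (X2 \<omega>))"
    by (rule independent_of_integral(1)[OF ind \<F>_subalgebra X2m _ _ iXD iX2]) measurable
  have "AE \<omega> in Q. real_cond_exp Q (\<F> t) (\<lambda>\<omega>. exp (X2 \<omega>)) \<omega> = exp (v / 2)"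
  proof (rule sub.real_cond_exp_charact)
    fix A assume A: "A \<in> sets (\<F> t)"
    then have AQ: "A \<in> sets Q" using \<F>_subalgebra[of t] by (auto simp: subalgebra_def)
    have "(\<integral>\<omega>\<in>A. exp (X2 \<omega>) \<partial>Q) = prob A * exp (v / 2)"
      using exp_wiener_integral_real(2)[OF t c2 A] unfolding set_lebesgue_integral_def X2_def v_def by simp
    also have "\<dots> = (\<integral>\<omega>\<in>A. exp (v / 2) \<partial>Q)"
      using AQ by (simp add: set_lebesgue_integral_def)
    finally show "(\<integral>\<omega>\<in>A. exp (X2 \<omega>) \<partial>Q) = (\<integral>\<omega>\<in>A. exp (v / 2) \<partial>Q)" .
  qed (use iX2 in auto)
  moreover have "AE \<omega> in Q. real_cond_exp Q (\<F> t) (\<lambda>\<omega>. exp (X \<omega> - D) * exp (X2 \<omega>)) \<omega> =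
      exp (X \<omega> - D) * real_cond_exp Q (\<F> t) (\<lambda>\<omega>. exp (X2 \<omega>)) \<omega>"
    by (rule sub.real_cond_exp_mult[OF _ _ iprod]) measurable
  moreover have "AE \<omega> in Q. bond_price Q \<F> r t T \<omega> = real_cond_exp Q (\<F> t) (\<lambda>\<omega>. exp (X \<omega> - D) * exp (X2 \<omega>)) \<omega>"
    unfolding bond_price_def by (rule sub.real_cond_exp_cong[OF eq em]) measurable
  ultimately show ?thesis
    by eventually_elim (simp add: log_bond_def D_def X_def v_def exp_add[symmetric] algebra_simps)
qed

lemma drift_integral_0[simp]: "drift_integral 0 = 0" by (simp add: drift_integral_def)

lemma AE_bond_price_0:
  assumes "0 \<le> T" shows "AE \<omega> in Q. bond_price Q \<F> r 0 T \<omega> = exp (log_bond 0 T)"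
  using AE_bond_price[OF order_refl assms] by eventually_elim simp

lemma Sigma_sq_eq:
  assumes "S \<le> T"
  shows "Sigma_sq p q b \<sigma> S T = integral {0..S} (\<lambda>u. (vol S u - vol T u) * (vol S u - vol T u))"
proof -
  have "Sigma_sq p q b \<sigma> S T = (LBINT u:{0..S}. (vol S u - vol T u) * (vol S u - vol T u))"
    unfolding Sigma_sq_def
    by (rule set_lebesgue_integral_cong) (use assms in \<open>auto simp: v_fun_eq_vol_diff power2_eq_square\<close>)
  also have "\<dots> = integral {0..S} (\<lambda>u. (vol S u - vol T u) * (vol S u - vol T u))"
    by (rule LBINT_continuous) (use assms in \<open>intro continuous_intros vol_continuous; simp\<close>)
  finally show ?thesis .
qed

text \<open>
  The integrand is continuous and does not vanish at the end point \<open>S\<close>.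
\<close>

lemma Sigma_sq_pos:
  assumes "0 < \<sigma>" "0 < S" "S < T"
  shows "0 < Sigma_sq p q b \<sigma> S T"
proof -
  let ?f = "\<lambda>u. (vol S u - vol T u) * (vol S u - vol T u)"
  have c: "continuous_on {0..S} ?f"
    using assms by (intro continuous_intros vol_continuous) auto
  have "?f S \<noteq> 0"
    using v_fun_at_S[of S T] v_fun_eq_vol_diff[of S S T] assms by auto
  then have "integral {0..S} ?f \<noteq> 0"
    using integral_eq_0_iff[OF c assms(2)] assms by auto
  moreover have "0 \<le> integral {0..S} ?f"
    by (rule Henstock_Kurzweil_Integration.integral_nonneg[OF integrable_continuous_real[OF c]]) simp
  ultimately show ?thesis using assms by (simp add: Sigma_sq_eq)
qed

text \<open>
  The discount factor \<open>H\<close> is used as the weight, so that \<open>X\<close> becomes normal with variance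
  \<open>V\<close> and a mean \<open>\<mu>\<close> shifted by the covariance of \<open>X\<close> with the exponent of \<open>H\<close>. That the mean of
  \<open>H P(S,T)\<close> is the bond price \<open>PT\<close> (fact \<open>logPT\<close>) brings the result into the stated form.
\<close>

lemma call_price_eq:
  assumes S: "0 < S" "S < T" and K: "0 < K" and \<sigma>: "0 < \<sigma>"
  defines "V \<equiv> Sigma_sq p q b \<sigma> S T" and "PT \<equiv> exp (log_bond 0 T)" and "PS \<equiv> exp (log_bond 0 S)"
  shows "call_price Q \<F> r S T K = PT * Phi (d_plus V K PT PS) - K * PS * Phi (d_minus V K PT PS)"
proof -
  define v where "v u = vol S u - vol T u" for u
  define X where "X = I v 0 S"
  define A where "A = I (\<lambda>u. (-1) * vol S u) 0 S"
  define H where "H \<omega> = exp (- drift_integral S) * exp (A \<omega>)" for \<omega>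
  define \<mu> where "\<mu> = - integral {0..S} (\<lambda>u. vol S u * v u)"
  define s where "s = sqrt V"
  define h where "h x = max (exp (log_bond S T + x) - K) 0" for x
  have ST: "0 \<le> S" "S \<le> T" using S by auto
  have cS: "C1_deriv_on {0..S} (\<lambda>u. (-1) * vol S u) (\<lambda>u. (-1) * vol' S u)"
    by (rule C1_deriv_on_cmult[OF vol_C1_subset]) auto
  have cv: "C1_deriv_on {0..S} v (\<lambda>u. vol' S u - vol' T u)"
    unfolding v_def[abs_def] by (rule C1_deriv_on_diff) (use ST in \<open>auto intro: vol_C1_subset\<close>)
  have Xm[measurable]: "X \<in> borel_measurable Q" and Am[measurable]: "A \<in> borel_measurable Q"
    unfolding X_def A_def using wiener_integral_measurable_Q S by auto
  have hm[measurable]: "h \<in> borel_measurable borel" unfolding h_def[abs_def] by measurable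
  have V: "0 < V" unfolding V_def by (rule Sigma_sq_pos[OF \<sigma> S])
  have V_eq: "V = integral {0..S} (\<lambda>u. v u * v u)"
    unfolding V_def v_def by (rule Sigma_sq_eq[OF ST(2)])
  have s: "0 < s" "s\<^sup>2 = V" using V by (auto simp: s_def)
  have vc: "continuous_on {0..S} v" by (rule C1_deriv_on_continuous[OF cv])
  have volSc: "continuous_on {0..S} (vol S)" "continuous_on {0..S} (vol T)"
    by (use ST in \<open>auto intro: vol_continuous\<close>)
  \<comment> \<open>The discounted price depends on the rate only through the Gaussian pair \<open>(A, X)\<close>.\<close>
  have disc: "AE \<omega> in Q. exp (- (LBINT s:{0..S}. r s \<omega>)) = H \<omega>"
    using AE_integrated_rate[OF order_refl ST(1)] AE_wiener_integral_cmult[OF order_refl ST(1) vol_C1, of "-1"]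
    by eventually_elim (simp add: H_def A_def exp_add[symmetric])
  have dm: "(\<lambda>\<omega>. exp (- (LBINT s:{0..S}. r s \<omega>))) \<in> borel_measurable Q"
    by (rule borel_measurable_AE_eq[OF _ disc]) (simp add: H_def)
  have bm: "bond_price Q \<F> r S T \<in> borel_measurable Q" unfolding bond_price_def by simp
  have "call_price Q \<F> r S T K = (\<integral>\<omega>. H \<omega> * h (X \<omega>) \<partial>Q)"
    unfolding call_price_def
  proof (rule integral_cong_AE)
    show "AE \<omega> in Q. exp (- (LBINT s:{0..S}. r s \<omega>)) * max (bond_price Q \<F> r S T \<omega> - K) 0 = H \<omega> * h (X \<omega>)"
      using disc AE_bond_price[OF ST] by eventually_elim (simp add: h_def X_def v_def[abs_def])
  qed (use dm bm in \<open>auto simp: H_def\<close>)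
  \<comment> \<open>The law of \<open>X\<close> weighted by the discount factor: the characteristic function of the \<open>S\<close>-forward measure.\<close>
  have char: "(\<integral>\<omega>. exp (Complex (A \<omega>) (I (\<lambda>x. u * v x) 0 S \<omega>)) \<partial>Q) =
      exp (Complex ((integral {0..S} (\<lambda>x. vol S x * vol S x) - u\<^sup>2 * V) / 2) (u * \<mu>))" for u
  proof -
    have 1: "integral {0..S} (\<lambda>x. (-1) * vol S x * ((-1) * vol S x)) = integral {0..S} (\<lambda>x. vol S x * vol S x)" by simp
    have 2: "integral {0..S} (\<lambda>x. u * v x * (u * v x)) = u\<^sup>2 * V"
      unfolding V_eq by (subst Henstock_Kurzweil_Integration.integral_mult_right[symmetric])
        (simp add: power2_eq_square mult.assoc mult.left_commute)
    have 3: "integral {0..S} (\<lambda>x. (-1) * vol S x * (u * v x)) = u * \<mu>"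
    proof -
      have "integral {0..S} (\<lambda>x. (-1) * vol S x * (u * v x)) = integral {0..S} (\<lambda>x. (- u) * (vol S x * v x))"
        by (rule Henstock_Kurzweil_Integration.integral_cong) simp
      also have "\<dots> = (- u) * integral {0..S} (\<lambda>x. vol S x * v x)"
        by (rule Henstock_Kurzweil_Integration.integral_mult_right)
      finally show ?thesis by (simp add: \<mu>_def)
    qed
    note e = exp_wiener_integral(2)[OF order_refl ST(1) cS C1_deriv_on_cmult[OF cv, of u] space_in_\<F>, unfolded 1 2 3, folded A_def]
    let ?E = "\<lambda>\<omega>. exp (Complex (A \<omega>) (I (\<lambda>x. u * v x) 0 S \<omega>))"
    have "(\<integral>\<omega>. indicator (space Q) \<omega> *\<^sub>R ?E \<omega> \<partial>Q) = (\<integral>\<omega>. ?E \<omega> \<partial>Q)"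
      by (rule Bochner_Integration.integral_cong) auto
    then show ?thesis using e by (simp add: prob_space)
  qed
  have AE_char: "AE \<omega> in Q. exp (Complex (A \<omega>) (I (\<lambda>x. u * v x) 0 S \<omega>)) = complex_of_real (exp (A \<omega>)) * iexp (u * X \<omega>)" for u
    using AE_wiener_integral_cmult[OF order_refl ST(1) cv, of u]
  proof eventually_elim
    case (elim \<omega>)
    have "Complex (A \<omega>) (u * X \<omega>) = complex_of_real (A \<omega>) + \<i> * complex_of_real (u * X \<omega>)" by (simp add: complex_eq_iff)
    then show ?case using elim by (simp only: X_def exp_add exp_of_real)
  qed
  have char': "(\<integral>\<omega>. complex_of_real (exp (A \<omega>)) * iexp (u * X \<omega>) \<partial>Q) =
     exp (Complex ((integral {0..S} (\<lambda>x. vol S x * vol S x) - u\<^sup>2 * V) / 2) (u * \<mu>))" for u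
    unfolding char[of u, symmetric]
  proof (rule integral_cong_AE)
    have C: "Complex a b = complex_of_real a + \<i> * complex_of_real b" for a b by (simp add: complex_eq_iff)
    have [measurable]: "I (\<lambda>x. u * v x) 0 S \<in> borel_measurable Q" by (rule wiener_integral_measurable_Q) (use ST in auto)
    show "(\<lambda>\<omega>. exp (Complex (A \<omega>) (I (\<lambda>x. u * v x) 0 S \<omega>))) \<in> borel_measurable Q"
      unfolding C by measurable
    show "AE \<omega> in Q. complex_of_real (exp (A \<omega>)) * iexp (u * X \<omega>) = exp (Complex (A \<omega>) (I (\<lambda>x. u * v x) 0 S \<omega>))"
      using AE_char[of u] by eventually_elim simp
  qed measurable
  have intA: "integrable Q (\<lambda>\<omega>. exp (A \<omega>))" and expA: "(\<integral>\<omega>. exp (A \<omega>) \<partial>Q) = exp (integral {0..S} (\<lambda>x. vol S x * vol S x) / 2)"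
  proof -
    note e = exp_wiener_integral_real[OF order_refl ST(1) cS space_in_\<F>, folded A_def]
    have "integrable Q (\<lambda>\<omega>. indicator (space Q) \<omega> * exp (A \<omega>)) \<longleftrightarrow> integrable Q (\<lambda>\<omega>. exp (A \<omega>))"
      "(\<integral>\<omega>. indicator (space Q) \<omega> * exp (A \<omega>) \<partial>Q) = (\<integral>\<omega>. exp (A \<omega>) \<partial>Q)"
      by (auto intro!: Bochner_Integration.integrable_cong Bochner_Integration.integral_cong)
    then show "integrable Q (\<lambda>\<omega>. exp (A \<omega>))"
      "(\<integral>\<omega>. exp (A \<omega>) \<partial>Q) = exp (integral {0..S} (\<lambda>x. vol S x * vol S x) / 2)"
      using e by (simp_all add: prob_space)
  qed
  have Hi: "integrable Q H" unfolding H_def[abs_def] using intA by simp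
  have EH: "(\<integral>\<omega>. H \<omega> \<partial>Q) = PS"
  proof -
    have "(\<integral>\<omega>. H \<omega> \<partial>Q) = exp (- drift_integral S) * (\<integral>\<omega>. exp (A \<omega>) \<partial>Q)"
      unfolding H_def by (rule integral_mult_right_zero)
    then show ?thesis unfolding expA exp_add[symmetric] by (simp add: PS_def log_bond_def)
  qed
  have charH: "(\<integral>\<omega>. H \<omega> *\<^sub>R iexp (u * X \<omega>) \<partial>Q) =
     (\<integral>\<omega>. H \<omega> \<partial>Q) *\<^sub>R exp (\<i> * complex_of_real (u * \<mu>) - complex_of_real (u\<^sup>2 * s\<^sup>2 / 2))" for u
  proof -
    define n where "n = integral {0..S} (\<lambda>x. vol S x * vol S x) / 2"
    have "(\<integral>\<omega>. H \<omega> *\<^sub>R iexp (u * X \<omega>) \<partial>Q) = (\<integral>\<omega>. complex_of_real (exp (- drift_integral S)) * (complex_of_real (exp (A \<omega>)) * iexp (u * X \<omega>)) \<partial>Q)"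
      by (rule Bochner_Integration.integral_cong) (simp_all add: H_def scaleR_conv_of_real)
    also have "\<dots> = complex_of_real (exp (- drift_integral S)) * exp (Complex (n - u\<^sup>2 * V / 2) (u * \<mu>))"
      by (subst integral_mult_right_zero) (simp only: char' diff_divide_distrib n_def)
    also have "Complex (n - u\<^sup>2 * V / 2) (u * \<mu>) = complex_of_real n + (\<i> * complex_of_real (u * \<mu>) - complex_of_real (u\<^sup>2 * s\<^sup>2 / 2))"
      by (simp add: complex_eq_iff s)
    also have "complex_of_real (exp (- drift_integral S)) * exp \<dots> =
       complex_of_real (exp (- drift_integral S) * exp n) * exp (\<i> * complex_of_real (u * \<mu>) - complex_of_real (u\<^sup>2 * s\<^sup>2 / 2))"
      unfolding exp_add by (simp only: exp_of_real of_real_mult mult.assoc)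
    also have "exp (- drift_integral S) * exp n = (\<integral>\<omega>. H \<omega> \<partial>Q)"
      unfolding H_def n_def integral_mult_right_zero expA ..
    finally show ?thesis by (simp only: scaleR_conv_of_real)
  qed
  have "(\<integral>\<omega>. H \<omega> * h (X \<omega>) \<partial>Q) = (\<integral>\<omega>. H \<omega> \<partial>Q) * (\<integral>y. std_normal_density y * h (\<mu> + s * y) \<partial>lborel)"
    by (rule weighted_law_of_char(1)[OF Hi _ Xm hm charH]) (simp add: H_def)
  also have "\<dots> = PS * (\<integral>y. std_normal_density y * max (exp ((log_bond S T + \<mu>) + s * y) - K) 0 \<partial>lborel)"
    unfolding EH h_def by (simp add: add.assoc)
  also have "\<dots> = PS * (exp (log_bond S T + \<mu> + s\<^sup>2 / 2) * Phi ((log_bond S T + \<mu> - ln K + s\<^sup>2) / s)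
      - K * Phi ((log_bond S T + \<mu> - ln K) / s))"
    by (simp only: lognormal_call_expectation[OF s(1) K])
  finally have price: "(\<integral>\<omega>. H \<omega> * h (X \<omega>) \<partial>Q) = \<dots>" .
  have logPT: "log_bond 0 T = log_bond 0 S + (log_bond S T + \<mu> + s\<^sup>2 / 2)"
  proof -
    have i: "(\<lambda>u. vol S u * vol S u) integrable_on {0..S}" "(\<lambda>u. vol S u * v u) integrable_on {0..S}" "(\<lambda>u. v u * v u) integrable_on {0..S}"
      "(\<lambda>u. vol T u * vol T u) integrable_on {0..T}"
      using ST by (auto intro!: integrable_continuous_real continuous_intros volSc vc vol_continuous)
    have "integral {0..S} (\<lambda>u. vol T u * vol T u) = integral {0..S} (\<lambda>u. vol S u * vol S u - 2 * (vol S u * v u) + v u * v u)"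
      by (rule Henstock_Kurzweil_Integration.integral_cong) (simp add: v_def algebra_simps)
    also have "\<dots> = integral {0..S} (\<lambda>u. vol S u * vol S u) - 2 * integral {0..S} (\<lambda>u. vol S u * v u) + integral {0..S} (\<lambda>u. v u * v u)"
      by (intro integral_unique has_integral_add has_integral_diff has_integral_mult_right integrable_integral i)
    finally have "integral {0..S} (\<lambda>u. vol T u * vol T u) = integral {0..S} (\<lambda>u. vol S u * vol S u) + 2 * \<mu> + V"
      by (simp add: \<mu>_def V_eq)
    moreover have "integral {0..T} (\<lambda>u. vol T u * vol T u) = integral {0..S} (\<lambda>u. vol T u * vol T u) + integral {S..T} (\<lambda>u. vol T u * vol T u)"
      by (rule Henstock_Kurzweil_Integration.integral_combine[symmetric, OF ST i(4)])
    ultimately show ?thesis by (simp add: log_bond_def s(2) field_simps)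
  qed
  have PT: "PS * exp (log_bond S T + \<mu> + s\<^sup>2 / 2) = PT"
    unfolding PS_def PT_def logPT exp_add by (simp add: mult.assoc)
  have "ln (PT / (K * PS)) = log_bond S T + \<mu> + s\<^sup>2 / 2 - ln K"
    unfolding PT[symmetric] using K by (simp add: PS_def ln_div)
  note ln_eq = this
  have "d_plus V K PT PS = 1 / s * (ln (PT / (K * PS)) + 1 / 2 * s\<^sup>2)"
    unfolding d_plus_def s(2) by (simp add: s_def)
  then have dp: "d_plus V K PT PS = (log_bond S T + \<mu> - ln K + s\<^sup>2) / s"
    unfolding ln_eq using s(1) by (simp add: field_simps)
  have dm: "d_minus V K PT PS = (log_bond S T + \<mu> - ln K) / s"
    unfolding d_minus_def dp s_def[symmetric] using s(1) by (simp add: field_simps power2_eq_square)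
  have "call_price Q \<F> r S T K = (PS * exp (log_bond S T + \<mu> + s\<^sup>2 / 2)) * Phi ((log_bond S T + \<mu> - ln K + s\<^sup>2) / s)
      - K * PS * Phi ((log_bond S T + \<mu> - ln K) / s)"
    using \<open>call_price Q \<F> r S T K = (\<integral>\<omega>. H \<omega> * h (X \<omega>) \<partial>Q)\<close> price by (simp add: algebra_simps)
  then show ?thesis unfolding PT dp dm .
qed

end

theorem proposition3p4:
  fixes Q :: "'w measure"
    and W Y r :: "real \<Rightarrow> 'w \<Rightarrow> real"
    and p q a b \<sigma> r0 S T K :: real
  defines "F \<equiv> augmented_filtration Q W"
  assumes "prob_space Q" and "complete_measure Q"
    and "standard_brownian_motion Q W"
    and "0 < q" and "- q < p"
    and "is_noise_drift Q W p q Y"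
    and "0 < a" and "0 < b" and "0 < \<sigma>" and "0 \<le> r0"
    and "strong_solution Q F (noise W Y) a b \<sigma> r0 r"
    and "0 < T" and "0 < S" and "S < T" and "0 < K"
  shows "AE \<omega> in Q.
    call_price Q F r S T K =
      bond_price Q F r 0 T \<omega> *
        Phi (d_plus (Sigma_sq p q b \<sigma> S T) K (bond_price Q F r 0 T \<omega>) (bond_price Q F r 0 S \<omega>)) -
      K * bond_price Q F r 0 S \<omega> *
        Phi (d_minus (Sigma_sq p q b \<sigma> S T) K (bond_price Q F r 0 T \<omega>) (bond_price Q F r 0 S \<omega>))"
proof -
  interpret P: prob_space Q by fact
  interpret C: complete_measure Q by fact
  interpret short_rate_model Q W p q b \<sigma> a r0 Y r
    by unfold_locales (use assms in auto)
  have TS: "0 \<le> T" "0 \<le> S" using assms by auto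
  show ?thesis
    unfolding F_def
    using AE_bond_price_0[OF TS(1)] AE_bond_price_0[OF TS(2)]
  proof eventually_elim
    case (elim \<omega>)
    then show ?case using call_price_eq[of S T K] assms by simp
  qed
qed

end
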